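(* Let $X$ be an infinite-dimensional complex Banach space, let $F \in \mathcal{B}(X)$, and let $\sigma_{*}$ be any one of the following spectra: $\sigma_{dsc}$, $\sigma^{e}_{dsc}$, $\sigma_{USBF}$, $\sigma_{LSBF}$, $\sigma_{SBF}$, $\sigma_{BF}$, $\sigma_{USBW}$, $\sigma_{LSBW}$, $\sigma_{SBW}$, $\sigma_{BW}$, $\sigma_{USBB}$, $\sigma_{LSBB}$, $\sigma_{SBB}$, $\sigma_{BB}$. Then the following are equivalent: (1) $F^{n}$ is a finite rank operator for some $n \in \mathbb{N}$; (2) $\sigma_{*}(T+F) = \sigma_{*}(T)$ for every $T \in \mathcal{B}(X)$ commuting with $F$.
   Context: $\mathcal{B}(X)$ is the algebra of bounded linear operators on $X$. For $T\in\mathcal{B}(X)$: $\alpha(T)=\dim\mathcal{N}(T)$, $\beta(T)=\operatorname{codim}\mathcal{R}(T)$; $T$ is upper (resp. lower) semi-Fredholm if $\mathcal{R}(T)$ is closed and $\alpha(T)<\infty$ (resp. $\beta(T)<\infty$), Fredholm if both, with index $\operatorname{ind}(T)=\alpha(T)-\beta(T)$. $asc(T)=\inf\{n:\mathcal{N}(T^n)=\mathcal{N}(T^{n+1})\}$, $dsc(T)=\inf\{n:\mathcal{R}(T^n)=\mathcal{R}(T^{n+1})\}$ (infimum of the empty set is $\infty$); $c_n(T)=\dim \mathcal{R}(T^n)/\mathcal{R}(T^{n+1})$ and the essential descent is $dsc_e(T)=\inf\{n: c_n(T)<\infty\}$. $T$ is Browder if Fredholm with $asc(T)=dsc(T)<\infty$;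 upper semi-Browder if upper semi-Fredholm with $asc(T)<\infty$; lower semi-Browder if lower semi-Fredholm with $dsc(T)<\infty$. For $n\in\mathbb{N}$, $T_n$ denotes the restriction of $T$ to $\mathcal{R}(T^n)$ as a map $\mathcal{R}(T^n)\to\mathcal{R}(T^n)$. $T$ is upper semi-B-Fredholm (resp. lower semi-B-Fredholm, B-Fredholm, upper semi-B-Browder, lower semi-B-Browder, B-Browder) if there is $n$ with $\mathcal{R}(T^n)$ closed and $T_n$ upper semi-Fredholm (resp. lower semi-Fredholm, Fredholm, upper semi-Browder, lower semi-Browder, Browder); semi-B-Fredholm means upper or lower semi-B-Fredholm, semi-B-Browder means upper or lower semi-B-Browder. For a semi-B-Fredholm $T$, $\operatorname{ind}(T):=\operatorname{ind}(T_n)$ for any $n$ with $\mathcal{R}(T^n)$ closed and $T_n$ semi-Fredholm (this is independent of $n$). $T$ is B-Weyl if B-Fredholm with index $0$; upper semi-B-Weyl if upper semi-B-Fredholm with index $\le 0$; lower semi-B-Weyl if lower semi-B-Fredholm with index $\ge 0$; semi-B-Weyl if upper or lower semi-B-Weyl. The spectra are: $\sigma_{dsc}(T)=\{\lambda: dsc(T-\lambda I)=\infty\}$, $\sigma^e_{dsc}(T)=\{\lambda: dsc_e(T-\lambda I)=\infty\}$, and $\sigma_{USBF}(T)$, $\sigma_{LSBF}(T)$, $\sigma_{SBF}(T)$, $\sigma_{BF}(T)$, $\sigma_{USBW}(T)$, $\sigma_{LSBW}(T)$, $\sigma_{SBW}(T)$, $\sigma_{BW}(T)$, $\sigma_{USBB}(T)$,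 $\sigma_{LSBB}(T)$, $\sigma_{SBB}(T)$, $\sigma_{BB}(T)$ are the sets of $\lambda\in\mathbb{C}$ for which $T-\lambda I$ is not, respectively, upper semi-B-Fredholm, lower semi-B-Fredholm, semi-B-Fredholm, B-Fredholm, upper semi-B-Weyl, lower semi-B-Weyl, semi-B-Weyl, B-Weyl, upper semi-B-Browder, lower semi-B-Browder, semi-B-Browder, B-Browder. *)

theory Defs
  imports "HOL-Analysis.Analysis" "HOL-Library.Extended_Nat" "HOL-Library.Extended_Real"
begin

definition complex_banach_scale :: "(complex \<Rightarrow> 'a::banach \<Rightarrow> 'a) \<Rightarrow> bool" where
  "complex_banach_scale sc \<longleftrightarrow>
     vector_space sc \<and>
     (\<forall>r x. sc (complex_of_real r) x = r *\<^sub>R x) \<and>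
     (\<forall>c x. norm (sc c x) = cmod c * norm x)"

definition bop :: "(complex \<Rightarrow> 'a::banach \<Rightarrow> 'a) \<Rightarrow> ('a \<Rightarrow> 'a) \<Rightarrow> bool" where
  "bop sc T \<longleftrightarrow> bounded_linear T \<and> (\<forall>c x. T (sc c x) = sc c (T x))"

definition shift :: "(complex \<Rightarrow> 'a::banach \<Rightarrow> 'a) \<Rightarrow> ('a \<Rightarrow> 'a) \<Rightarrow> complex \<Rightarrow> 'a \<Rightarrow> 'a" where
  "shift sc T l = (\<lambda>x. T x - sc l x)"

definition opadd :: "('a::banach \<Rightarrow> 'a) \<Rightarrow> ('a \<Rightarrow> 'a) \<Rightarrow> 'a \<Rightarrow> 'a" where
  "opadd T F = (\<lambda>x. T x + F x)"

definition cdim :: "(complex \<Rightarrow> 'a::banach \<Rightarrow> 'a) \<Rightarrow> 'a set \<Rightarrow> enat" where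
  "cdim sc S = (if \<exists>B. finite B \<and> B \<subseteq> S \<and> S \<subseteq> module.span sc B
                then enat (vector_space.dim sc S) else \<infinity>)"

definition is_complement :: "(complex \<Rightarrow> 'a::banach \<Rightarrow> 'a) \<Rightarrow> 'a set \<Rightarrow> 'a set \<Rightarrow> 'a set \<Rightarrow> bool" where
  "is_complement sc M R C \<longleftrightarrow> module.subspace sc C \<and> C \<subseteq> M \<and> C \<inter> R = {0} \<and>
      {x + y | x y. x \<in> R \<and> y \<in> C} = M"

text \<open>codim of R in M = dim (M / R) = dim of any algebraic complement of R in M.\<close>
definition rcodim :: "(complex \<Rightarrow> 'a::banach \<Rightarrow> 'a) \<Rightarrow> 'a set \<Rightarrow> 'a set \<Rightarrow> enat" where
  "rcodim sc M R = cdim sc (SOME C. is_complement sc M R C)"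

section \<open>Notions for an operator T regarded as an operator on an invariant subspace M\<close>

definition kern_on :: "('a::banach \<Rightarrow> 'a) \<Rightarrow> 'a set \<Rightarrow> 'a set" where
  "kern_on T M = {x \<in> M. T x = 0}"

definition alpha_on :: "(complex \<Rightarrow> 'a::banach \<Rightarrow> 'a) \<Rightarrow> ('a \<Rightarrow> 'a) \<Rightarrow> 'a set \<Rightarrow> enat" where
  "alpha_on sc T M = cdim sc (kern_on T M)"

definition beta_on :: "(complex \<Rightarrow> 'a::banach \<Rightarrow> 'a) \<Rightarrow> ('a \<Rightarrow> 'a) \<Rightarrow> 'a set \<Rightarrow> enat" where
  "beta_on sc T M = rcodim sc M (T ` M)"

definition asc_on :: "('a::banach \<Rightarrow> 'a) \<Rightarrow> 'a set \<Rightarrow> enat" where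
  "asc_on T M = (if \<exists>n. kern_on (T ^^ n) M = kern_on (T ^^ Suc n) M
                 then enat (LEAST n. kern_on (T ^^ n) M = kern_on (T ^^ Suc n) M) else \<infinity>)"

definition dsc_on :: "('a::banach \<Rightarrow> 'a) \<Rightarrow> 'a set \<Rightarrow> enat" where
  "dsc_on T M = (if \<exists>n. (T ^^ n) ` M = (T ^^ Suc n) ` M
                 then enat (LEAST n. (T ^^ n) ` M = (T ^^ Suc n) ` M) else \<infinity>)"

text \<open>(Closedness of the range in M; M will always be closed here, so this equals closedness in X.)\<close>
definition upper_sf_on :: "(complex \<Rightarrow> 'a::banach \<Rightarrow> 'a) \<Rightarrow> ('a \<Rightarrow> 'a) \<Rightarrow> 'a set \<Rightarrow> bool" where
  "upper_sf_on sc T M \<longleftrightarrow> closed (T ` M) \<and> alpha_on sc T M \<noteq> \<infinity>"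

definition lower_sf_on :: "(complex \<Rightarrow> 'a::banach \<Rightarrow> 'a) \<Rightarrow> ('a \<Rightarrow> 'a) \<Rightarrow> 'a set \<Rightarrow> bool" where
  "lower_sf_on sc T M \<longleftrightarrow> closed (T ` M) \<and> beta_on sc T M \<noteq> \<infinity>"

definition fredholm_on :: "(complex \<Rightarrow> 'a::banach \<Rightarrow> 'a) \<Rightarrow> ('a \<Rightarrow> 'a) \<Rightarrow> 'a set \<Rightarrow> bool" where
  "fredholm_on sc T M \<longleftrightarrow> upper_sf_on sc T M \<and> lower_sf_on sc T M"

text \<open>index alpha - beta (as an extended real; semi-Fredholm ensures it is defined).\<close>
definition ind_on :: "(complex \<Rightarrow> 'a::banach \<Rightarrow> 'a) \<Rightarrow> ('a \<Rightarrow> 'a) \<Rightarrow> 'a set \<Rightarrow> ereal" where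
  "ind_on sc T M = ereal_of_enat (alpha_on sc T M) - ereal_of_enat (beta_on sc T M)"

definition upper_sb_on :: "(complex \<Rightarrow> 'a::banach \<Rightarrow> 'a) \<Rightarrow> ('a \<Rightarrow> 'a) \<Rightarrow> 'a set \<Rightarrow> bool" where
  "upper_sb_on sc T M \<longleftrightarrow> upper_sf_on sc T M \<and> asc_on T M \<noteq> \<infinity>"

definition lower_sb_on :: "(complex \<Rightarrow> 'a::banach \<Rightarrow> 'a) \<Rightarrow> ('a \<Rightarrow> 'a) \<Rightarrow> 'a set \<Rightarrow> bool" where
  "lower_sb_on sc T M \<longleftrightarrow> lower_sf_on sc T M \<and> dsc_on T M \<noteq> \<infinity>"

definition browder_on :: "(complex \<Rightarrow> 'a::banach \<Rightarrow> 'a) \<Rightarrow> ('a \<Rightarrow> 'a) \<Rightarrow> 'a set \<Rightarrow> bool" where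
  "browder_on sc T M \<longleftrightarrow> fredholm_on sc T M \<and> asc_on T M = dsc_on T M \<and> asc_on T M \<noteq> \<infinity>"

section \<open>B-notions: T_n = T restricted to R(T^n)\<close>

definition B_prop :: "(('a::banach \<Rightarrow> 'a) \<Rightarrow> 'a set \<Rightarrow> bool) \<Rightarrow> ('a \<Rightarrow> 'a) \<Rightarrow> bool" where
  "B_prop P T \<longleftrightarrow> (\<exists>n. closed (range (T ^^ n)) \<and> P T (range (T ^^ n)))"

definition upper_sbf :: "(complex \<Rightarrow> 'a::banach \<Rightarrow> 'a) \<Rightarrow> ('a \<Rightarrow> 'a) \<Rightarrow> bool" where
  "upper_sbf sc = B_prop (upper_sf_on sc)"
definition lower_sbf :: "(complex \<Rightarrow> 'a::banach \<Rightarrow> 'a) \<Rightarrow> ('a \<Rightarrow> 'a) \<Rightarrow> bool" where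
  "lower_sbf sc = B_prop (lower_sf_on sc)"
definition b_fredholm :: "(complex \<Rightarrow> 'a::banach \<Rightarrow> 'a) \<Rightarrow> ('a \<Rightarrow> 'a) \<Rightarrow> bool" where
  "b_fredholm sc = B_prop (fredholm_on sc)"
definition upper_sbb :: "(complex \<Rightarrow> 'a::banach \<Rightarrow> 'a) \<Rightarrow> ('a \<Rightarrow> 'a) \<Rightarrow> bool" where
  "upper_sbb sc = B_prop (upper_sb_on sc)"
definition lower_sbb :: "(complex \<Rightarrow> 'a::banach \<Rightarrow> 'a) \<Rightarrow> ('a \<Rightarrow> 'a) \<Rightarrow> bool" where
  "lower_sbb sc = B_prop (lower_sb_on sc)"
definition b_browder :: "(complex \<Rightarrow> 'a::banach \<Rightarrow> 'a) \<Rightarrow> ('a \<Rightarrow> 'a) \<Rightarrow> bool" where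
  "b_browder sc = B_prop (browder_on sc)"

text \<open>Weyl-type notions: the index ind(T) = ind(T_n) for any admissible n (independent of n).\<close>
definition upper_sbw :: "(complex \<Rightarrow> 'a::banach \<Rightarrow> 'a) \<Rightarrow> ('a \<Rightarrow> 'a) \<Rightarrow> bool" where
  "upper_sbw sc = B_prop (\<lambda>T M. upper_sf_on sc T M \<and> ind_on sc T M \<le> 0)"
definition lower_sbw :: "(complex \<Rightarrow> 'a::banach \<Rightarrow> 'a) \<Rightarrow> ('a \<Rightarrow> 'a) \<Rightarrow> bool" where
  "lower_sbw sc = B_prop (\<lambda>T M. lower_sf_on sc T M \<and> ind_on sc T M \<ge> 0)"
definition b_weyl :: "(complex \<Rightarrow> 'a::banach \<Rightarrow> 'a) \<Rightarrow> ('a \<Rightarrow> 'a) \<Rightarrow> bool" where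
  "b_weyl sc = B_prop (\<lambda>T M. fredholm_on sc T M \<and> ind_on sc T M = 0)"

definition dsc :: "('a::banach \<Rightarrow> 'a) \<Rightarrow> enat" where
  "dsc T = dsc_on T UNIV"

definition c_num :: "(complex \<Rightarrow> 'a::banach \<Rightarrow> 'a) \<Rightarrow> ('a \<Rightarrow> 'a) \<Rightarrow> nat \<Rightarrow> enat" where
  "c_num sc T n = rcodim sc (range (T ^^ n)) (range (T ^^ Suc n))"

definition dsc_e :: "(complex \<Rightarrow> 'a::banach \<Rightarrow> 'a) \<Rightarrow> ('a \<Rightarrow> 'a) \<Rightarrow> enat" where
  "dsc_e sc T = (if \<exists>n. c_num sc T n \<noteq> \<infinity> then enat (LEAST n. c_num sc T n \<noteq> \<infinity>) else \<infinity>)"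

datatype spec_kind = DSC | EDSC | USBF | LSBF | SBF | BF | USBW | LSBW | SBW | BW
  | USBB | LSBB | SBB | BB

fun spec_prop :: "(complex \<Rightarrow> 'a::banach \<Rightarrow> 'a) \<Rightarrow> spec_kind \<Rightarrow> ('a \<Rightarrow> 'a) \<Rightarrow> bool" where
  "spec_prop sc DSC S = (dsc S \<noteq> \<infinity>)"
| "spec_prop sc EDSC S = (dsc_e sc S \<noteq> \<infinity>)"
| "spec_prop sc USBF S = upper_sbf sc S"
| "spec_prop sc LSBF S = lower_sbf sc S"
| "spec_prop sc SBF S = (upper_sbf sc S \<or> lower_sbf sc S)"
| "spec_prop sc BF S = b_fredholm sc S"
| "spec_prop sc USBW S = upper_sbw sc S"
| "spec_prop sc LSBW S = lower_sbw sc S"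
| "spec_prop sc SBW S = (upper_sbw sc S \<or> lower_sbw sc S)"
| "spec_prop sc BW S = b_weyl sc S"
| "spec_prop sc USBB S = upper_sbb sc S"
| "spec_prop sc LSBB S = lower_sbb sc S"
| "spec_prop sc SBB S = (upper_sbb sc S \<or> lower_sbb sc S)"
| "spec_prop sc BB S = b_browder sc S"

definition spectrum_k :: "(complex \<Rightarrow> 'a::banach \<Rightarrow> 'a) \<Rightarrow> spec_kind \<Rightarrow> ('a \<Rightarrow> 'a) \<Rightarrow> complex set" where
  "spectrum_k sc k T = {l. \<not> spec_prop sc k (shift sc T l)}"

definition finite_rank :: "(complex \<Rightarrow> 'a::banach \<Rightarrow> 'a) \<Rightarrow> ('a \<Rightarrow> 'a) \<Rightarrow> bool" where
  "finite_rank sc F \<longleftrightarrow> cdim sc (range F) \<noteq> \<infinity>"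

end

theory Submission
  imports Defs "HOL-Complex_Analysis.Cauchy_Integral_Formula"
begin

text \<open>
  If \<open>F\<close> commutes with \<open>T\<close> and \<open>F^d\<close> has finite rank, then \<open>(T + F)^(k + d) = T^k G + F^d H\<close>. Hence
  the ranges and kernels of the powers of \<open>T + F\<close> and of \<open>T\<close> interlace up to subspaces of bounded
  finite dimension, and each of the properties defining the spectra passes from \<open>T\<close> to \<open>T + F\<close>. The index
  is preserved because the index of \<open>T^m\<close> is \<open>m\<close> times that of \<open>T\<close>, while the indices of \<open>T^m\<close> and
  \<open>(T + F)^m\<close> differ by a bounded amount.

  Conversely, taking \<open>T = 0\<close> shows that the spectrum of \<open>F\<close> is empty, so that every \<open>F - \<lambda>\<close> has
  topological uniform descent. At a boundary point of the ordinary spectrum this makes \<open>\<lambda>\<close> a pole; as poles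
  are isolated, the closure of the resolvent set is open, so \<open>F\<close> has finite spectrum consisting of poles
  and is algebraic by Liouville's theorem. If no power of \<open>F\<close> has finite rank, then some \<open>N = F - \<lambda>\<close>
  with \<open>\<lambda> \<noteq> 0\<close> has an infinite-dimensional generalised kernel \<open>Z\<close>. An infinite combination of operators
  \<open>\<Sum>\<^sub>i N^i (x \<otimes> f) N^(q-i)\<close> then gives \<open>T\<close> in the commutant of \<open>F\<close>, supported on \<open>Z\<close>, with infinitely many
  eigenvalues. By the previous step \<open>T - \<mu>\<close> lacks uniform descent for some \<open>\<mu>\<close>, so by invariance
  \<open>\<mu>\<close> lies in the spectrum of every \<open>T + m F\<close>; but for large \<open>m\<close> the operator \<open>T + m F - \<mu>\<close> is
  invertible on \<open>Z\<close> and has a pole on the complement.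
\<close>

section \<open>Preliminaries\<close>

text \<open>The fourteen properties enter the converse only through two facts: a pole has all of
  them, and each of them implies uniform descent. One argument therefore serves every
  \<open>k\<close>. Uniform descent asks for closedness of \<open>R(T^n) + N(T^p)\<close> rather
  than of ranges, because finite (essential) descent says nothing about closed ranges. In the direct
  part dimension counts do not settle closedness of the perturbed ranges. On the lower side, an
  operator range of finite codimension in a closed space is closed by the open mapping theorem; on
  the upper side, the semi-Fredholm property is recast as a compactness property of bounded
  sequences that survives commuting perturbation. The point \<lambda> must be nonzero so that
  multiples of F can outgrow T: on \<open>Z\<close> the operator F is \<lambda> plus a nilpotent, so
  \<open>T + m F - \<mu>\<close> is there \<open>T + (m \<lambda> - \<mu>)\<close> plus a commuting
  nilpotent. Such a \<lambda> exists because otherwise a product of powers of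
  \<open>F - \<lambda>\<close> over the nonzero spectrum would have a finite-dimensional kernel
  containing the range of a power of F.\<close>

lemma bounded_nat_attains_max:
  assumes "\<And>k. c k \<le> (r::nat)" shows "\<exists>k0. \<forall>k. c k \<le> c k0"
proof -
  have "finite (range c)" using assms by (metis finite_atMost finite_subset atMost_iff image_subsetI)
  then have "\<forall>k. c k \<le> Max (range c)" "Max (range c) \<in> range c" by (auto intro: Max_in)
  then show ?thesis by (metis rangeE)
qed

lemma enat_finite_le: "x \<le> y \<Longrightarrow> y \<noteq> \<infinity> \<Longrightarrow> x \<noteq> (\<infinity>::enat)"
  by (cases x; cases y) auto

lemma enat_finite_le_enat: "x \<le> enat r \<Longrightarrow> x \<noteq> \<infinity>"
  by (cases x) auto

lemma enat_finite_le_add: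
  "x \<le> a + b \<Longrightarrow> a \<noteq> \<infinity> \<Longrightarrow> b \<noteq> \<infinity> \<Longrightarrow> x \<noteq> (\<infinity>::enat)"
  by (cases x; cases a; cases b) auto

lemma enat_eq_add_self: "(a::enat) = a + b \<Longrightarrow> a \<noteq> \<infinity> \<Longrightarrow> b = 0"
  by (cases a; cases b) (auto simp: zero_enat_def)

lemma ereal_of_enat_diff_le_0:
  "a \<noteq> \<infinity> \<Longrightarrow> ereal_of_enat a - ereal_of_enat c \<le> 0 \<longleftrightarrow> a \<le> c"
  by (cases a; cases c) (auto simp: zero_ereal_def)

lemma ereal_of_enat_diff_ge_0:
  "c \<noteq> \<infinity> \<Longrightarrow> 0 \<le> ereal_of_enat a - ereal_of_enat c \<longleftrightarrow> c \<le> a"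
  by (cases a; cases c) (auto simp: zero_ereal_def)

lemma funpow_commute:
  assumes "\<And>x. A (B x) = B (A x)" shows "(A ^^ n) (B x) = B ((A ^^ n) x)"
  by (induction n) (auto simp: assms)

lemma range_funpow_add: "range (T ^^ (j + n)) = (T ^^ j) ` range (T ^^ n)"
  by (simp add: funpow_add image_comp)

lemma range_funpow_Suc: "range (T ^^ Suc n) = T ` range (T ^^ n)"
  by (simp add: image_comp)

lemma range_funpow_antimono:
  fixes T :: "'b \<Rightarrow> 'b"
  shows "m \<le> n \<Longrightarrow> range (T ^^ n) \<subseteq> range (T ^^ m)"
proof -
  assume "m \<le> n"
  then have "T ^^ n = (T ^^ m) \<circ> (T ^^ (n - m))" by (simp add: funpow_add[symmetric])
  then show ?thesis by auto
qed

lemma range_stable: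
  fixes T :: "'b \<Rightarrow> 'b"
  assumes "range (T ^^ p) = range (T ^^ Suc p)" "p \<le> m" shows "range (T ^^ m) = range (T ^^ p)"
  using assms(2)
proof (induction m rule: dec_induct)
  case (step m)
  have "range (T ^^ Suc m) = T ` range (T ^^ p)" using step by (simp only: range_funpow_Suc)
  also have "\<dots> = range (T ^^ p)" using assms(1) by (simp only: range_funpow_Suc)
  finally show ?case .
qed simp

lemma ker_stable:
  fixes T :: "'b::zero \<Rightarrow> 'b"
  assumes "{x. (T ^^ p) x = 0} = {x. (T ^^ Suc p) x = 0}" "p \<le> m"
  shows "{x. (T ^^ m) x = 0} = {x. (T ^^ p) x = 0}"
  using assms(2)
proof (induction m rule: dec_induct)
  case (step m)
  have "(T ^^ Suc m) x = 0 \<longleftrightarrow> (T ^^ p) x = 0" for x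
  proof -
    have "(T ^^ Suc m) x = 0 \<longleftrightarrow> (T ^^ m) (T x) = 0" by (simp add: funpow_swap1)
    also have "\<dots> \<longleftrightarrow> (T ^^ p) (T x) = 0" using step by blast
    also have "\<dots> \<longleftrightarrow> (T ^^ Suc p) x = 0" by (simp add: funpow_swap1)
    also have "\<dots> \<longleftrightarrow> (T ^^ p) x = 0" using assms(1) by blast
    finally show ?thesis .
  qed
  then show ?case by (simp only:)
qed simp

lemma infdist_approx:
  assumes "A \<noteq> {}" "e > 0" obtains a where "a \<in> A" "dist x a < infdist x A + e"
proof -
  have "\<exists>a\<in>A. dist x a < infdist x A + e"
  proof (rule ccontr)
    assume "\<not> ?thesis"
    then have "infdist x A + e \<le> (INF a\<in>A. dist x a)"
      using assms(1) by (intro cINF_greatest) auto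
    then show False using assms by (simp add: infdist_notempty)
  qed
  with that show ?thesis by blast
qed

section \<open>Dimension of quotients of vector spaces\<close>

locale quotient_dimension = vector_space scale
  for scale :: "'a::field \<Rightarrow> 'b::ab_group_add \<Rightarrow> 'b"
begin

lemma independent_Un:
  assumes A: "independent A" and B: "independent B" and AB: "span A \<inter> span B \<subseteq> {0}"
  shows "independent (A \<union> B)"
  unfolding independent_explicit_finite_subsets
proof (intro allI impI ballI)
  fix S u v
  assume S: "S \<subseteq> A \<union> B" "finite S" and s: "(\<Sum>v\<in>S. scale (u v) v) = 0" and v: "v \<in> S"
  let ?x = "\<Sum>v\<in>S \<inter> A. scale (u v) v" and ?y = "\<Sum>v\<in>S - A. scale (u v) v"
  have "?x + ?y = 0"
    using s sum.Int_Diff[OF S(2), of "\<lambda>v. scale (u v) v" A] by simp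
  then have xy: "?x = - ?y" by (simp add: eq_neg_iff_add_eq_0)
  have x: "?x \<in> span A" by (rule span_sum) (auto intro: span_scale span_base)
  have "?y \<in> span B" using S(1) by (intro span_sum) (auto intro: span_scale span_base)
  then have "?x \<in> span B" using xy span_neg by metis
  with x AB have x0: "?x = 0" by auto
  with xy have y0: "?y = 0" by simp
  show "u v = 0"
  proof (cases "v \<in> A")
    case True
    with independentD[OF A _ _ x0] S v show ?thesis by auto
  next
    case False
    with independentD[OF B _ _ y0] S v show ?thesis by auto
  qed
qed

text \<open>The dimension of \<open>(A + B)/B\<close>.\<close>
definition qdim :: "'b set \<Rightarrow> 'b set \<Rightarrow> enat" where
  "qdim A B = (INF G \<in> {G. finite G \<and> A \<subseteq> span (B \<union> G)}. enat (card G))"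

lemma qdim_le: "finite G \<Longrightarrow> A \<subseteq> span (B \<union> G) \<Longrightarrow> qdim A B \<le> enat (card G)"
  unfolding qdim_def by (rule INF_lower) simp

lemma qdim_attained:
  assumes "qdim A B \<noteq> \<infinity>"
  obtains G where "finite G" "A \<subseteq> span (B \<union> G)" "qdim A B = enat (card G)"
proof -
  let ?X = "(\<lambda>G. enat (card G)) ` {G. finite G \<and> A \<subseteq> span (B \<union> G)}"
  have "?X \<noteq> {}" using assms unfolding qdim_def Inf_enat_def by metis
  then obtain x where "x \<in> ?X" by blast
  then have "(LEAST x. x \<in> ?X) \<in> ?X" by (rule LeastI)
  moreover have "qdim A B = (LEAST x. x \<in> ?X)"
    using \<open>?X \<noteq> {}\<close> unfolding qdim_def Inf_enat_def by (simp only: if_False)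
  ultimately show ?thesis using that by auto
qed

lemma qdim_mono:
  assumes "A' \<subseteq> A" "B \<subseteq> B'" shows "qdim A' B' \<le> qdim A B"
proof (cases "qdim A B = \<infinity>")
  case False
  then obtain G where G: "finite G" "A \<subseteq> span (B \<union> G)" "qdim A B = enat (card G)"
    by (rule qdim_attained)
  have "span (B \<union> G) \<subseteq> span (B' \<union> G)" using assms(2) by (intro span_mono) auto
  with G assms show ?thesis by (metis qdim_le order_trans)
qed simp

text \<open>A triangle inequality for arbitrary sets: finite-dimensional errors add up along a chain
  of ranges or kernels. The interlacing arguments below are built from it.\<close>

lemma qdim_trans: "qdim A C \<le> qdim A B + qdim B C"
proof (cases "qdim A B = \<infinity> \<or> qdim B C = \<infinity>")
  case False
  then obtain G H where G: "finite G" "A \<subseteq> span (B \<union> G)" "qdim A B = enat (card G)"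
    and H: "finite H" "B \<subseteq> span (C \<union> H)" "qdim B C = enat (card H)"
    by (metis qdim_attained)
  have "span (C \<union> H) \<subseteq> span (C \<union> (G \<union> H))" "G \<subseteq> span (C \<union> (G \<union> H))"
    by (auto intro!: span_mono span_base)
  with H have "B \<union> G \<subseteq> span (C \<union> (G \<union> H))" by auto
  then have "span (B \<union> G) \<subseteq> span (C \<union> (G \<union> H))" by (simp add: span_minimal)
  then have "qdim A C \<le> enat (card (G \<union> H))" using G H by (intro qdim_le) auto
  also have "\<dots> \<le> enat (card G + card H)" by (simp add: card_Un_le)
  finally show ?thesis using G H by simp
qed auto

lemma qdim_eq_0: "A \<subseteq> B \<Longrightarrow> qdim A B = 0"
  using qdim_le[of "{}" A B] span_superset[of B] by (auto simp: enat_0)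

lemma qdim_eq_0_iff: "subspace B \<Longrightarrow> qdim A B = 0 \<longleftrightarrow> A \<subseteq> B"
proof
  assume B: "subspace B" and q: "qdim A B = 0"
  then obtain G where "finite G" "A \<subseteq> span (B \<union> G)" "qdim A B = enat (card G)"
    using qdim_attained[of A B] by (metis infinity_ne_i0)
  with q have "A \<subseteq> span B" by (auto simp: zero_enat_def)
  with B show "A \<subseteq> B" by (metis span_eq_iff)
qed (rule qdim_eq_0)

lemma relative_basis_exists:
  assumes A: "subspace A" and B: "subspace B" and BA: "B \<subseteq> A"
  obtains H where "H \<subseteq> A" "independent H" "span H \<inter> B = {0}" "A = span (B \<union> H)"
proof -
  obtain K where K: "K \<subseteq> B" "independent K" "B \<subseteq> span K" by (rule maximal_independent_subset)
  obtain L where L: "K \<subseteq> L" "L \<subseteq> A" "independent L" "A \<subseteq> span L"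
    by (rule maximal_independent_subset_extend[OF order_trans[OF K(1) BA] K(2)])
  have spK: "span K = B" using K B by (simp add: span_subspace)
  show ?thesis
  proof
    show "L - K \<subseteq> A" using L by auto
    show "independent (L - K)" using L independent_mono by blast
    show "span (L - K) \<inter> B = {0}"
    proof -
      have "x = 0" if x1: "x \<in> span (L - K)" and x2: "x \<in> span K" for x
      proof -
        have eq: "representation L x = representation (L - K) x"
          using L x1 by (intro representation_extend) auto
        have eq2: "representation L x = representation K x"
          using L x2 by (intro representation_extend) auto
        \<comment> \<open>The \<open>L\<close>-coordinates of \<open>x\<close> live on
          \<open>L - K\<close> by one equation and on \<open>K\<close> by the other, so all of them
          vanish.\<close>
        have z: "representation L x v = 0" for v
        proof (cases "v \<in> K")
          case True
          then show ?thesis unfolding eq using representation_ne_zero[of "L - K" x v] by auto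
        next
          case False
          then show ?thesis unfolding eq2 using representation_ne_zero[of K x v] by auto
        qed
        have "x \<in> span L" using x2 L(1) span_mono by blast
        then have "(\<Sum>v | representation L x v \<noteq> 0. scale (representation L x v) v) = x"
          using L(3) by (intro sum_nonzero_representation_eq)
        then show "x = 0" using z by simp
      qed
      then show ?thesis using spK B by (auto intro: span_zero subspace_0)
    qed
    have "span (B \<union> (L - K)) = span L"
    proof
      show "span (B \<union> (L - K)) \<subseteq> span L"
        using L K spK span_mono[OF L(1)] by (intro span_minimal) (auto intro: span_base)
      show "span L \<subseteq> span (B \<union> (L - K))" using K by (intro span_mono) auto
    qed
    then show "A = span (B \<union> (L - K))" using L A by (simp add: span_subspace)
  qed
qed

text \<open>Exchange argument: a relative basis attains the infimum. The infinite case is included,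
  so \<open>qdim\<close> is the dimension of the quotient also when that is infinite.\<close>

lemma qdim_relative_basis:
  assumes B: "subspace B" and H: "independent H" "span H \<inter> B \<subseteq> {0}" and A: "A = span (B \<union> H)"
  shows "qdim A B = (if finite H then enat (card H) else \<infinity>)"
proof -
  have bound: "finite H \<and> card H \<le> card G" if G: "finite G" "A \<subseteq> span (B \<union> G)" for G
  proof -
    have fin: "card F \<le> card G" if F: "F \<subseteq> H" "finite F" for F
    proof -
      obtain K where K: "K \<subseteq> B" "independent K" "B \<subseteq> span K" by (rule maximal_independent_subset)
      have spK: "span K = B" using K B by (simp add: span_subspace)
      have "span F \<inter> span K \<subseteq> {0}" using H F span_mono[of F H] spK by auto
      then have ind: "independent (F \<union> K)"
        using F H K independent_mono by (intro independent_Un) auto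
      have "span (B \<union> G) \<subseteq> span (K \<union> G)"
        using spK span_mono[of K "K \<union> G"] by (intro span_minimal) (auto intro: span_base)
      then have FKG: "F \<subseteq> span (K \<union> G)"
        using F A G span_superset[of "B \<union> H"] by (meson Un_subset_iff order_trans)
      \<comment> \<open>The exchange lemma needs a finite spanning set, whereas \<open>K\<close> may
        be infinite. Each vector of \<open>F\<close> uses only finitely many elements of
        \<open>K\<close>; adding these to both sides lets them cancel in the count.\<close>
      have "\<exists>K0. finite K0 \<and> K0 \<subseteq> K \<and> x \<in> span (K0 \<union> G)" if "x \<in> F" for x
      proof -
        from that FKG obtain t r where t: "finite t" "t \<subseteq> K \<union> G" "x = (\<Sum>a\<in>t. scale (r a) a)"
          unfolding span_explicit by blast
        then have "x \<in> span ((t \<inter> K) \<union> G)" by (auto intro!: span_sum span_scale intro: span_base)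
        then show ?thesis using t by (intro exI[of _ "t \<inter> K"]) auto
      qed
      then obtain k where k: "\<And>x. x \<in> F \<Longrightarrow> finite (k x) \<and> k x \<subseteq> K \<and> x \<in> span (k x \<union> G)"
        by metis
      let ?K = "\<Union>(k ` F)"
      have Kf: "finite ?K" "?K \<subseteq> K" using k F by auto
      have "F \<union> ?K \<subseteq> span (?K \<union> G)"
      proof -
        have "x \<in> span (?K \<union> G)" if "x \<in> F" for x
          using k[OF that] that span_mono[of "k x \<union> G" "?K \<union> G"] by blast
        then show ?thesis by (auto intro: span_base)
      qed
      moreover have "independent (F \<union> ?K)" using ind Kf independent_mono by (metis Un_mono order_refl)
      ultimately have "card (F \<union> ?K) \<le> card (?K \<union> G)"
        using independent_span_bound[of "?K \<union> G" "F \<union> ?K"] Kf G by auto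
      moreover have "F \<inter> ?K = {}"
      proof -
        have "x = 0" if "x \<in> F" "x \<in> K" for x
          using that H F spK span_base[of x H] span_base[of x K] by auto
        moreover have "0 \<notin> F" using H F dependent_zero by blast
        ultimately show ?thesis using Kf by blast
      qed
      ultimately have "card F + card ?K \<le> card ?K + card G"
        using F Kf card_Un_le[of ?K G] by (simp add: card_Un_disjoint)
      then show ?thesis by simp
    qed
    have "finite H"
    proof (rule ccontr)
      assume "infinite H"
      then obtain F where "F \<subseteq> H" "finite F" "card F = Suc (card G)"
        using infinite_arbitrarily_large by metis
      with fin[of F] show False by simp
    qed
    with fin show ?thesis by blast
  qed
  show ?thesis
  proof (cases "finite H")
    case True
    have "qdim A B \<le> enat (card H)" using True A by (intro qdim_le) auto
    moreover have "enat (card H) \<le> qdim A B"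
      using bound unfolding qdim_def by (intro INF_greatest) auto
    ultimately show ?thesis using True by auto
  next
    case False
    then have "\<not> (finite G \<and> A \<subseteq> span (B \<union> G))" for G using bound by auto
    then have "qdim A B = \<infinity>" by (metis qdim_attained)
    then show ?thesis using False by simp
  qed
qed

lemma qdim_attained_subset:
  assumes "subspace A" "subspace B" "B \<subseteq> A" "qdim A B \<noteq> \<infinity>"
  obtains H where "finite H" "H \<subseteq> A" "independent H" "span H \<inter> B = {0}" "A = span (B \<union> H)"
    "qdim A B = enat (card H)"
proof -
  obtain H where H: "H \<subseteq> A" "independent H" "span H \<inter> B = {0}" "A = span (B \<union> H)"
    using relative_basis_exists[OF assms(1-3)] .
  with qdim_relative_basis[of B H A] assms that show ?thesis by (auto split: if_splits)
qed

lemma qdim_add: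
  assumes "subspace A" "subspace B" "subspace C" "C \<subseteq> B" "B \<subseteq> A"
  shows "qdim A C = qdim A B + qdim B C"
proof -
  obtain H where H: "H \<subseteq> A" "independent H" "span H \<inter> B = {0}" "A = span (B \<union> H)"
    using relative_basis_exists[of A B] assms by metis
  obtain K where K: "K \<subseteq> B" "independent K" "span K \<inter> C = {0}" "B = span (C \<union> K)"
    using relative_basis_exists[of B C] assms by metis
  have KB: "span K \<subseteq> B" using K assms(2) by (simp add: span_minimal)
  have ind: "independent (H \<union> K)" using H K KB by (intro independent_Un) auto
  have disj: "H \<inter> K = {}"
  proof -
    have "x = 0" if "x \<in> H" "x \<in> K" for x using that H K span_base[of x H] by auto
    moreover have "0 \<notin> H" using H dependent_zero by blast
    ultimately show ?thesis by blast
  qed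
  have "span (H \<union> K) \<inter> C \<subseteq> {0}"
  proof
    fix x assume x: "x \<in> span (H \<union> K) \<inter> C"
    then obtain h k where hk: "x = h + k" "h \<in> span H" "k \<in> span K" unfolding span_Un by auto
    have "x - k \<in> B" using x hk KB assms by (intro subspace_diff) auto
    then have "h = 0" using hk H(3) by auto
    then show "x \<in> {0}" using x hk K(3) by auto
  qed
  moreover have "A = span (C \<union> (H \<union> K))"
  proof
    have "span (C \<union> K) \<subseteq> span (C \<union> (H \<union> K))" by (intro span_mono) auto
    then have "B \<union> H \<subseteq> span (C \<union> (H \<union> K))" using K(4) by (auto intro: span_base)
    then show "A \<subseteq> span (C \<union> (H \<union> K))" using H(4) by (simp add: span_minimal)
    show "span (C \<union> (H \<union> K)) \<subseteq> A" using assms H K by (intro span_minimal) auto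
  qed
  ultimately have "qdim A C = (if finite (H \<union> K) then enat (card (H \<union> K)) else \<infinity>)"
    by (intro qdim_relative_basis ind assms)
  moreover have "qdim A B = (if finite H then enat (card H) else \<infinity>)"
    using H by (intro qdim_relative_basis assms) auto
  moreover have "qdim B C = (if finite K then enat (card K) else \<infinity>)"
    using K by (intro qdim_relative_basis assms) auto
  ultimately show ?thesis using disj by (auto simp: card_Un_disjoint)
qed

text \<open>Second isomorphism theorem: a basis of \<open>A\<close> relative to
  \<open>A \<inter> B\<close> is also a basis of \<open>A + B\<close> relative to
  \<open>B\<close>.\<close>

lemma qdim_sum:
  assumes A: "subspace A" and B: "subspace B"
  shows "qdim (span (A \<union> B)) B = qdim A (A \<inter> B)"
proof -
  have I: "subspace (A \<inter> B)" using assms by (rule subspace_inter)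
  obtain H where H: "H \<subseteq> A" "independent H" "span H \<inter> (A \<inter> B) = {0}" "A = span ((A \<inter> B) \<union> H)"
    using relative_basis_exists[OF A I] by blast
  have HA: "span H \<subseteq> A" using H A by (simp add: span_minimal)
  then have "span H \<inter> B \<subseteq> {0}" using H by auto
  moreover have "span (A \<union> B) = span (B \<union> H)"
  proof
    have "span ((A \<inter> B) \<union> H) \<subseteq> span (B \<union> H)" by (intro span_mono) auto
    then have "A \<subseteq> span (B \<union> H)" using H(4) by simp
    then show "span (A \<union> B) \<subseteq> span (B \<union> H)" by (intro span_minimal) (auto intro: span_base)
    show "span (B \<union> H) \<subseteq> span (A \<union> B)" using H by (intro span_mono) auto
  qed
  ultimately have "qdim (span (A \<union> B)) B = (if finite H then enat (card H) else \<infinity>)"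
    by (intro qdim_relative_basis H B)
  moreover have "qdim A (A \<inter> B) = (if finite H then enat (card H) else \<infinity>)"
    using qdim_relative_basis[OF I H(2)] H by auto
  ultimately show ?thesis by simp
qed

lemma qdim_Int:
  assumes A: "subspace A" and B: "subspace B"
  shows "qdim A (A \<inter> B) = qdim A B"
proof (rule antisym)
  have "qdim (span (A \<union> B)) B \<le> qdim (span (A \<union> B)) (A \<union> B) + qdim (A \<union> B) B"
    by (rule qdim_trans)
  also have "qdim (span (A \<union> B)) (A \<union> B) = 0"
    using qdim_le[of "{}" "span (A \<union> B)" "A \<union> B"] by (auto simp: enat_0)
  also have "qdim (A \<union> B) B \<le> qdim A B"
  proof (cases "qdim A B = \<infinity>")
    case False
    then obtain G where G: "finite G" "A \<subseteq> span (B \<union> G)" "qdim A B = enat (card G)"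
      by (rule qdim_attained)
    then show ?thesis by (auto intro!: qdim_le intro: span_base)
  qed simp
  finally show "qdim A (A \<inter> B) \<le> qdim A B" using qdim_sum[OF assms] by simp
qed (auto intro: qdim_mono)

lemma qdim_Int_mono:
  assumes "subspace A" "subspace B" "subspace C"
  shows "qdim (A \<inter> C) (B \<inter> C) \<le> qdim A B"
proof -
  have "qdim (A \<inter> C) (B \<inter> C) \<le> qdim (A \<inter> C) ((A \<inter> C) \<inter> B)" by (rule qdim_mono) auto
  also have "\<dots> = qdim (A \<inter> C) B" using assms by (intro qdim_Int subspace_inter)
  also have "\<dots> \<le> qdim A B" by (rule qdim_mono) auto
  finally show ?thesis .
qed

lemma qdim_image_le:
  assumes "Vector_Spaces.linear scale scale f"
  shows "qdim (f ` A) (f ` B) \<le> qdim A B"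
proof (cases "qdim A B = \<infinity>")
  case False
  interpret f: Vector_Spaces.linear scale scale f by fact
  from False obtain G where G: "finite G" "A \<subseteq> span (B \<union> G)" "qdim A B = enat (card G)"
    by (rule qdim_attained)
  have "f ` A \<subseteq> span (f ` B \<union> f ` G)"
    using G(2) f.span_image[of "B \<union> G"] by (metis image_Un image_mono)
  then have "qdim (f ` A) (f ` B) \<le> enat (card (f ` G))" using G by (intro qdim_le) auto
  also have "\<dots> \<le> enat (card G)" using G by (simp add: card_image_le)
  finally show ?thesis using G by simp
qed simp

text \<open>The induced map from \<open>A/B\<close> onto the quotient of the images has kernel
  \<open>(N + B)/B\<close> with \<open>N = A \<inter> ker f\<close>, which is
  \<open>N/(N \<inter> B)\<close> by the second isomorphism theorem. This relative rank-nullity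
  formula drives the index calculus.\<close>

lemma qdim_rank_nullity:
  assumes f: "Vector_Spaces.linear scale scale f" and A: "subspace A" and B: "subspace B" and BA: "B \<subseteq> A"
  shows "qdim A B = qdim (f ` A) (f ` B) + qdim (A \<inter> {x. f x = 0}) (B \<inter> {x. f x = 0})"
proof -
  interpret f: Vector_Spaces.linear scale scale f by fact
  let ?N = "A \<inter> {x. f x = 0}"
  have N: "subspace ?N" using A f.subspace_kernel by (rule subspace_inter)
  let ?C = "span (?N \<union> B)"
  have CA: "?C \<subseteq> A" using A BA by (intro span_minimal) auto
  have BC: "B \<subseteq> ?C" by (auto intro: span_base)
  have "qdim A B = qdim A ?C + qdim ?C B"
    using A B CA BC by (intro qdim_add) auto
  also have "qdim ?C B = qdim ?N (?N \<inter> B)" using N B by (rule qdim_sum)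
  also have "?N \<inter> B = B \<inter> {x. f x = 0}" using BA by auto
  also have "qdim A ?C = qdim (f ` A) (f ` B)"
  proof (rule antisym)
    have fC: "f ` ?C = f ` B"
    proof -
      have "f ` ?C = span (f ` (?N \<union> B))" by (simp add: f.span_image)
      also have "f ` (?N \<union> B) = f ` B"
      proof -
        have "0 \<in> f ` B" using subspace_0[OF B] f.zero by (metis image_eqI)
        then show ?thesis by (auto simp: image_Un)
      qed
      also have "span (f ` B) = f ` B" using B f.subspace_image by simp
      finally show ?thesis .
    qed
    show "qdim (f ` A) (f ` B) \<le> qdim A ?C" using qdim_image_le[OF f, of A ?C] fC by simp
    show "qdim A ?C \<le> qdim (f ` A) (f ` B)"
    proof (cases "qdim (f ` A) (f ` B) = \<infinity>")
      case False
      obtain H where H: "finite H" "H \<subseteq> f ` A" "f ` A = span (f ` B \<union> H)"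
        "qdim (f ` A) (f ` B) = enat (card H)"
        by (rule qdim_attained_subset[OF f.subspace_image[OF A] f.subspace_image[OF B] image_mono[OF BA] False])
      from H(2) obtain G where G: "G \<subseteq> A" "inj_on f G" "H = f ` G"
        unfolding subset_image_inj by blast
      with H(1) have Gc: "finite G" "card G = card H" by (auto simp: finite_image_iff card_image)
      have "A \<subseteq> span (?C \<union> G)"
      proof
        fix x assume x: "x \<in> A"
        then have "f x \<in> f ` span (B \<union> G)" using H G by (metis image_Un f.span_image imageI)
        then obtain y where y: "y \<in> span (B \<union> G)" "f x = f y" by auto
        have "span (B \<union> G) \<subseteq> A" using A BA G by (intro span_minimal) auto
        then have "x - y \<in> ?N" using x y A by (auto simp: f.diff intro: subspace_diff)
        then have "x - y \<in> span (?C \<union> G)" by (auto intro!: span_base)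
        moreover have "y \<in> span (?C \<union> G)" using y(1) span_mono[of "B \<union> G" "?C \<union> G"] BC by auto
        ultimately have "(x - y) + y \<in> span (?C \<union> G)" by (rule span_add)
        then show "x \<in> span (?C \<union> G)" by simp
      qed
      then show ?thesis using qdim_le[OF Gc(1)] Gc H by simp
    qed simp
  qed
  finally show ?thesis .
qed

lemma qdim_image_add_kernel:
  assumes "Vector_Spaces.linear scale scale f" "subspace A"
  shows "qdim A {0} = qdim (f ` A) {0} + qdim (A \<inter> {x. f x = 0}) {0}"
proof -
  interpret f: Vector_Spaces.linear scale scale f by fact
  have "{0} \<inter> {x. f x = 0} = {0}" by auto
  then show ?thesis
    using qdim_rank_nullity[OF assms, of "{0}"] subspace_0[OF assms(2)] by auto
qed

text \<open>The dimensions of \<open>V 0 / V k\<close> are natural numbers below the common bound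
  \<open>r\<close>, so a maximal one exists; from there on additivity of \<open>qdim\<close> forces
  the successive quotients to vanish.\<close>

lemma decreasing_subspaces_stabilise:
  assumes V: "\<And>k. subspace (V k)" and dec: "\<And>k. V (Suc k) \<subseteq> V k"
    and fin: "\<And>k. qdim (V 0) (V k) \<le> enat r"
  obtains k0 where "\<And>k. k \<ge> k0 \<Longrightarrow> V (Suc k) = V k"
proof -
  have dec': "V k \<subseteq> V j" if "j \<le> k" for j k using lift_Suc_antimono_le[of V] dec that by blast
  define c where "c k = the_enat (qdim (V 0) (V k))" for k
  have c: "qdim (V 0) (V k) = enat (c k)" for k
    using fin[of k] unfolding c_def by (cases "qdim (V 0) (V k)") auto
  have cr: "c k \<le> r" for k using fin[of k] c[of k] by simp
  obtain k0 where k0: "\<And>k. c k \<le> c k0" using bounded_nat_attains_max[of c r] cr by blast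
  show ?thesis
  proof
    fix k assume "k0 \<le> k"
    have "qdim (V 0) (V (Suc k)) = qdim (V 0) (V k) + qdim (V k) (V (Suc k))"
      using V dec dec'[of 0] by (intro qdim_add) auto
    moreover have "qdim (V 0) (V k) = qdim (V 0) (V k0) + qdim (V k0) (V k)"
      using V dec' \<open>k0 \<le> k\<close> by (intro qdim_add) auto
    ultimately have "enat (c (Suc k)) = enat (c k0) + qdim (V k0) (V k) + qdim (V k) (V (Suc k))"
      using c by metis
    moreover have "enat (c (Suc k)) \<le> enat (c k0)" using k0 by simp
    ultimately have "qdim (V k) (V (Suc k)) = 0"
      by (cases "qdim (V k) (V (Suc k))"; cases "qdim (V k0) (V k)") (auto simp: zero_enat_def)
    then show "V (Suc k) = V k" using V dec by (auto simp: qdim_eq_0_iff)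
  qed
qed

lemma increasing_subspaces_stabilise:
  assumes V: "\<And>k. subspace (V k)" and inc: "\<And>k. V k \<subseteq> V (Suc k)"
    and fin: "\<And>k. qdim (V k) (V 0) \<le> enat r"
  obtains k0 where "\<And>k. k \<ge> k0 \<Longrightarrow> V (Suc k) = V k"
proof -
  have inc': "V j \<subseteq> V k" if "j \<le> k" for j k using lift_Suc_mono_le[of V] inc that by blast
  define c where "c k = the_enat (qdim (V k) (V 0))" for k
  have c: "qdim (V k) (V 0) = enat (c k)" for k
    using fin[of k] unfolding c_def by (cases "qdim (V k) (V 0)") auto
  have cr: "c k \<le> r" for k using fin[of k] c[of k] by simp
  obtain k0 where k0: "\<And>k. c k \<le> c k0" using bounded_nat_attains_max[of c r] cr by blast
  show ?thesis
  proof
    fix k assume "k0 \<le> k"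
    have "qdim (V (Suc k)) (V 0) = qdim (V (Suc k)) (V k) + qdim (V k) (V 0)"
      using V inc inc'[of 0] by (intro qdim_add) auto
    moreover have "qdim (V k) (V 0) = qdim (V k) (V k0) + qdim (V k0) (V 0)"
      using V inc' \<open>k0 \<le> k\<close> by (intro qdim_add) auto
    ultimately have "enat (c (Suc k)) = qdim (V (Suc k)) (V k) + (qdim (V k) (V k0) + enat (c k0))"
      using c by metis
    moreover have "enat (c (Suc k)) \<le> enat (c k0)" using k0 by simp
    ultimately have "qdim (V (Suc k)) (V k) = 0"
      by (cases "qdim (V (Suc k)) (V k)"; cases "qdim (V k) (V k0)") (auto simp: zero_enat_def)
    then show "V (Suc k) = V k" using V inc by (auto simp: qdim_eq_0_iff)
  qed
qed

end

section \<open>The open mapping theorem on closed subspaces\<close>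

text \<open>Closed subspaces are sets here, not types, so the Baire argument runs in the subspace
  topology of \<open>C\<close>. Exact solvability is obtained afterwards by iteration.\<close>

lemma open_mapping_approximation:
  fixes f :: "'a::real_normed_vector \<Rightarrow> 'b::banach"
  assumes f: "bounded_linear f" and D: "subspace D" and C: "closed C" and fD: "f ` D = C"
  obtains K where "K \<ge> 0"
    "\<And>y e. y \<in> C \<Longrightarrow> e > 0 \<Longrightarrow> \<exists>x\<in>D. norm x \<le> K * norm y \<and> norm (y - f x) < e"
proof -
  interpret f: bounded_linear f by fact
  define E where "E n = closure (f ` (D \<inter> cball 0 (real n)))" for n
  have EC: "E n \<subseteq> C" for n unfolding E_def using fD C by (intro closure_minimal) auto
  have "C \<subseteq> (\<Union>n. E n)"
  proof
    fix y assume "y \<in> C"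
    then obtain x where x: "x \<in> D" "f x = y" using fD by auto
    obtain n where "norm x \<le> real n" using real_arch_simple by blast
    then have "y \<in> E n" unfolding E_def using x by (auto intro!: closure_subset[THEN subsetD] image_eqI[of _ _ x])
    then show "y \<in> (\<Union>n. E n)" by auto
  qed
  with EC have UE: "(\<Union>n. E n) = C" by blast
  have C0: "0 \<in> C" using fD subspace_0[OF D] f.zero by (metis image_eqI)
  have "\<exists>n. top_of_set C interior_of E n \<noteq> {}"
  proof (rule ccontr)
    assume "\<not> ?thesis"
    then have "top_of_set C interior_of \<Union>(range E) = {}"
      using C EC
      by (intro Baire_category_alt disjI1 completely_metrizable_space_closedin[OF completely_metrizable_space_euclidean])
         (auto simp: E_def closed_closedin[symmetric] intro!: closed_subset)
    then show False using UE C0 interior_of_topspace[of "top_of_set C"] by auto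
  qed
  then obtain n y0 where "y0 \<in> top_of_set C interior_of E n" by auto
  then obtain U where U: "openin (top_of_set C) U" "y0 \<in> U" "U \<subseteq> E n" unfolding interior_of_def by auto
  obtain V where V: "open V" "U = C \<inter> V" using U(1) unfolding openin_open by auto
  obtain r where r: "r > 0" "ball y0 r \<subseteq> V" using V U(2) by (metis IntE open_contains_ball)
  have subC: "subspace C" using D f.linear_axioms fD linear_subspace_image by metis
  have y0C: "y0 \<in> C" using U V by auto
  \<comment> \<open>Differences of two approximate preimages, one for \<open>y0 + y\<close> and one
    for \<open>y0\<close>, move the ball from \<open>y0\<close> to the origin and double the radius
    \<open>n\<close>.\<close>
  have small: "\<exists>x\<in>D. norm x \<le> 2 * real n \<and> norm (y - f x) < e" if y: "y \<in> C" "norm y < r" and e: "e > 0" for y e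
  proof -
    have "y0 + y \<in> ball y0 r" using y by (simp add: dist_norm)
    moreover have "y0 + y \<in> C" using y y0C subC by (simp add: subspace_add)
    ultimately have "y0 + y \<in> E n" using r V U by auto
    then obtain a where a: "a \<in> D" "norm a \<le> real n" "dist (f a) (y0 + y) < e / 2"
      using e by (auto simp: E_def closure_approachable dest!: spec[of _ "e / 2"])
    have "y0 \<in> E n" using U by auto
    then obtain b where b: "b \<in> D" "norm b \<le> real n" "dist (f b) y0 < e / 2"
      using e by (auto simp: E_def closure_approachable dest!: spec[of _ "e / 2"])
    have "norm (a - b) \<le> 2 * real n" using a b norm_triangle_ineq4[of a b] by simp
    moreover have eq: "y - f (a - b) = (f b - y0) - (f a - (y0 + y))" by (simp add: f.diff)
    have "norm (y - f (a - b)) \<le> norm (f b - y0) + norm (f a - (y0 + y))"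
      unfolding eq by (rule norm_triangle_ineq4)
    then have "norm (y - f (a - b)) < e" using a(3) b(3) by (simp add: dist_norm)
    ultimately show ?thesis using a b subspace_diff[OF D] by blast
  qed
  show ?thesis
  proof
    \<comment> \<open>Vectors of norm below \<open>r\<close> cost norm at most \<open>2 n\<close>;
      rescaling \<open>y\<close> to norm \<open>r / 2\<close> multiplies this by
      \<open>2 norm y / r\<close>.\<close>
    show "0 \<le> 4 * real n / r" using r by simp
    fix y and e :: real assume y: "y \<in> C" and e: "e > 0"
    show "\<exists>x\<in>D. norm x \<le> 4 * real n / r * norm y \<and> norm (y - f x) < e"
    proof (cases "y = 0")
      case True
      then show ?thesis using subspace_0[OF D] e by (intro bexI[of _ 0]) (auto simp: f.zero)
    next
      case False
      define c where "c = r / (2 * norm y)"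
      have c: "c > 0" using False r by (simp add: c_def)
      have "norm (c *\<^sub>R y) = r / 2" using False r by (simp add: c_def)
      then have "norm (c *\<^sub>R y) < r" using r by simp
      then obtain x where x: "x \<in> D" "norm x \<le> 2 * real n" "norm (c *\<^sub>R y - f x) < c * e"
        using small[of "c *\<^sub>R y" "c * e"] subspace_scale[OF subC y] c e by auto
      let ?x = "(1 / c) *\<^sub>R x"
      have "norm ?x \<le> (1 / c) * (2 * real n)" using x c by (simp add: divide_right_mono)
      also have "\<dots> = 4 * real n / r * norm y" using r False by (simp add: c_def)
      finally have 1: "norm ?x \<le> 4 * real n / r * norm y" .
      have "c *\<^sub>R (y - f ?x) = c *\<^sub>R y - f x" using c by (simp add: f.scaleR scaleR_right_diff_distrib)
      then have "c * norm (y - f ?x) < c * e" using x(3) c by (metis abs_of_pos norm_scaleR)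
      then have "norm (y - f ?x) < e" using c by simp
      with 1 x subspace_scale[OF D] show ?thesis by blast
    qed
  qed
qed

text \<open>Successive approximation: each correction halves the bound on the residual, and the
  corrections form a geometrically dominated series whose sum lies in the closed set
  \<open>D\<close>.\<close>

theorem open_mapping_bound:
  fixes f :: "'a::banach \<Rightarrow> 'b::banach"
  assumes f: "bounded_linear f" and D: "subspace D" "closed D" and C: "closed C" and fD: "f ` D = C"
  obtains K where "K > 0" "\<And>y. y \<in> C \<Longrightarrow> \<exists>x\<in>D. f x = y \<and> norm x \<le> K * norm y"
proof -
  interpret f: bounded_linear f by fact
  obtain K where K: "K \<ge> 0"
    "\<And>y e. y \<in> C \<Longrightarrow> e > 0 \<Longrightarrow> \<exists>x\<in>D. norm x \<le> K * norm y \<and> norm (y - f x) < e"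
    using open_mapping_approximation[OF f D(1) C fD] by blast
  have subC: "subspace C" using D f.linear_axioms fD linear_subspace_image by metis
  obtain g where g: "\<And>y e. y \<in> C \<Longrightarrow> e > 0 \<Longrightarrow> g y e \<in> D \<and> norm (g y e) \<le> K * norm y \<and> norm (y - f (g y e)) < e"
    using K(2) by metis
  \<comment> \<open>The geometric series gives the constant \<open>2 * K\<close>; the added 1 keeps
    it positive when \<open>K = 0\<close>.\<close>
  have "\<exists>x\<in>D. f x = y \<and> norm x \<le> (2 * K + 1) * norm y" if y: "y \<in> C" for y
  proof (cases "y = 0")
    case True
    then show ?thesis using subspace_0[OF D(1)] by (intro bexI[of _ 0]) (auto simp: f.zero)
  next
    case False
    define e where "e k = norm y * (1 / 2) ^ Suc k" for k
    have e: "e k > 0" for k using False by (simp add: e_def)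
    define r where "r = rec_nat y (\<lambda>k v. v - f (g v (e k)))"
    have r0: "r 0 = y" and rS: "r (Suc k) = r k - f (g (r k) (e k))" for k by (simp_all add: r_def)
    define x where "x k = g (r k) (e k)" for k
    have rC: "r k \<in> C" for k
    proof (induction k)
      case (Suc k)
      then show ?case using g[OF Suc e[of k]] fD subC rS by (metis imageI subspace_diff)
    qed (simp add: r0 y)
    have xD: "x k \<in> D" for k using g[OF rC e] by (simp add: x_def)
    have rn: "norm (r k) \<le> norm y * (1 / 2) ^ k" for k
    proof (cases k)
      case (Suc j)
      then show ?thesis using g[OF rC[of j] e[of j]] rS[of j] by (simp add: e_def)
    qed (simp add: r0)
    have xn: "norm (x k) \<le> K * norm y * (1 / 2) ^ k" for k
    proof -
      have "norm (x k) \<le> K * norm (r k)" using g[OF rC e] by (simp add: x_def)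
      also have "\<dots> \<le> K * (norm y * (1 / 2) ^ k)" using rn K by (intro mult_left_mono)
      finally show ?thesis by simp
    qed
    have geo: "(\<lambda>k. K * norm y * (1 / 2) ^ k) sums (K * norm y * 2)"
      using sums_mult[OF geometric_sums[of "1/2::real"], of "K * norm y"] by simp
    have sn: "summable (\<lambda>k. norm (x k))"
      using geo xn by (intro summable_comparison_test[OF _ sums_summable[OF geo]]) auto
    then have s: "summable x" by (rule summable_norm_cancel)
    have xD': "suminf x \<in> D"
    proof (rule closed_sequentially[OF D(2)])
      show "(\<Sum>k<n. x k) \<in> D" for n using D xD by (intro subspace_sum) auto
      show "(\<lambda>n. \<Sum>k<n. x k) \<longlonglongrightarrow> suminf x" using s by (rule summable_LIMSEQ)
    qed
    have "r \<longlonglongrightarrow> 0"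
    proof (rule Lim_null_comparison)
      show "(\<lambda>k. norm y * (1 / 2) ^ k) \<longlonglongrightarrow> 0" by (intro tendsto_mult_right_zero LIMSEQ_realpow_zero) auto
    qed (use rn in auto)
    then have "(\<lambda>k. r k - r (Suc k)) sums (r 0 - 0)" by (rule telescope_sums')
    moreover have "(\<lambda>k. f (x k)) = (\<lambda>k. r k - r (Suc k))" using rS by (auto simp: x_def)
    ultimately have "(\<lambda>k. f (x k)) sums y" by (simp add: r0)
    then have "f (suminf x) = y" using f.suminf[OF s] by (simp add: sums_unique[symmetric])
    moreover have "norm (suminf x) \<le> (2 * K + 1) * norm y"
    proof -
      have "norm (suminf x) \<le> (\<Sum>k. norm (x k))" using sn by (rule summable_norm)
      also have "\<dots> \<le> (\<Sum>k. K * norm y * (1 / 2) ^ k)" using sn geo xn by (intro suminf_le) (auto simp: sums_summable)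
      also have "\<dots> = K * norm y * 2" using geo by (simp add: sums_unique[symmetric])
      also have "\<dots> \<le> (2 * K + 1) * norm y" by (simp add: algebra_simps)
      finally show ?thesis .
    qed
    ultimately show ?thesis using xD' by blast
  qed
  then show ?thesis by (intro that[of "2 * K + 1"]) (use K(1) in auto)
qed

lemma subspace_Pair_Times: "subspace A \<Longrightarrow> subspace B \<Longrightarrow> subspace (A \<times> B)"
  by (auto simp: subspace_def zero_prod_def)

text \<open>Open mapping for the map sending \<open>(x, z)\<close> to \<open>f x + z\<close> on the
  product space. It yields estimates modulo \<open>Z\<close> without forming a quotient
  space.\<close>

lemma open_mapping_bound_sum:
  fixes f :: "'a::banach \<Rightarrow> 'b::banach"
  assumes f: "bounded_linear f" and D: "subspace D" "closed D" and Z: "subspace Z" "closed Z"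
    and C: "closed C" and fD: "{f x + z | x z. x \<in> D \<and> z \<in> Z} = C"
  obtains K where "K > 0"
    "\<And>y. y \<in> C \<Longrightarrow> \<exists>x\<in>D. \<exists>z\<in>Z. f x + z = y \<and> norm x \<le> K * norm y \<and> norm z \<le> K * norm y"
proof -
  let ?f = "\<lambda>p. f (fst p) + snd p"
  have "bounded_linear ?f"
    by (intro bounded_linear_add bounded_linear_compose[OF f] bounded_linear_fst bounded_linear_snd)
  moreover have "?f ` (D \<times> Z) = C" using fD by force
  moreover have "subspace (D \<times> Z)" "closed (D \<times> Z)" using D Z by (auto intro: subspace_Pair_Times closed_Times)
  ultimately obtain K where K: "K > 0" "\<And>y. y \<in> C \<Longrightarrow> \<exists>p\<in>D \<times> Z. ?f p = y \<and> norm p \<le> K * norm y"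
    using open_mapping_bound[of ?f "D \<times> Z" C] C by blast
  show ?thesis
  proof
    fix y assume "y \<in> C"
    from K(2)[OF this] obtain x z where xz: "x \<in> D" "z \<in> Z" "f x + z = y" "norm (x, z) \<le> K * norm y" by auto
    moreover have "norm x \<le> norm (x, z)" "norm z \<le> norm (x, z)"
      using norm_fst_le[of x z] norm_snd_le[of z x] by auto
    ultimately show "\<exists>x\<in>D. \<exists>z\<in>Z. f x + z = y \<and> norm x \<le> K * norm y \<and> norm z \<le> K * norm y"
      by (intro bexI[of _ x] bexI[of _ z]) auto
  qed (use K in auto)
qed

text \<open>The summands meet only in 0, so in a bounded solution of \<open>f x + z = y\<close> the
  component \<open>z\<close> is determined by \<open>y\<close>, and the projection of
  \<open>C\<close> onto \<open>Z\<close> is bounded. A limit of points of the image therefore has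
  \<open>Z\<close>-component 0.\<close>

lemma closed_image_complemented:
  fixes f :: "'a::banach \<Rightarrow> 'b::banach"
  assumes f: "bounded_linear f" and D: "subspace D" "closed D" and Z: "subspace Z" "closed Z"
    and C: "closed C" and fD: "{f x + z | x z. x \<in> D \<and> z \<in> Z} = C" and int: "f ` D \<inter> Z \<subseteq> {0}"
  shows "closed (f ` D)"
proof -
  interpret f: bounded_linear f by fact
  obtain K where K: "K > 0"
    "\<And>y. y \<in> C \<Longrightarrow> \<exists>x\<in>D. \<exists>z\<in>Z. f x + z = y \<and> norm x \<le> K * norm y \<and> norm z \<le> K * norm y"
    using open_mapping_bound_sum[OF f D Z C fD] by blast
  have fDC: "f ` D \<subseteq> C" using fD subspace_0[OF Z(1)] by force
  have sD: "subspace (f ` D)" using D f.linear_axioms linear_subspace_image by blast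
  have subC: "subspace C" unfolding fD[symmetric]
    using subspace_sums[OF sD Z(1)] by (rule back_subst[of subspace]) blast
  have bd: "norm z \<le> K * norm (y + z)" if "y \<in> f ` D" "z \<in> Z" for y z
  proof -
    have "y + z \<in> C" using fD that by blast
    from K(2)[OF this] obtain x' z' where xz: "x' \<in> D" "z' \<in> Z" "f x' + z' = y + z" "norm z' \<le> K * norm (y + z)"
      by auto
    have "y - f x' \<in> f ` D" using xz sD that by (intro subspace_diff) auto
    moreover have "y - f x' = z' - z" using xz(3) by (simp add: algebra_simps)
    moreover have "z' - z \<in> Z" using xz that Z by (intro subspace_diff)
    ultimately have "z' - z = 0" using int by auto
    with xz show ?thesis by simp
  qed
  show ?thesis
    unfolding closed_sequential_limits
  proof (intro allI impI)
    fix y l assume y: "(\<forall>n. y n \<in> f ` D) \<and> y \<longlonglongrightarrow> l"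
    then have "l \<in> C" using fDC by (intro closed_sequentially[OF C, of y l]) auto
    then obtain x z where l: "x \<in> D" "z \<in> Z" "l = f x + z" using fD by blast
    have "norm z \<le> K * norm (l - y n)" for n
    proof -
      have "f x - y n \<in> f ` D" using sD l y by (intro subspace_diff) auto
      from bd[OF this l(2)] show ?thesis using l by (simp add: algebra_simps)
    qed
    moreover have "(\<lambda>n. K * norm (l - y n)) \<longlonglongrightarrow> K * norm (l - l)"
      using y by (intro tendsto_intros) auto
    ultimately have "norm z \<le> K * norm (l - l)" by (intro LIMSEQ_le_const[of _ _ "norm z"]) auto
    then show "l \<in> f ` D" using l by simp
  qed
qed

section \<open>Finite-dimensional subspaces of complex Banach spaces\<close>

locale cbanach =
  fixes sc :: "complex \<Rightarrow> 'a::banach \<Rightarrow> 'a"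
  assumes scale: "complex_banach_scale sc"
begin

sublocale quotient_dimension sc
  using scale by (simp add: complex_banach_scale_def quotient_dimension_def)

lemmas span_of_subspace = span_eq_iff[THEN iffD2]

lemma sc_of_real: "sc (complex_of_real r) x = r *\<^sub>R x"
  and norm_sc [simp]: "norm (sc c x) = cmod c * norm x"
  using scale by (auto simp: complex_banach_scale_def)

lemma real_subspace: "subspace S \<Longrightarrow> real_vector.subspace S"
  unfolding real_vector.subspace_def subspace_def by (metis sc_of_real)

lemma bounded_bilinear_sc: "bounded_bilinear sc"
proof
  show "sc (r *\<^sub>R a) b = r *\<^sub>R sc a b" for r a b
    by (simp add: scaleR_conv_of_real sc_of_real[symmetric])
  show "sc a (r *\<^sub>R b) = r *\<^sub>R sc a b" for r a b
    by (simp add: sc_of_real[symmetric] mult.commute)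
  show "\<exists>K. \<forall>a b. norm (sc a b) \<le> norm a * norm b * K" by (intro exI[of _ 1]) simp
qed (simp_all add: scale_left_distrib scale_right_distrib)

lemmas tendsto_sc [tendsto_intros] = bounded_bilinear.tendsto[OF bounded_bilinear_sc]

lemma bop_bounded_linear: "bop sc T \<Longrightarrow> bounded_linear T"
  by (simp add: bop_def)

lemma bop_linear: "bop sc T \<Longrightarrow> Vector_Spaces.linear sc sc T"
  unfolding bop_def Vector_Spaces.linear_iff using vector_space_axioms
  by (auto simp: bounded_linear.linear linear_add)

lemma bop_compose: "bop sc S \<Longrightarrow> bop sc T \<Longrightarrow> bop sc (S \<circ> T)"
  unfolding bop_def o_def by (auto intro: bounded_linear_compose)

lemma bop_id: "bop sc id" "bop sc (\<lambda>x. x)"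
  unfolding bop_def by (auto simp: id_def)

lemma bop_funpow: "bop sc T \<Longrightarrow> bop sc (T ^^ n)"
  by (induction n) (auto intro: bop_compose simp: bop_id)

text \<open>The coordinate along \<open>g\<close> is bounded by the reciprocal of the distance from
  \<open>g\<close> to \<open>A\<close>; convergence in \<open>A + span g\<close> thus forces
  convergence of the coordinates.\<close>

lemma coefficient_bound:
  assumes A: "subspace A" "closed A" and g: "g \<notin> A"
  obtains K where "K > 0" "\<And>a c. a \<in> A \<Longrightarrow> cmod c \<le> K * norm (a + sc c g)"
proof -
  define d where "d = infdist g A"
  have d: "d > 0" unfolding d_def using A subspace_0[OF A(1)] g by (intro infdist_pos_not_in_closed) auto
  have "cmod c \<le> 1 / d * norm (a + sc c g)" if a: "a \<in> A" for a c
  proof (cases "c = 0")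
    case False
    have "sc (- (1 / c)) a \<in> A" using A a by (intro subspace_scale)
    then have "d \<le> norm (g - sc (- (1 / c)) a)" unfolding d_def by (metis infdist_le dist_norm)
    moreover have "a + sc c g = sc c (g - sc (- (1 / c)) a)"
      using False by (simp add: scale_right_diff_distrib scale_right_distrib)
    ultimately have "cmod c * d \<le> norm (a + sc c g)" by (simp add: mult_left_mono)
    then show ?thesis using d by (simp add: field_simps)
  qed (use d in auto)
  then show ?thesis using that[of "1 / d"] d by auto
qed

lemma closed_span_insert:
  assumes A: "subspace A" "closed A"
  shows "closed (span (insert g A))"
proof (cases "g \<in> A")
  case True
  then have "span (insert g A) = A" using A by (simp add: insert_absorb)
  then show ?thesis using A by simp
next
  case False
  obtain K where K: "K > 0" "\<And>a c. a \<in> A \<Longrightarrow> cmod c \<le> K * norm (a + sc c g)"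
    using coefficient_bound[OF A False] by metis
  have sp: "span A = A" using A by (simp add: span_of_subspace)
  show ?thesis
    unfolding closed_sequential_limits
  proof (intro allI impI)
    fix z l assume z: "(\<forall>n. z n \<in> span (insert g A)) \<and> z \<longlonglongrightarrow> l"
    then have "\<forall>n. \<exists>c. z n - sc c g \<in> A" unfolding span_insert sp by auto
    then obtain c where c: "\<And>n. z n - sc (c n) g \<in> A" by metis
    have cd: "cmod (c m - c n) \<le> K * norm (z m - z n)" for m n
    proof -
      have "(z m - sc (c m) g) - (z n - sc (c n) g) \<in> A" by (rule subspace_diff[OF A(1) c c])
      from K(2)[OF this, of "c m - c n"] show ?thesis by (simp add: scale_left_diff_distrib)
    qed
    have "Cauchy c"
      unfolding Cauchy_def
    proof (intro allI impI)
      fix e :: real assume e: "e > 0"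
      have "Cauchy z" using z LIMSEQ_imp_Cauchy by blast
      then obtain M where M: "\<And>m n. m \<ge> M \<Longrightarrow> n \<ge> M \<Longrightarrow> norm (z m - z n) < e / K"
        using e K(1) unfolding Cauchy_def dist_norm by (metis divide_pos_pos)
      have "dist (c m) (c n) < e" if "m \<ge> M" "n \<ge> M" for m n
        using cd[of m n] M[OF that] K(1) by (simp add: dist_norm field_simps)
      then show "\<exists>M. \<forall>m\<ge>M. \<forall>n\<ge>M. dist (c m) (c n) < e" by blast
    qed
    then obtain k where k: "c \<longlonglongrightarrow> k" using Cauchy_convergent convergent_def by blast
    have "(\<lambda>n. z n - sc (c n) g) \<longlonglongrightarrow> l - sc k g" using z k by (intro tendsto_intros) auto
    then have "l - sc k g \<in> A" using closed_sequentially[OF A(2), of "\<lambda>n. z n - sc (c n) g"] c by blast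
    then show "l \<in> span (insert g A)" unfolding span_insert sp by auto
  qed
qed

lemma closed_span_Un:
  assumes A: "subspace A" "closed A" and "finite G"
  shows "closed (span (A \<union> G))"
  using \<open>finite G\<close>
proof induction
  case empty
  then show ?case using A by (simp add: span_of_subspace)
next
  case (insert g G)
  have "span (A \<union> insert g G) = span (insert g (span (A \<union> G)))"
  proof
    show "span (A \<union> insert g G) \<subseteq> span (insert g (span (A \<union> G)))"
      by (intro span_mono) (auto intro: span_base)
    have "span (A \<union> G) \<subseteq> span (A \<union> insert g G)" by (intro span_mono) auto
    then show "span (insert g (span (A \<union> G))) \<subseteq> span (A \<union> insert g G)"
      by (intro span_minimal) (auto intro: span_base)
  qed
  then show ?case using closed_span_insert[OF subspace_span insert.IH] by simp
qed

lemma closed_span_finite: "finite G \<Longrightarrow> closed (span G)"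
  using closed_span_Un[of "{0}" G] by simp

lemma closed_finite_extension:
  assumes A: "subspace A" "closed A" and B: "subspace B" "A \<subseteq> B" and q: "qdim B A \<noteq> \<infinity>"
  shows "closed B"
  using qdim_attained_subset[OF B(1) A(1) B(2) q] closed_span_Un[OF A] by metis

text \<open>Kato's closed range criterion: a finite-dimensional complement of the image is closed,
  so \<open>closed_image_complemented\<close> applies with \<open>Z = span H\<close>.\<close>

lemma closed_image_finite_codim:
  assumes T: "bop sc T" and D: "subspace D" "closed D" and C: "subspace C" "closed C"
    and TD: "T ` D \<subseteq> C" and q: "qdim C (T ` D) \<noteq> \<infinity>"
  shows "closed (T ` D)"
proof -
  interpret T: Vector_Spaces.linear sc sc T using T by (rule bop_linear)
  have sTD: "subspace (T ` D)" using D by (intro T.subspace_image)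
  obtain H where H: "finite H" "span H \<inter> T ` D = {0}" "C = span (T ` D \<union> H)"
    using qdim_attained_subset[OF C(1) sTD TD q] by metis
  have "C = {T x + z | x z. x \<in> D \<and> z \<in> span H}"
    unfolding H(3) span_Un using sTD by (auto simp: span_of_subspace)
  then show ?thesis
    using H C D T
    by (intro closed_image_complemented[of T D "span H" C])
       (auto simp: bop_def real_subspace closed_span_finite)
qed

text \<open>Relative compactness of the bounded subsets in sequential form; the limit may lie
  outside \<open>A\<close>.\<close>

definition relatively_compact_bounded :: "'a set \<Rightarrow> bool" where
  "relatively_compact_bounded A \<longleftrightarrow> (\<forall>x B. (\<forall>n::nat. x n \<in> A \<and> norm (x n) \<le> B) \<longrightarrow>
     (\<exists>r l. strict_mono r \<and> (\<lambda>n. x (r n)) \<longlonglongrightarrow> (l::'a)))"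

lemma relatively_compact_boundedE:
  fixes x :: "nat \<Rightarrow> 'a"
  assumes "relatively_compact_bounded A" "\<And>n. x n \<in> A" "\<And>n. norm (x n) \<le> B"
  obtains r l where "strict_mono r" "(\<lambda>n. x (r n)) \<longlonglongrightarrow> l"
  using assms unfolding relatively_compact_bounded_def by blast

lemma relatively_compact_bounded_span:
  assumes "finite G" shows "relatively_compact_bounded (span G)"
  using assms
proof induction
  case empty
  have "\<exists>r l. strict_mono r \<and> (\<lambda>n. x (r n)) \<longlonglongrightarrow> (l::'a)" if "\<forall>n::nat. x n \<in> {0} \<and> norm (x n) \<le> B" for x B
    using that by (intro exI[of _ id] exI[of _ 0]) (auto simp: strict_mono_def)
  then show ?case unfolding relatively_compact_bounded_def span_empty by blast
next
  case (insert g G)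
  show ?case
  proof (cases "g \<in> span G")
    case True
    then show ?thesis using insert.IH by (simp add: span_redundant)
  next
    case False
    obtain K where K: "K > 0" "\<And>a c. a \<in> span G \<Longrightarrow> cmod c \<le> K * norm (a + sc c g)"
      using coefficient_bound[OF subspace_span closed_span_finite[OF insert.hyps(1)] False] by metis
    show ?thesis
      unfolding relatively_compact_bounded_def
    proof (intro allI impI)
      fix x :: "nat \<Rightarrow> 'a" and B assume x: "\<forall>n. x n \<in> span (insert g G) \<and> norm (x n) \<le> B"
      then have "\<forall>n. \<exists>c. x n - sc c g \<in> span G" unfolding span_insert by auto
      then obtain c where c: "\<And>n. x n - sc (c n) g \<in> span G" by metis
      have cb: "cmod (c n) \<le> K * B" for n
      proof -
        have "cmod (c n) \<le> K * norm (x n)" using K(2)[OF c, of "c n" n] by simp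
        also have "\<dots> \<le> K * B" using x K(1) by (intro mult_left_mono) auto
        finally show ?thesis .
      qed
      then have "bounded (range c)" unfolding bounded_iff by auto
      then obtain k r where r: "strict_mono r" "(c \<circ> r) \<longlonglongrightarrow> k"
        using bounded_imp_convergent_subsequence by blast
      have "norm (x (r n) - sc (c (r n)) g) \<le> B + K * B * norm g" for n
      proof -
        have "norm (x (r n) - sc (c (r n)) g) \<le> norm (x (r n)) + cmod (c (r n)) * norm g"
          using norm_triangle_ineq4[of "x (r n)" "sc (c (r n)) g"] by simp
        also have "\<dots> \<le> B + K * B * norm g" using x cb by (intro add_mono mult_right_mono) auto
        finally show ?thesis .
      qed
      then obtain s l where s: "strict_mono s"
        "(\<lambda>n. x (r (s n)) - sc (c (r (s n))) g) \<longlonglongrightarrow> l"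
        using relatively_compact_boundedE[OF insert.IH, of "\<lambda>n. x (r n) - sc (c (r n)) g"] c by metis
      have "(\<lambda>n. c (r (s n))) \<longlonglongrightarrow> k" using LIMSEQ_subseq_LIMSEQ[OF r(2) s(1)] by (simp add: o_def)
      then have "(\<lambda>n. (x (r (s n)) - sc (c (r (s n))) g) + sc (c (r (s n))) g) \<longlonglongrightarrow> l + sc k g"
        using s by (intro tendsto_intros)
      then have "(\<lambda>n. x ((r \<circ> s) n)) \<longlonglongrightarrow> l + sc k g" by simp
      moreover have "strict_mono (r \<circ> s)" using r s by (simp add: strict_mono_o)
      ultimately show "\<exists>r l. strict_mono r \<and> (\<lambda>n. x (r n)) \<longlonglongrightarrow> l" by blast
    qed
  qed
qed

lemma finite_dim_span:
  assumes A: "subspace A" and q: "qdim A {0} \<noteq> \<infinity>"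
  obtains G where "finite G" "A = span G" "independent G"
proof -
  have "{0} \<subseteq> A" using subspace_0[OF A] by simp
  then obtain H where H: "finite H" "A = span ({0} \<union> H)" "independent H"
    using qdim_attained_subset[OF A subspace_single_0 _ q] by metis
  then show ?thesis using that[of H] by simp
qed

lemma relatively_compact_bounded_finite_dim:
  "subspace A \<Longrightarrow> qdim A {0} \<noteq> \<infinity> \<Longrightarrow> relatively_compact_bounded A"
  using finite_dim_span relatively_compact_bounded_span by metis

lemma riesz_almost_orthogonal:
  assumes A: "subspace A" and G: "finite G" and AG: "\<not> A \<subseteq> span G" and GA: "G \<subseteq> A"
  shows "\<exists>x\<in>A. norm x = 1 \<and> (\<forall>y\<in>span G. norm (x - y) \<ge> 1 / 2)"
proof -
  obtain v where v: "v \<in> A" "v \<notin> span G" using AG by auto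
  define d where "d = infdist v (span G)"
  have d: "d > 0" unfolding d_def
    using closed_span_finite[OF G] span_zero[of G] v by (intro infdist_pos_not_in_closed) auto
  \<comment> \<open>A point of the span within twice the distance keeps the normalised difference at
    distance at least 1/2 from the span.\<close>
  obtain y where y: "y \<in> span G" "norm (v - y) < 2 * d"
    using infdist_approx[of "span G" d v] span_zero[of G] d by (auto simp: dist_norm d_def)
  define n where "n = norm (v - y)"
  have n: "n > 0" using v y by (auto simp: n_def)
  let ?x = "(1 / n) *\<^sub>R (v - y)"
  have GA': "span G \<subseteq> A" using GA A by (rule span_minimal)
  have "?x \<in> A" unfolding sc_of_real[symmetric] using A v y GA' by (intro subspace_scale subspace_diff) auto
  moreover have "norm ?x = 1" using n by (simp add: n_def)
  moreover have "norm (?x - w) \<ge> 1 / 2" if w: "w \<in> span G" for w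
  proof -
    have "y + sc n w \<in> span G" using y w by (intro span_add span_scale)
    then have "d \<le> dist v (y + sc n w)" unfolding d_def by (rule infdist_le)
    then have "d \<le> norm (v - y - n *\<^sub>R w)" by (simp add: dist_norm sc_of_real algebra_simps)
    moreover have "v - y - n *\<^sub>R w = n *\<^sub>R (?x - w)" using n by (simp add: scaleR_right_diff_distrib)
    ultimately have "d \<le> n * norm (?x - w)" using n by (metis abs_of_pos norm_scaleR)
    moreover have "n < 2 * d" using y by (simp add: n_def)
    ultimately have "n < n * (2 * norm (?x - w))" by simp
    then show ?thesis using n by (simp add: mult_less_cancel_left1)
  qed
  ultimately show ?thesis by blast
qed

theorem riesz_finite_dim:
  assumes A: "subspace A" and rc: "relatively_compact_bounded A"
  shows "qdim A {0} \<noteq> \<infinity>"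
proof
  assume inf: "qdim A {0} = \<infinity>"
  have "\<not> A \<subseteq> span G" if "finite G" for G
    using qdim_le[of G A "{0}"] that inf by auto
  then obtain g where g: "\<And>G. finite G \<Longrightarrow> G \<subseteq> A \<Longrightarrow> g G \<in> A \<and> norm (g G) = 1 \<and> (\<forall>y\<in>span G. norm (g G - y) \<ge> 1 / 2)"
    using riesz_almost_orthogonal[OF A] by metis
  \<comment> \<open>\<open>S n\<close> collects the first \<open>n\<close> vectors, each at distance
    at least 1/2 from the span of its predecessors, so that no subsequence is Cauchy.\<close>
  define S where "S = rec_nat {} (\<lambda>_ G. insert (g G) G)"
  have S: "S 0 = {}" "S (Suc n) = insert (g (S n)) (S n)" for n by (simp_all add: S_def)
  have SA: "finite (S n) \<and> S n \<subseteq> A" for n by (induction n) (use g in \<open>auto simp: S\<close>)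
  have inS: "g (S m) \<in> S n" if "m < n" for m n
    using that by (induction n) (auto simp: S less_Suc_eq)
  have far: "norm (g (S n) - g (S m)) \<ge> 1 / 2" if "m < n" for m n
    using g[of "S n"] SA[of n] inS[OF that] by (auto intro: span_base)
  have "g (S n) \<in> A" "norm (g (S n)) \<le> 1" for n using g[of "S n"] SA[of n] by auto
  then obtain r l where r: "strict_mono r" "(\<lambda>n. g (S (r n))) \<longlonglongrightarrow> l"
    using relatively_compact_boundedE[OF rc, of "\<lambda>n. g (S n)"] by metis
  then have "Cauchy (\<lambda>n. g (S (r n)))" using LIMSEQ_imp_Cauchy by blast
  then obtain M where "\<And>m n. m \<ge> M \<Longrightarrow> n \<ge> M \<Longrightarrow> norm (g (S (r m)) - g (S (r n))) < 1 / 2"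
    unfolding Cauchy_def dist_norm by (metis half_gt_zero zero_less_one)
  from this[of "Suc M" M] far[of "r M" "r (Suc M)"] show False
    using r(1) by (auto simp: strict_mono_def)
qed

section \<open>Sequentially proper operators\<close>

lemma subspace_ker: "bop sc T \<Longrightarrow> subspace {x. T x = 0}"
proof -
  assume "bop sc T"
  then interpret T: Vector_Spaces.linear sc sc T by (rule bop_linear)
  show ?thesis by (rule T.subspace_kernel)
qed

lemma subspace_image: "bop sc T \<Longrightarrow> subspace M \<Longrightarrow> subspace (T ` M)"
proof -
  assume "bop sc T" and M: "subspace M"
  then interpret T: Vector_Spaces.linear sc sc T by (intro bop_linear)
  show ?thesis using M by (rule T.subspace_image)
qed

lemma subspace_preimage: "bop sc T \<Longrightarrow> subspace M \<Longrightarrow> subspace {x. T x \<in> M}"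
  unfolding subspace_def by (simp add: bop_def bounded_linear.linear linear_0 linear_add)

lemma subspace_range: "bop sc T \<Longrightarrow> subspace (range T)"
  by (rule subspace_image) simp_all

lemma bop_0: "bop sc T \<Longrightarrow> T 0 = 0"
  by (simp add: bop_def bounded_linear.linear linear_0)

lemma bop_add: "bop sc T \<Longrightarrow> T (x + y) = T x + T y"
  by (simp add: bop_def bounded_linear.linear linear_add)

lemma bop_diff: "bop sc T \<Longrightarrow> T (x - y) = T x - T y"
  by (simp add: bop_def bounded_linear.linear linear_diff)

lemma bop_minus: "bop sc T \<Longrightarrow> T (- x) = - T x"
  by (simp add: bop_def bounded_linear.linear linear_neg)

lemma bop_scale: "bop sc T \<Longrightarrow> T (sc c x) = sc c (T x)"
  by (simp add: bop_def)

lemma bop_tendsto: "bop sc T \<Longrightarrow> (x \<longlongrightarrow> l) F \<Longrightarrow> ((\<lambda>n. T (x n)) \<longlongrightarrow> T l) F"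
  by (simp add: bop_def bounded_linear.tendsto)

lemma closed_ker: "bop sc T \<Longrightarrow> closed {x. T x = 0}"
proof -
  assume "bop sc T"
  then have "continuous_on UNIV T" using linear_continuous_on bop_bounded_linear by blast
  then show ?thesis by (intro closed_Collect_eq) (auto intro: continuous_intros)
qed

text \<open>On a closed subspace this is equivalent to a finite-dimensional kernel together with a
  closed image, that is, to the upper semi-Fredholm property. The sequential form is chosen because
  it passes to powers and to commuting perturbations by extracting subsequences.\<close>

definition seq_proper :: "('a \<Rightarrow> 'a) \<Rightarrow> 'a set \<Rightarrow> bool" where
  "seq_proper T M \<longleftrightarrow> (\<forall>x B l. (\<forall>n::nat. x n \<in> M \<and> norm (x n) \<le> B) \<and> (\<lambda>n. T (x n)) \<longlonglongrightarrow> l \<longrightarrow>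
     (\<exists>r l'. strict_mono r \<and> (\<lambda>n. x (r n)) \<longlonglongrightarrow> l'))"

lemma seq_properE:
  fixes x :: "nat \<Rightarrow> 'a"
  assumes "seq_proper T M" "\<And>n. x n \<in> M" "\<And>n. norm (x n) \<le> B" "(\<lambda>n. T (x n)) \<longlonglongrightarrow> l"
  obtains r l' where "strict_mono r" "(\<lambda>n. x (r n)) \<longlonglongrightarrow> l'"
  using assms unfolding seq_proper_def by blast

lemma seq_proper_kernel:
  assumes T: "bop sc T" and M: "subspace M" and sp: "seq_proper T M"
  shows "qdim ({x. T x = 0} \<inter> M) {0} \<noteq> \<infinity>"
proof (rule riesz_finite_dim)
  show "subspace ({x. T x = 0} \<inter> M)" using subspace_ker[OF T] M by (rule subspace_inter)
  show "relatively_compact_bounded ({x. T x = 0} \<inter> M)"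
    unfolding relatively_compact_bounded_def
  proof (intro allI impI)
    fix x :: "nat \<Rightarrow> 'a" and B assume x: "\<forall>n. x n \<in> {x. T x = 0} \<inter> M \<and> norm (x n) \<le> B"
    then have "(\<lambda>n. T (x n)) \<longlonglongrightarrow> 0" by auto
    with x show "\<exists>r l. strict_mono r \<and> (\<lambda>n. x (r n)) \<longlonglongrightarrow> l"
      using seq_properE[OF sp, of x B 0] by (metis IntE)
  qed
qed

text \<open>If no constant worked, normalised near-minimal preimages \<open>z n\<close> would have
  images tending to 0, hence a subsequence converging to a kernel vector. Subtracting a multiple of
  that vector contradicts near-minimality.\<close>

lemma seq_proper_preimage_bound:
  assumes T: "bop sc T" and M: "subspace M" "closed M" and sp: "seq_proper T M"
  obtains c where "\<And>y. y \<in> T ` M \<Longrightarrow> \<exists>x\<in>M. T x = y \<and> norm x \<le> c * norm y"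
proof (rule ccontr)
  assume neg: "\<not> thesis"
  then have "\<forall>n::nat. \<exists>y\<in>T ` M. \<forall>x\<in>M. T x = y \<longrightarrow> norm x > real n * norm y"
    using that by (metis linorder_not_le)
  then obtain y where y: "\<And>n. y n \<in> T ` M" "\<And>n x. x \<in> M \<Longrightarrow> T x = y n \<Longrightarrow> norm x > real n * norm (y n)"
    by metis
  have "\<exists>x. x \<in> M \<and> T x = y n \<and> norm x > 0 \<and> (\<forall>x'\<in>M. T x' = y n \<longrightarrow> norm x \<le> 2 * norm x')" for n
  proof -
    let ?S = "norm ` {x\<in>M. T x = y n}"
    have ne: "?S \<noteq> {}" using y(1)[of n] by auto
    have bdd: "bdd_below ?S" by (intro bdd_belowI[of _ 0]) auto
    have pos: "norm x > 0" if "x \<in> M" "T x = y n" for x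
    proof -
      have "real n * norm (y n) \<ge> 0" by simp
      then show ?thesis using y(2)[OF that] by linarith
    qed
    show ?thesis
    proof (cases "Inf ?S > 0")
      case True
      then obtain s where s: "s \<in> ?S" "s < 2 * Inf ?S" using cInf_lessD[OF ne, of "2 * Inf ?S"] by auto
      then obtain x where x: "x \<in> M" "T x = y n" "norm x < 2 * Inf ?S" by auto
      have "norm x \<le> 2 * norm x'" if "x' \<in> M" "T x' = y n" for x'
      proof -
        have "Inf ?S \<le> norm x'" using that bdd by (intro cInf_lower) auto
        then show ?thesis using x by linarith
      qed
      then show ?thesis using x pos by blast
    next
      case False
      have "y n \<noteq> 0" using pos[of 0] subspace_0[OF M(1)] bop_0[OF T] by auto
      obtain K where K: "K > 0" "\<And>x. norm (T x) \<le> norm x * K"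
        using bounded_linear.pos_bounded[OF bop_bounded_linear[OF T]] by blast
      \<comment> \<open>Boundedness of \<open>T\<close> keeps the preimages of the nonzero vector
        \<open>y n\<close> away from 0; with a positive infimum, the factor 2 leaves room for a
        near-minimiser.\<close>
      have "norm (y n) / K \<le> Inf ?S"
      proof (intro cInf_greatest[OF ne])
        fix s assume "s \<in> ?S"
        then obtain a where "s = norm a" "T a = y n" by auto
        then show "norm (y n) / K \<le> s" using K(2)[of a] K(1) by (simp add: field_simps)
      qed
      moreover have "norm (y n) / K > 0" using K \<open>y n \<noteq> 0\<close> by simp
      ultimately have "Inf ?S > 0" by linarith
      with False show ?thesis by simp
    qed
  qed
  then obtain x where x: "\<And>n. x n \<in> M" "\<And>n. T (x n) = y n" "\<And>n. norm (x n) > 0"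
    "\<And>n x'. x' \<in> M \<Longrightarrow> T x' = y n \<Longrightarrow> norm (x n) \<le> 2 * norm x'"
    by metis
  define z where "z n = (1 / norm (x n)) *\<^sub>R x n" for n
  have xz: "x n = norm (x n) *\<^sub>R z n" for n using x(3)[of n] by (simp add: z_def)
  have zM: "z n \<in> M" for n unfolding z_def sc_of_real[symmetric] using M x by (intro subspace_scale) auto
  have zn: "norm (z n) \<le> 1" for n by (simp add: z_def)
  have Tz: "norm (T (z n)) \<le> 1 / real n" if "n > 0" for n
  proof -
    have "T (z n) = (1 / norm (x n)) *\<^sub>R y n"
      unfolding z_def using x(2) T by (simp add: bop_def bounded_linear.linear linear_scale)
    then have "norm (T (z n)) = norm (y n) / norm (x n)" by simp
    also have "\<dots> \<le> 1 / real n"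
      using y(2)[OF x(1,2), of n] x(3)[of n] that by (simp add: field_simps)
    finally show ?thesis .
  qed
  have Tz0: "(\<lambda>n. T (z n)) \<longlonglongrightarrow> 0"
  proof (rule Lim_null_comparison)
    show "\<forall>\<^sub>F n in sequentially. norm (T (z n)) \<le> 1 / real n"
      using eventually_gt_at_top[of 0] by eventually_elim (rule Tz)
    show "(\<lambda>n. 1 / real n) \<longlonglongrightarrow> 0" by (rule lim_1_over_n)
  qed
  obtain r l where r: "strict_mono r" "(\<lambda>n. z (r n)) \<longlonglongrightarrow> l"
    by (rule seq_properE[OF sp, where x = z, OF zM zn Tz0])
  have lM: "l \<in> M" using closed_sequentially[OF M(2), of "\<lambda>n. z (r n)"] zM r by blast
  have "(\<lambda>n. T (z (r n))) \<longlonglongrightarrow> T l" using T r(2) by (rule bop_tendsto)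
  moreover have "(\<lambda>n. T (z (r n))) \<longlonglongrightarrow> 0"
    using LIMSEQ_subseq_LIMSEQ[OF Tz0 r(1)] by (simp add: o_def)
  ultimately have Tl: "T l = 0" by (rule LIMSEQ_unique)
  obtain n where n: "norm (z (r n) - l) < 1 / 2"
    using r(2) unfolding LIMSEQ_iff by (metis half_gt_zero order_refl zero_less_one)
  let ?x = "x (r n)"
  \<comment> \<open>Another preimage of the same vector, of norm less than half that of
    \<open>?x\<close>.\<close>
  have "?x - norm ?x *\<^sub>R l \<in> M"
    unfolding sc_of_real[symmetric] using M x lM by (intro subspace_diff subspace_scale) auto
  moreover have "T (?x - norm ?x *\<^sub>R l) = y (r n)"
    unfolding sc_of_real[symmetric] by (simp add: bop_diff[OF T] bop_scale[OF T] x Tl)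
  ultimately have "norm ?x \<le> 2 * norm (?x - norm ?x *\<^sub>R l)" by (rule x(4))
  also have "?x - norm ?x *\<^sub>R l = norm ?x *\<^sub>R (z (r n) - l)"
    using xz[of "r n"] by (simp add: scaleR_right_diff_distrib)
  also have "2 * norm \<dots> < norm ?x" using n x(3)[of "r n"] by simp
  finally show False by simp
qed

lemma seq_proper_closed_image:
  assumes T: "bop sc T" and M: "subspace M" "closed M" and sp: "seq_proper T M"
  shows "closed (T ` M)"
proof -
  obtain c where c: "\<And>y. y \<in> T ` M \<Longrightarrow> \<exists>x\<in>M. T x = y \<and> norm x \<le> c * norm y"
    using seq_proper_preimage_bound[OF assms] by blast
  show ?thesis
    unfolding closed_sequential_limits
  proof (intro allI impI)
    fix y l assume y: "(\<forall>n. y n \<in> T ` M) \<and> y \<longlonglongrightarrow> l"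
    then have "\<forall>n. \<exists>x. x \<in> M \<and> T x = y n \<and> norm x \<le> c * norm (y n)" using c by blast
    then obtain x where x: "\<And>n. x n \<in> M" "\<And>n. T (x n) = y n" "\<And>n. norm (x n) \<le> c * norm (y n)"
      by metis
    have "Bseq y" using y convergent_def convergent_imp_Bseq by blast
    then obtain B where B: "\<And>n. norm (y n) \<le> B" "B > 0" unfolding Bseq_def by blast
    have nb: "norm (x n) \<le> \<bar>c\<bar> * B" for n
    proof -
      have "norm (x n) \<le> \<bar>c\<bar> * norm (y n)"
        using x(3)[of n] mult_right_mono[OF abs_ge_self[of c] norm_ge_zero[of "y n"]] by linarith
      also have "\<dots> \<le> \<bar>c\<bar> * B" using B by (intro mult_left_mono) auto
      finally show ?thesis .
    qed
    have lim: "(\<lambda>n. T (x n)) \<longlonglongrightarrow> l" using x y by simp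
    obtain r l' where r: "strict_mono r" "(\<lambda>n. x (r n)) \<longlonglongrightarrow> l'"
      by (rule seq_properE[OF sp, where x = x, OF x(1) nb lim])
    have "l' \<in> M" using closed_sequentially[OF M(2), of "\<lambda>n. x (r n)"] x r by blast
    moreover have "(\<lambda>n. T (x (r n))) \<longlonglongrightarrow> T l'" using T r(2) by (rule bop_tendsto)
    moreover have "(\<lambda>n. T (x (r n))) \<longlonglongrightarrow> l"
      using LIMSEQ_subseq_LIMSEQ[of y l r] y r x by (simp add: o_def)
    ultimately show "l \<in> T ` M" using LIMSEQ_unique by blast
  qed
qed

text \<open>The open mapping bound gives preimages \<open>u n\<close> of \<open>T (x n - a)\<close>
  tending to 0; what remains of \<open>x n - a\<close> is a bounded sequence in the
  finite-dimensional kernel.\<close>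

lemma seq_proper_if_closed_range:
  assumes T: "bop sc T" and M: "subspace M" "closed M" and cl: "closed (T ` M)"
    and fin: "qdim ({x. T x = 0} \<inter> M) {0} \<noteq> \<infinity>"
  shows "seq_proper T M"
  unfolding seq_proper_def
proof (intro allI impI, elim conjE)
  fix x :: "nat \<Rightarrow> 'a" and B l
  assume x: "\<forall>n. x n \<in> M \<and> norm (x n) \<le> B" and l: "(\<lambda>n. T (x n)) \<longlonglongrightarrow> l"
  obtain K where K: "K > 0" "\<And>y. y \<in> T ` M \<Longrightarrow> \<exists>x\<in>M. T x = y \<and> norm x \<le> K * norm y"
    using open_mapping_bound[OF bop_bounded_linear[OF T] real_subspace[OF M(1)] M(2) cl refl] by blast
  have "l \<in> T ` M" using closed_sequentially[OF cl, of "\<lambda>n. T (x n)"] x l by blast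
  then obtain a where a: "a \<in> M" "l = T a" by auto
  have "T (x n - a) \<in> T ` M" for n using x a M by (intro imageI subspace_diff) auto
  then have "\<forall>n. \<exists>u. u \<in> M \<and> T u = T (x n - a) \<and> norm u \<le> K * norm (T (x n - a))" using K(2) by blast
  then obtain u where u: "\<And>n. u n \<in> M" "\<And>n. T (u n) = T (x n - a)" "\<And>n. norm (u n) \<le> K * norm (T (x n - a))"
    by metis
  have u0: "u \<longlonglongrightarrow> 0"
  proof (rule Lim_null_comparison)
    show "\<forall>\<^sub>F n in sequentially. norm (u n) \<le> K * norm (T (x n - a))" using u by simp
    have "(\<lambda>n. K * norm (T (x n) - T a)) \<longlonglongrightarrow> K * norm (l - T a)" using l by (intro tendsto_intros)
    then show "(\<lambda>n. K * norm (T (x n - a))) \<longlonglongrightarrow> 0" using a by (simp add: bop_diff[OF T])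
  qed
  then have "Bseq u" using convergent_def convergent_imp_Bseq by blast
  then obtain C where C: "\<And>n. norm (u n) \<le> C" unfolding Bseq_def by blast
  have xN: "x n - a - u n \<in> {x. T x = 0} \<inter> M" for n
    using x a u M by (auto simp: bop_diff[OF T] intro!: subspace_diff)
  have xb: "norm (x n - a - u n) \<le> B + norm a + C" for n
  proof -
    have "norm (x n - a - u n) \<le> norm (x n) + norm a + norm (u n)"
      using norm_triangle_ineq4[of "x n - a" "u n"] norm_triangle_ineq4[of "x n" a] by linarith
    moreover have "norm (x n) \<le> B" using x by blast
    ultimately show ?thesis using C[of n] by linarith
  qed
  have rc: "relatively_compact_bounded ({x. T x = 0} \<inter> M)"
    using subspace_inter[OF subspace_ker[OF T] M(1)] fin by (rule relatively_compact_bounded_finite_dim)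
  obtain r l' where r: "strict_mono r" "(\<lambda>n. x (r n) - a - u (r n)) \<longlonglongrightarrow> l'"
    by (rule relatively_compact_boundedE[OF rc, where x = "\<lambda>n. x n - a - u n", OF xN xb])
  have "(\<lambda>n. u (r n)) \<longlonglongrightarrow> 0" using LIMSEQ_subseq_LIMSEQ[OF u0 r(1)] by (simp add: o_def)
  then have "(\<lambda>n. (x (r n) - a - u (r n)) + a + u (r n)) \<longlonglongrightarrow> l' + a + 0" using r by (intro tendsto_intros)
  then show "\<exists>r l'. strict_mono r \<and> (\<lambda>n. x (r n)) \<longlonglongrightarrow> l'" using r(1) by auto
qed

lemma seq_proper_funpow:
  assumes T: "bop sc T" and sp: "seq_proper T M" and inv: "T ` M \<subseteq> M"
  shows "seq_proper (T ^^ k) M"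
proof (induction k)
  case 0
  show ?case unfolding seq_proper_def by (auto intro!: exI[of _ id] simp: strict_mono_def)
next
  case (Suc k)
  show ?case
    unfolding seq_proper_def
  proof (intro allI impI, elim conjE)
    fix x :: "nat \<Rightarrow> 'a" and B l
    assume x: "\<forall>n. x n \<in> M \<and> norm (x n) \<le> B" and l: "(\<lambda>n. (T ^^ Suc k) (x n)) \<longlonglongrightarrow> l"
    obtain K where K: "K > 0" "\<And>x. norm (T x) \<le> norm x * K"
      using bounded_linear.pos_bounded[OF bop_bounded_linear[OF T]] by blast
    have Tb: "norm (T (x n)) \<le> B * K" for n
      by (rule order_trans[OF K(2) mult_right_mono]) (use x K(1) in auto)
    have TM: "T (x n) \<in> M" for n using inv x by auto
    have Tl: "(\<lambda>n. (T ^^ k) (T (x n))) \<longlonglongrightarrow> l" using l by (simp add: funpow_swap1)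
    obtain r l' where r: "strict_mono r" "(\<lambda>n. T (x (r n))) \<longlonglongrightarrow> l'"
      by (rule seq_properE[OF Suc, where x = "\<lambda>n. T (x n)", OF TM Tb Tl])
    obtain s l'' where s: "strict_mono s" "(\<lambda>n. x (r (s n))) \<longlonglongrightarrow> l''"
      using seq_properE[OF sp, of "\<lambda>n. x (r n)" B l'] x r(2) by blast
    have "strict_mono (r \<circ> s)" using r s by (simp add: strict_mono_o)
    then show "\<exists>r l'. strict_mono r \<and> (\<lambda>n. x (r n)) \<longlonglongrightarrow> l'" using s(2) by (intro exI[of _ "r \<circ> s"] exI[of _ l'']) simp
  qed
qed

section \<open>Commuting perturbations with a power of finite rank\<close>

text \<open>Sums of words in \<open>A\<close> and \<open>B\<close>. Membership certifies that the
  cofactors in the binomial factorisation are bounded along with \<open>A\<close> and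
  \<open>B\<close> and commute with every operator commuting with both.\<close>

inductive opalg :: "('a \<Rightarrow> 'a) \<Rightarrow> ('a \<Rightarrow> 'a) \<Rightarrow> ('a \<Rightarrow> 'a) \<Rightarrow> bool"
  for A B :: "'a \<Rightarrow> 'a" where
  opalg_id: "opalg A B (\<lambda>x. x)"
| opalg_zero: "opalg A B (\<lambda>x. 0)"
| opalg_add: "opalg A B X \<Longrightarrow> opalg A B Y \<Longrightarrow> opalg A B (\<lambda>x. X x + Y x)"
| opalg_left: "opalg A B X \<Longrightarrow> opalg A B (\<lambda>x. A (X x))"
| opalg_right: "opalg A B X \<Longrightarrow> opalg A B (\<lambda>x. B (X x))"

lemma bop_zero: "bop sc (\<lambda>x. 0)"
  by (simp add: bop_def)

lemma bop_plus: "bop sc A \<Longrightarrow> bop sc B \<Longrightarrow> bop sc (\<lambda>x. A x + B x)"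
  unfolding bop_def by (auto intro: bounded_linear_add simp: scale_right_distrib)

lemma bop_sub: "bop sc A \<Longrightarrow> bop sc B \<Longrightarrow> bop sc (\<lambda>x. A x - B x)"
  unfolding bop_def by (auto intro: bounded_linear_sub simp: scale_right_diff_distrib)

lemma bop_sc: "bop sc A \<Longrightarrow> bop sc (\<lambda>x. sc c (A x))"
  unfolding bop_def
  by (auto intro: bounded_linear_compose[OF bounded_bilinear.bounded_linear_right[OF bounded_bilinear_sc]]
           simp: mult.commute)

lemma opalg_bop: "opalg A B X \<Longrightarrow> bop sc A \<Longrightarrow> bop sc B \<Longrightarrow> bop sc X"
  by (induction rule: opalg.induct)
     (auto simp: bop_id bop_zero intro: bop_plus bop_compose[unfolded o_def])

lemma opalg_commute:
  assumes "opalg A B X" and C: "bop sc C" and AC: "\<And>x. A (C x) = C (A x)" and BC: "\<And>x. B (C x) = C (B x)"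
  shows "X (C x) = C (X x)"
  using assms(1) by induction (auto simp: bop_0[OF C] bop_add[OF C] AC BC)

text \<open>In \<open>(A + B)^(k + d)\<close> every monomial is divisible by \<open>A^k\<close> or by \<open>B^d\<close>.\<close>
lemma funpow_add_factor:
  assumes A: "bop sc A" and B: "bop sc B" and AB: "\<And>x. A (B x) = B (A x)"
  shows "\<exists>G H. opalg A B G \<and> opalg A B H \<and>
    (\<forall>x. ((\<lambda>x. A x + B x) ^^ (k + d)) x = (A ^^ k) (G x) + (B ^^ d) (H x))"
proof (induction "k + d" arbitrary: k d)
  case 0
  then show ?case
    using opalg_id[of A B] opalg_zero[of A B]
    by (intro exI[of _ "\<lambda>x. x"] exI[of _ "\<lambda>x. 0"]) auto
next
  case (Suc n)
  let ?S = "\<lambda>x. A x + B x"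
  have S: "opalg A B (?S ^^ m)" for m
  proof (induction m)
    case 0
    then show ?case using opalg_id by (simp add: id_def)
  next
    case (Suc m)
    then show ?case using opalg_add[OF opalg_left[OF Suc] opalg_right[OF Suc]] by (simp add: o_def)
  qed
  have An: "(A ^^ n) 0 = 0" "(B ^^ n) 0 = 0" for n
    using bop_0 bop_funpow A B by auto
  have cA: "(B ^^ m) (A y) = A ((B ^^ m) y)" and cB: "(A ^^ m) (B y) = B ((A ^^ m) y)" for m y
    using funpow_commute[of B A m y] funpow_commute[of A B m y] by (simp_all add: AB)
  consider "k = 0" | "d = 0" | k' d' where "k = Suc k'" "d = Suc d'"
    by (metis not0_implies_Suc)
  then show ?case
  proof cases
    case 1
    then show ?thesis using S[of d] opalg_zero[of A B] An
      by (intro exI[of _ "?S ^^ d"] exI[of _ "\<lambda>x. 0"]) auto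
  next
    case 2
    then show ?thesis using S[of k] opalg_zero[of A B] An
      by (intro exI[of _ "\<lambda>x. 0"] exI[of _ "?S ^^ k"]) auto
  next
    case 3
    \<comment> \<open>One factor \<open>A + B\<close> is split off: the \<open>A\<close> part uses
      the hypothesis for \<open>(k', d)\<close>, the \<open>B\<close> part the one for
      \<open>(k, d')\<close>, so each regains its missing power.\<close>
    from Suc(1)[of k' d] Suc(2) 3 obtain G H where GH: "opalg A B G" "opalg A B H"
      "\<And>x. (?S ^^ n) x = (A ^^ k') (G x) + (B ^^ d) (H x)" by auto
    from Suc(1)[of k d'] Suc(2) 3 obtain G' H' where GH': "opalg A B G'" "opalg A B H'"
      "\<And>x. (?S ^^ n) x = (A ^^ k) (G' x) + (B ^^ d') (H' x)" by auto
    have "(?S ^^ (k + d)) x = (A ^^ k) (G x + B (G' x)) + (B ^^ d) (A (H x) + H' x)" for x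
    proof -
      have "(?S ^^ (k + d)) x = A ((?S ^^ n) x) + B ((?S ^^ n) x)" using Suc(2)[symmetric] by simp
      also have "A ((?S ^^ n) x) = (A ^^ k) (G x) + (B ^^ d) (A (H x))"
        unfolding GH(3) using 3 by (simp add: bop_add[OF A] cA AB)
      also have "B ((?S ^^ n) x) = (A ^^ k) (B (G' x)) + (B ^^ d) (H' x)"
        unfolding GH'(3) using 3 by (simp add: bop_add[OF B] cB AB[symmetric])
      finally show ?thesis
        using bop_add[OF bop_funpow[OF A]] bop_add[OF bop_funpow[OF B]] by (simp add: algebra_simps)
    qed
    moreover have "opalg A B (\<lambda>x. G x + B (G' x))" "opalg A B (\<lambda>x. A (H x) + H' x)"
      using GH GH' by (auto intro: opalg.intros)
    ultimately show ?thesis by blast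
  qed
qed

text \<open>Relating \<open>T\<close> and \<open>S\<close> rather than \<open>T\<close> and
  \<open>F\<close> makes the relation symmetric, so each one-sided estimate below is available in
  both directions. The bound \<open>r\<close> enters them unchanged for all exponents
  \<open>k\<close>.\<close>

definition pert :: "('a \<Rightarrow> 'a) \<Rightarrow> ('a \<Rightarrow> 'a) \<Rightarrow> nat \<Rightarrow> nat \<Rightarrow> bool" where
  "pert T S d r \<longleftrightarrow> bop sc T \<and> bop sc S \<and> (\<forall>x. T (S x) = S (T x)) \<and>
     qdim (range ((\<lambda>x. S x - T x) ^^ d)) {0} \<le> enat r"

lemma pert_sym:
  assumes "pert T S d r" shows "pert S T d r"
proof -
  define F where "F = (\<lambda>x. S x - T x)"
  define G where "G = (\<lambda>x. T x - S x)"
  have F: "bop sc F" using assms bop_sub unfolding F_def pert_def by blast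
  have GF: "G x = - F x" for x by (simp add: F_def G_def)
  have "(G ^^ d) x = (if even d then (F ^^ d) x else - (F ^^ d) x)" for x
    by (induction d) (auto simp: GF bop_minus[OF F])
  moreover have "- (F ^^ d) x \<in> range (F ^^ d)" for x
    using subspace_range[OF bop_funpow[OF F]] subspace_neg by blast
  ultimately have "range (G ^^ d) \<subseteq> range (F ^^ d)" by auto
  from qdim_mono[OF this, of "{0}" "{0}"] show ?thesis using assms
    unfolding pert_def F_def[symmetric] G_def[symmetric]
    by (auto intro: order_trans)
qed

text \<open>\<open>E = F^d H\<close> has rank at most \<open>r\<close> for every \<open>k\<close>,
  which is the source of all uniform bounds. The factor \<open>G\<close> is given on both sides of
  \<open>T^k\<close>: one form controls ranges, the other kernels.\<close>

lemma pert_factor: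
  assumes p: "pert T S d r"
  obtains G E where "bop sc G" "bop sc E" "\<And>x. (S ^^ (k + d)) x = (T ^^ k) (G x) + E x"
    "\<And>x. (S ^^ (k + d)) x = G ((T ^^ k) x) + E x"
    "\<And>x. G (T x) = T (G x)" "\<And>x. G (S x) = S (G x)" "\<And>x. E (T x) = T (E x)" "\<And>x. E (S x) = S (E x)"
    "qdim (range E) {0} \<le> enat r"
proof -
  define F where "F = (\<lambda>x. S x - T x)"
  have T: "bop sc T" "bop sc S" "\<And>x. T (S x) = S (T x)" and r: "qdim (range (F ^^ d)) {0} \<le> enat r"
    using p by (auto simp: pert_def F_def)
  have F: "bop sc F" unfolding F_def using T by (intro bop_sub)
  have TF: "T (F x) = F (T x)" and SF: "S (F x) = F (S x)" for x
    using T by (simp_all add: bop_diff F_def)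
  have S: "(\<lambda>x. T x + F x) = S" by (auto simp: F_def)
  obtain G H where GH: "opalg T F G" "opalg T F H"
    "\<And>x. (S ^^ (k + d)) x = (T ^^ k) (G x) + (F ^^ d) (H x)"
    using funpow_add_factor[of T F k d, OF T(1) F TF] unfolding S by blast
  have G: "bop sc G" "bop sc H" using opalg_bop[OF _ T(1) F] GH by auto
  have cT: "X (T x) = T (X x)" and cS: "X (S x) = S (X x)" if "opalg T F X" for X x
    using opalg_commute[OF that T(1)] opalg_commute[OF that T(2)] TF SF T(3) by simp_all
  define E where "E = (\<lambda>x. (F ^^ d) (H x))"
  have FT: "(F ^^ d) (T x) = T ((F ^^ d) x)" "(F ^^ d) (S x) = S ((F ^^ d) x)"
    "(T ^^ k) (G x) = G ((T ^^ k) x)" for x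
    using funpow_commute[of F T d x] funpow_commute[of F S d x] funpow_commute[of T G k x]
    by (simp_all add: TF SF cT[OF GH(1)])
  show ?thesis
  proof
    show "bop sc G" "bop sc E"
      using G bop_compose[OF bop_funpow[OF F] G(2), of d] by (auto simp: E_def o_def)
    show "(S ^^ (k + d)) x = (T ^^ k) (G x) + E x" for x using GH by (simp add: E_def)
    show "(S ^^ (k + d)) x = G ((T ^^ k) x) + E x" for x using GH FT by (simp add: E_def)
    show "G (T x) = T (G x)" "G (S x) = S (G x)" for x using cT cS GH by auto
    show "E (T x) = T (E x)" "E (S x) = S (E x)" for x
      using cT[OF GH(2)] cS[OF GH(2)] FT by (simp_all add: E_def)
    show "qdim (range E) {0} \<le> enat r"
      using qdim_mono[of "range E" "range (F ^^ d)" "{0}" "{0}"] r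
      by (auto intro: order_trans simp: E_def)
  qed
qed

lemma qdim_sum_le:
  assumes "\<And>x. x \<in> A \<Longrightarrow> \<exists>b\<in>B. \<exists>e\<in>E. x = b + e" and "subspace E"
  shows "qdim A B \<le> qdim E {0}"
proof (cases "qdim E {0} = \<infinity>")
  case False
  then obtain G where G: "finite G" "E \<subseteq> span ({0} \<union> G)" "qdim E {0} = enat (card G)"
    by (rule qdim_attained)
  have "A \<subseteq> span (B \<union> G)"
  proof
    fix x assume "x \<in> A"
    then obtain b e where be: "b \<in> B" "e \<in> E" "x = b + e" using assms by metis
    then have "e \<in> span G" using G by auto
    then have "e \<in> span (B \<union> G)" using span_mono[of G "B \<union> G"] by auto
    with be show "x \<in> span (B \<union> G)" by (auto intro: span_add span_base)
  qed
  then show ?thesis using qdim_le[OF G(1)] G(3) by simp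
qed simp

lemma pert_range:
  assumes p: "pert T S d r" shows "qdim (range (S ^^ (k + d))) (range (T ^^ k)) \<le> enat r"
proof -
  obtain G E where GE: "bop sc G" "bop sc E" "\<And>x. (S ^^ (k + d)) x = (T ^^ k) (G x) + E x"
    "qdim (range E) {0} \<le> enat r"
    using pert_factor[OF p, of k] by metis
  have "qdim (range (S ^^ (k + d))) (range (T ^^ k)) \<le> qdim (range E) {0}"
    using GE subspace_range[OF GE(2)] by (intro qdim_sum_le) auto
  with GE show ?thesis by (meson order_trans)
qed

lemma qdim_kernel_le:
  assumes L: "bop sc L" and A: "subspace A"
  shows "qdim A (A \<inter> {x. L x = 0}) = qdim (L ` A) {0}"
proof -
  have K: "subspace (A \<inter> {x. L x = 0})" using A subspace_ker[OF L] by (rule subspace_inter)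
  have "L ` (A \<inter> {x. L x = 0}) = {0}" using subspace_0[OF A] bop_0[OF L] by force
  then show ?thesis
    using qdim_rank_nullity[OF bop_linear[OF L] A K] by (simp add: qdim_eq_0 Int_assoc)
qed

text \<open>On the kernel of \<open>T^k\<close> the operator \<open>S^(k+d)\<close> reduces to
  \<open>E\<close>, hence has rank at most \<open>r\<close> there, and its kernel has at most that
  codimension.\<close>

lemma pert_kernel:
  assumes p: "pert T S d r" and M: "subspace M"
  shows "qdim ({x. (T ^^ k) x = 0} \<inter> M) ({x. (S ^^ (k + d)) x = 0} \<inter> M) \<le> enat r"
proof -
  obtain G E where GE: "bop sc G" "bop sc E" "\<And>x. (S ^^ (k + d)) x = G ((T ^^ k) x) + E x"
    "qdim (range E) {0} \<le> enat r"
    using pert_factor[OF p, of k] by metis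
  have T: "bop sc (T ^^ k)" "bop sc (S ^^ (k + d))" using p bop_funpow by (auto simp: pert_def)
  let ?A = "{x. (T ^^ k) x = 0} \<inter> M" and ?L = "S ^^ (k + d)"
  have A: "subspace ?A" using subspace_ker[OF T(1)] M by (rule subspace_inter)
  have "qdim ?A ({x. ?L x = 0} \<inter> M) \<le> qdim ?A (?A \<inter> {x. ?L x = 0})" by (rule qdim_mono) auto
  also have "\<dots> = qdim (?L ` ?A) {0}" using T A by (intro qdim_kernel_le)
  also have "\<dots> \<le> qdim (range E) {0}"
    using GE(3) bop_0[OF GE(1)] by (intro qdim_mono) auto
  finally show ?thesis using GE by (meson order_trans)
qed

lemma qdim_trans3: "qdim A D \<le> qdim A B + (qdim B C + qdim C D)"
  by (rule order_trans[OF qdim_trans add_left_mono[OF qdim_trans]])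

lemma qdim_finite_trans: "qdim A B \<noteq> \<infinity> \<Longrightarrow> qdim B C \<noteq> \<infinity> \<Longrightarrow> qdim A C \<noteq> \<infinity>"
  by (rule enat_finite_le_add[OF qdim_trans])

lemma qdim_finite_mono: "qdim A B \<noteq> \<infinity> \<Longrightarrow> A' \<subseteq> A \<Longrightarrow> B \<subseteq> B' \<Longrightarrow> qdim A' B' \<noteq> \<infinity>"
  by (rule enat_finite_le[OF qdim_mono])

lemma ker_funpow_mono: "bop sc T \<Longrightarrow> m \<le> n \<Longrightarrow> {x. (T ^^ m) x = 0} \<subseteq> {x. (T ^^ n) x = 0}"
proof -
  assume T: "bop sc T" and "m \<le> n"
  then have "T ^^ n = (T ^^ (n - m)) \<circ> (T ^^ m)" by (simp add: funpow_add[symmetric])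
  then show ?thesis using bop_0[OF bop_funpow[OF T]] by auto
qed

lemma subspace_range_funpow: "bop sc T \<Longrightarrow> subspace (range (T ^^ n))"
  by (intro subspace_range bop_funpow)

lemma subspace_ker_funpow: "bop sc T \<Longrightarrow> subspace {x. (T ^^ n) x = 0}"
  by (intro subspace_ker bop_funpow)

section \<open>Semi-Fredholm restrictions to ranges of powers and their perturbation\<close>

definition upper_at :: "('a \<Rightarrow> 'a) \<Rightarrow> nat \<Rightarrow> bool" where
  "upper_at T n \<longleftrightarrow> closed (range (T ^^ n)) \<and> closed (range (T ^^ Suc n)) \<and>
     qdim ({x. T x = 0} \<inter> range (T ^^ n)) {0} \<noteq> \<infinity>"

definition lower_at :: "('a \<Rightarrow> 'a) \<Rightarrow> nat \<Rightarrow> bool" where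
  "lower_at T n \<longleftrightarrow> closed (range (T ^^ n)) \<and> closed (range (T ^^ Suc n)) \<and>
     qdim (range (T ^^ n)) (range (T ^^ Suc n)) \<noteq> \<infinity>"

lemma upper_at_seq_proper:
  assumes T: "bop sc T" and u: "upper_at T n"
  shows "seq_proper T (range (T ^^ n))"
  using u unfolding upper_at_def range_funpow_Suc
  by (intro seq_proper_if_closed_range[OF T] subspace_range_funpow T) blast+

lemma upper_at_seq_proper_funpow:
  assumes T: "bop sc T" and u: "upper_at T n"
  shows "seq_proper (T ^^ k) (range (T ^^ n))"
  using seq_proper_funpow[OF T upper_at_seq_proper[OF assms]] range_funpow_Suc[of n T]
    range_funpow_antimono[of n "Suc n" T] by auto

lemma upper_at_mono:
  assumes T: "bop sc T" and u: "upper_at T n" and "n \<le> m"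
  shows "upper_at T m"
proof -
  have cl: "closed (range (T ^^ (j + n)))" for j
    using seq_proper_closed_image[OF bop_funpow[OF T] subspace_range_funpow[OF T] _ upper_at_seq_proper_funpow[OF T u], of j] u
    by (simp only: range_funpow_add upper_at_def)
  have "range (T ^^ m) \<subseteq> range (T ^^ n)" using \<open>n \<le> m\<close> by (rule range_funpow_antimono)
  then have "qdim ({x. T x = 0} \<inter> range (T ^^ m)) {0} \<noteq> \<infinity>"
    by (intro qdim_finite_mono[OF u[unfolded upper_at_def, THEN conjunct2, THEN conjunct2]]) blast+
  moreover have "closed (range (T ^^ m))" "closed (range (T ^^ Suc m))"
    using cl[of "m - n"] cl[of "Suc m - n"] \<open>n \<le> m\<close> by (auto simp del: funpow.simps)
  ultimately show ?thesis unfolding upper_at_def by blast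
qed

lemma codim_antimono:
  assumes T: "bop sc T" and "n \<le> m"
  shows "qdim (range (T ^^ m)) (range (T ^^ Suc m)) \<le> qdim (range (T ^^ n)) (range (T ^^ Suc n))"
  using \<open>n \<le> m\<close>
proof (induction m rule: dec_induct)
  case (step m)
  then show ?case
    using qdim_image_le[OF bop_linear[OF T], of "range (T ^^ m)" "range (T ^^ Suc m)"]
    unfolding range_funpow_Suc[symmetric] by (meson order_trans)
qed simp

lemma finite_codim_iterate:
  assumes T: "bop sc T" and c: "qdim (range (T ^^ n)) (range (T ^^ Suc n)) \<noteq> \<infinity>"
  shows "qdim (range (T ^^ n)) (range (T ^^ (n + j))) \<noteq> \<infinity>"
proof (induction j)
  case (Suc j)
  have "qdim (range (T ^^ (n + j))) (range (T ^^ Suc (n + j))) \<noteq> \<infinity>"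
    using codim_antimono[OF T le_add1] c by (rule enat_finite_le)
  with Suc show ?case unfolding add_Suc_right by (rule qdim_finite_trans)
qed (simp add: qdim_eq_0)

lemma lower_at_mono:
  assumes T: "bop sc T" and u: "lower_at T n" and "n \<le> m"
  shows "lower_at T m"
proof -
  have c: "qdim (range (T ^^ n)) (range (T ^^ Suc n)) \<noteq> \<infinity>" using u by (simp add: lower_at_def)
  have cl: "closed (range (T ^^ (n + j)))" for j
  proof -
    have eq: "range (T ^^ (n + j)) = (T ^^ j) ` range (T ^^ n)"
      using range_funpow_add[of j n T] by (simp add: add.commute)
    have sub: "(T ^^ j) ` range (T ^^ n) \<subseteq> range (T ^^ n)"
      using range_funpow_antimono[of n "n + j" T] unfolding eq by simp
    have "qdim (range (T ^^ n)) ((T ^^ j) ` range (T ^^ n)) \<noteq> \<infinity>"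
      using finite_codim_iterate[OF T c, of j] unfolding eq .
    with sub show ?thesis unfolding eq using u unfolding lower_at_def
      by (metis closed_image_finite_codim[OF bop_funpow[OF T] subspace_range_funpow[OF T, of n] _
            subspace_range_funpow[OF T, of n]])
  qed
  have "qdim (range (T ^^ m)) (range (T ^^ Suc m)) \<noteq> \<infinity>"
    using codim_antimono[OF T \<open>n \<le> m\<close>] c by (rule enat_finite_le)
  moreover have "closed (range (T ^^ m))" "closed (range (T ^^ Suc m))"
    using cl[of "m - n"] cl[of "Suc m - n"] \<open>n \<le> m\<close> by (auto simp del: funpow.simps)
  ultimately show ?thesis by (simp add: lower_at_def)
qed

lemma pert_bop: "pert T S d r \<Longrightarrow> bop sc T" "pert T S d r \<Longrightarrow> bop sc S"
  by (simp_all add: pert_def)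

text \<open>Adding the finite-dimensional range of \<open>E\<close> to \<open>range (T ^^ n)\<close>
  gives a closed space containing the range of \<open>S^(n+d)\<close>, whose own closedness is still
  to be shown.\<close>

lemma pert_cover:
  assumes p: "pert T S d r" and cl: "closed (range (T ^^ n))"
  obtains C where "subspace C" "closed C" "range (S ^^ (n + d)) \<subseteq> C" "range (T ^^ n) \<subseteq> C"
    "qdim C (range (T ^^ n)) \<noteq> \<infinity>"
proof -
  obtain G E where GE: "bop sc G" "bop sc E" "\<And>x. (S ^^ (n + d)) x = (T ^^ n) (G x) + E x"
    "qdim (range E) {0} \<le> enat r"
    using pert_factor[OF p, of n] by metis
  let ?R = "range (T ^^ n)"
  let ?C = "span (range E \<union> ?R)"
  have R: "subspace ?R" using pert_bop[OF p] by (intro subspace_range_funpow)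
  have sub: "?R \<subseteq> ?C" by (auto intro: span_base)
  have "qdim ?C ?R = qdim (range E) (range E \<inter> ?R)"
    using subspace_range[OF GE(2)] R by (rule qdim_sum)
  also have "\<dots> \<le> qdim (range E) {0}"
    using subspace_range[OF GE(2)] R by (intro qdim_mono) (auto intro: subspace_0)
  also have "\<dots> \<le> enat r" by (rule GE(4))
  finally have q: "qdim ?C ?R \<noteq> \<infinity>" by (rule enat_finite_le_enat)
  show ?thesis
  proof
    show "closed ?C" by (rule closed_finite_extension[OF R cl subspace_span sub q])
    show "range (S ^^ (n + d)) \<subseteq> ?C"
      using GE(3) by (auto intro!: span_add intro: span_base)
  qed (use sub q in auto)
qed

text \<open>By interlacing, the ranges of powers of \<open>S\<close> have finite codimension in the
  closed space \<open>C\<close>, so they are closed by Kato's criterion.\<close>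

lemma lower_at_pert:
  assumes p: "pert T S d r" and l: "lower_at T n"
  shows "lower_at S (n + d)"
proof -
  note T = pert_bop[OF p]
  have c: "qdim (range (T ^^ n)) (range (T ^^ Suc n)) \<noteq> \<infinity>" using l by (simp add: lower_at_def)
  obtain C where C: "subspace C" "closed C" "range (S ^^ (n + d)) \<subseteq> C" "qdim C (range (T ^^ n)) \<noteq> \<infinity>"
    by (rule pert_cover[OF p l[unfolded lower_at_def, THEN conjunct1]])
  have fin: "qdim C (range (S ^^ m)) \<noteq> \<infinity>" if "m \<ge> n" for m
  proof -
    have "qdim (range (T ^^ n)) (range (T ^^ (m + d))) \<noteq> \<infinity>"
      using finite_codim_iterate[OF T(1) c, of "m + d - n"] that by simp
    moreover have "qdim (range (T ^^ (m + d))) (range (S ^^ m)) \<noteq> \<infinity>"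
      using pert_range[OF pert_sym[OF p]] by (rule enat_finite_le_enat)
    ultimately have "qdim (range (T ^^ n)) (range (S ^^ m)) \<noteq> \<infinity>" by (rule qdim_finite_trans)
    with C(4) show ?thesis by (rule qdim_finite_trans)
  qed
  have sub: "range (S ^^ m) \<subseteq> C" if "m \<ge> n + d" for m
    by (rule order_trans[OF range_funpow_antimono[OF that] C(3)])
  have cl: "closed (range (S ^^ m))" if "m \<ge> n + d" for m
    by (rule closed_image_finite_codim[OF bop_funpow[OF T(2)] subspace_UNIV closed_UNIV C(1,2) sub[OF that]])
      (use fin[of m] that in simp)
  have "qdim (range (S ^^ (n + d))) (range (S ^^ Suc (n + d))) \<noteq> \<infinity>"
    using C(3) by (intro qdim_finite_mono[OF fin[of "Suc (n + d)"]]) auto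
  then show ?thesis using cl[of "n + d"] cl[of "Suc (n + d)"] by (simp add: lower_at_def)
qed

lemma pert_commute_funpow: "pert T S d r \<Longrightarrow> (T ^^ n) ((S ^^ m) x) = (S ^^ m) ((T ^^ n) x)"
proof -
  assume "pert T S d r"
  then have "T (S x) = S (T x)" for x by (simp add: pert_def)
  then have "T ((S ^^ m) x) = (S ^^ m) (T x)" for x using funpow_commute[of S T m x] by simp
  then show ?thesis by (rule funpow_commute)
qed

text \<open>In \<open>T^(1+d) = G S + E\<close> the operator \<open>E\<close> has finite rank. So if
  \<open>S (x n)\<close> converges, then \<open>T^(1+d) (x n)\<close> converges along a subsequence,
  and properness of \<open>T^(1+d)\<close> does the rest.\<close>

lemma seq_proper_pert:
  assumes p: "pert T S d r" and M: "subspace M" and sp: "\<And>k. seq_proper (T ^^ k) M"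
  shows "seq_proper S M"
  unfolding seq_proper_def
proof (intro allI impI, elim conjE)
  fix x :: "nat \<Rightarrow> 'a" and B l
  assume x: "\<forall>n. x n \<in> M \<and> norm (x n) \<le> B" and l: "(\<lambda>n. S (x n)) \<longlonglongrightarrow> l"
  obtain G E where GE: "bop sc G" "bop sc E" "\<And>x. (T ^^ (1 + d)) x = G ((S ^^ 1) x) + E x"
    "qdim (range E) {0} \<le> enat r"
    using pert_factor[OF pert_sym[OF p], of 1] by metis
  obtain K where K: "K > 0" "\<And>x. norm (E x) \<le> norm x * K"
    using bounded_linear.pos_bounded[OF bop_bounded_linear[OF GE(2)]] by blast
  have rc: "relatively_compact_bounded (range E)"
    using subspace_range[OF GE(2)] enat_finite_le_enat[OF GE(4)] by (rule relatively_compact_bounded_finite_dim)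
  have Eb: "norm (E (x n)) \<le> B * K" for n
    by (rule order_trans[OF K(2) mult_right_mono]) (use x K(1) in auto)
  obtain s e where s: "strict_mono s" "(\<lambda>n. E (x (s n))) \<longlonglongrightarrow> e"
    by (rule relatively_compact_boundedE[OF rc, where x = "\<lambda>n. E (x n)", OF _ Eb]) auto
  have "(\<lambda>n. S (x (s n))) \<longlonglongrightarrow> l" using LIMSEQ_subseq_LIMSEQ[OF l s(1)] by (simp add: o_def)
  then have "(\<lambda>n. G (S (x (s n))) + E (x (s n))) \<longlonglongrightarrow> G l + e"
    using s(2) by (intro tendsto_add bop_tendsto[OF GE(1)])
  then have lim: "(\<lambda>n. (T ^^ (1 + d)) (x (s n))) \<longlonglongrightarrow> G l + e" by (simp only: GE(3)) simp
  have xs: "x (s n) \<in> M" "norm (x (s n)) \<le> B" for n using x by auto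
  obtain t l' where t: "strict_mono t" "(\<lambda>n. x (s (t n))) \<longlonglongrightarrow> l'"
    by (rule seq_properE[OF sp, where x = "\<lambda>n. x (s n)", OF xs lim])
  have "strict_mono (s \<circ> t)" using s t by (simp add: strict_mono_o)
  then show "\<exists>r l'. strict_mono r \<and> (\<lambda>n. x (r n)) \<longlonglongrightarrow> l'"
    using t(2) by (intro exI[of _ "s \<circ> t"] exI[of _ l']) simp
qed

text \<open>Here the ranges of \<open>S\<close> may have infinite codimension in \<open>C\<close>,
  so Kato's criterion needs a smaller closed space around them.\<close>

lemma upper_at_pert:
  assumes p: "pert T S d r" and u: "upper_at T n"
  shows "upper_at S (n + d)"
proof -
  note T = pert_bop[OF p]
  let ?M = "range (T ^^ n)"
  have M: "subspace ?M" "closed ?M" using u subspace_range_funpow[OF T(1)] by (auto simp: upper_at_def)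
  have spT: "seq_proper (T ^^ k) ?M" for k using T u by (intro upper_at_seq_proper_funpow)
  have spS: "seq_proper S ?M" using p M(1) spT by (rule seq_proper_pert)
  have SM: "S ` ?M \<subseteq> ?M"
    using pert_commute_funpow[OF p, of n 1, symmetric] by auto
  have spSk: "seq_proper (S ^^ k) ?M" for k using T spS SM by (intro seq_proper_funpow)
  obtain C where C: "subspace C" "closed C" "range (S ^^ (n + d)) \<subseteq> C" "?M \<subseteq> C" "qdim C ?M \<noteq> \<infinity>"
    using pert_cover[OF p M(2)] by blast
  have kerC: "qdim ({x. L x = 0} \<inter> C) {0} \<noteq> \<infinity>" if L: "bop sc L" and sp: "seq_proper L ?M" for L
  proof -
    have "qdim (C \<inter> {x. L x = 0}) (?M \<inter> {x. L x = 0}) \<noteq> \<infinity>"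
      using C M subspace_ker[OF L] by (intro enat_finite_le[OF qdim_Int_mono C(5)])
    moreover have "qdim (?M \<inter> {x. L x = 0}) {0} \<noteq> \<infinity>"
      using seq_proper_kernel[OF L M(1) sp] by (metis Int_commute)
    ultimately have "qdim (C \<inter> {x. L x = 0}) {0} \<noteq> \<infinity>" by (rule qdim_finite_trans)
    then show ?thesis by (metis Int_commute)
  qed
  have cl: "closed (range (S ^^ m))" if m: "m \<ge> n + d" for m
  proof -
    \<comment> \<open>The closed space is cut out by \<open>T^n\<close>, which maps into
      \<open>?M\<close>, where \<open>S^m\<close> has closed image. If
      \<open>T^n y = S^m T^n z\<close>, then \<open>y - S^m z\<close> lies in the kernel of
      \<open>T^n\<close> within \<open>C\<close>, which is finite-dimensional.\<close>
    define A where "A = C \<inter> {y. (T ^^ n) y \<in> (S ^^ m) ` ?M}"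
    have Sm: "bop sc (S ^^ m)" and Tn: "bop sc (T ^^ n)" using T bop_funpow by auto
    have cSM: "closed ((S ^^ m) ` ?M)" by (rule seq_proper_closed_image[OF Sm M spSk])
    have "closed ((T ^^ n) -` ((S ^^ m) ` ?M))"
      using cSM linear_continuous_on[OF bop_bounded_linear[OF Tn]] by (intro closed_vimage) auto
    then have cA: "closed A" unfolding A_def using C(2) by (auto simp: vimage_def)
    have sA: "subspace A" unfolding A_def
      using C(1) subspace_preimage[OF Tn subspace_image[OF Sm M(1)]]
      by (rule subspace_inter)
    have sub: "range (S ^^ m) \<subseteq> A"
      using range_funpow_antimono[OF m, of S] C(3) pert_commute_funpow[OF p] unfolding A_def by auto
    have "qdim A (range (S ^^ m)) \<le> qdim ({x. (T ^^ n) x = 0} \<inter> A) {0}"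
    proof (rule qdim_sum_le)
      fix y assume y: "y \<in> A"
      then obtain z where z: "(T ^^ n) y = (S ^^ m) ((T ^^ n) z)" unfolding A_def by auto
      have "y - (S ^^ m) z \<in> {x. (T ^^ n) x = 0} \<inter> A"
        using y sA sub z by (auto simp: bop_diff[OF Tn] pert_commute_funpow[OF p] intro!: subspace_diff)
      then show "\<exists>b\<in>range (S ^^ m). \<exists>e\<in>{x. (T ^^ n) x = 0} \<inter> A. y = b + e"
        by (intro bexI[of _ "(S ^^ m) z"] bexI[of _ "y - (S ^^ m) z"]) auto
    qed (intro subspace_inter subspace_ker Tn sA)
    also have "\<dots> \<le> qdim ({x. (T ^^ n) x = 0} \<inter> C) {0}" by (rule qdim_mono) (auto simp: A_def)
    finally have "qdim A (range (S ^^ m)) \<noteq> \<infinity>" using kerC[OF Tn spT] by (rule enat_finite_le)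
    then show ?thesis
      by (rule closed_image_finite_codim[OF Sm subspace_UNIV closed_UNIV sA cA sub])
  qed
  have "qdim ({x. S x = 0} \<inter> range (S ^^ (n + d))) {0} \<noteq> \<infinity>"
    using C(3) by (intro qdim_finite_mono[OF kerC[OF T(2) spS]]) auto
  then show ?thesis using cl[of "n + d"] cl[of "Suc (n + d)"] by (simp add: upper_at_def)
qed

lemma edsc_pert:
  assumes p: "pert T S d r" and c: "qdim (range (T ^^ n)) (range (T ^^ Suc n)) \<noteq> \<infinity>"
  shows "qdim (range (S ^^ (n + d))) (range (S ^^ (n + d + j))) \<noteq> \<infinity>"
proof -
  note T = pert_bop[OF p]
  have "qdim (range (S ^^ (n + d))) (range (T ^^ n)) \<noteq> \<infinity>"
    using pert_range[OF p] by (rule enat_finite_le_enat)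
  moreover have "qdim (range (T ^^ (n + d + j + d))) (range (S ^^ (n + d + j))) \<noteq> \<infinity>"
    using pert_range[OF pert_sym[OF p]] by (rule enat_finite_le_enat)
  moreover have "qdim (range (T ^^ n)) (range (T ^^ (n + d + j + d))) \<noteq> \<infinity>"
    using finite_codim_iterate[OF T(1) c, of "d + j + d"] unfolding add.assoc .
  ultimately show ?thesis by (meson qdim_finite_trans)
qed

text \<open>All \<open>range (T ^^ j)\<close> with \<open>j \<ge> n\<close> coincide, so the ranges
  of \<open>S\<close> from exponent \<open>n + d\<close> on have codimension at most
  \<open>2 r\<close> in the first of them. A decreasing chain with such a uniform bound is
  eventually constant.\<close>

lemma dsc_pert:
  assumes p: "pert T S d r" and e: "range (T ^^ n) = range (T ^^ Suc n)"
  shows "\<exists>m. range (S ^^ m) = range (S ^^ Suc m)"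
proof -
  note T = pert_bop[OF p]
  define V where "V k = range (S ^^ (n + d + k))" for k
  have "qdim (V 0) (V k) \<le> enat (r + r)" for k
  proof -
    have "qdim (V 0) (V k) \<le> qdim (range (S ^^ (n + d))) (range (T ^^ n)) + qdim (range (T ^^ (n + d + k + d))) (V k)"
      using qdim_trans[of "V 0" "V k" "range (T ^^ n)"] range_stable[OF e, of "n + d + k + d"] by (simp add: V_def)
    also have "\<dots> \<le> enat r + enat r"
      unfolding V_def using pert_range[OF p] pert_range[OF pert_sym[OF p]] by (intro add_mono)
    finally show ?thesis by simp
  qed
  then obtain k0 where "\<And>k. k \<ge> k0 \<Longrightarrow> V (Suc k) = V k"
    using decreasing_subspaces_stabilise[of V "r + r"] subspace_range_funpow[OF T(2)]
      range_funpow_antimono[of _ _ S] unfolding V_def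
    by (metis add_Suc_right lessI less_imp_le_nat)
  then have "range (S ^^ (n + d + k0)) = range (S ^^ Suc (n + d + k0))" by (simp add: V_def del: funpow.simps)
  then show ?thesis by blast
qed

lemma asc_pert:
  assumes p: "pert T S d r" and e: "{x. (T ^^ n) x = 0} = {x. (T ^^ Suc n) x = 0}"
  shows "\<exists>m. {x. (S ^^ m) x = 0} = {x. (S ^^ Suc m) x = 0}"
proof -
  note T = pert_bop[OF p]
  define V where "V k = {x. (S ^^ (n + d + k)) x = 0}" for k
  have k: "qdim {x. (A ^^ k) x = 0} {x. (B ^^ (k + d)) x = 0} \<le> enat r" if "pert A B d r" for k A B
    using pert_kernel[OF that subspace_UNIV] by simp
  have "qdim (V k) (V 0) \<le> enat (r + r)" for k
  proof -
    have "qdim (V k) (V 0) \<le> qdim (V k) {x. (T ^^ (n + d + k + d)) x = 0} + qdim {x. (T ^^ n) x = 0} {x. (S ^^ (n + d)) x = 0}"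
      using qdim_trans[of "V k" "V 0" "{x. (T ^^ n) x = 0}"] ker_stable[OF e, of "n + d + k + d"] by (simp add: V_def)
    also have "\<dots> \<le> enat r + enat r"
      unfolding V_def using k[OF p] k[OF pert_sym[OF p]] by (intro add_mono)
    finally show ?thesis by simp
  qed
  then obtain k0 where "\<And>k. k \<ge> k0 \<Longrightarrow> V (Suc k) = V k"
    using increasing_subspaces_stabilise[of V "r + r"] subspace_ker_funpow[OF T(2)]
      ker_funpow_mono[OF T(2)] unfolding V_def
    by (metis add_Suc_right lessI less_imp_le_nat)
  then have "{x. (S ^^ (n + d + k0)) x = 0} = {x. (S ^^ Suc (n + d + k0)) x = 0}" by (simp add: V_def del: funpow.simps)
  then show ?thesis by blast
qed

section \<open>The index\<close>

definition nul :: "('a \<Rightarrow> 'a) \<Rightarrow> nat \<Rightarrow> enat" where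
  "nul T n = qdim ({x. T x = 0} \<inter> range (T ^^ n)) {0}"

definition cod :: "('a \<Rightarrow> 'a) \<Rightarrow> nat \<Rightarrow> enat" where
  "cod T n = qdim (range (T ^^ n)) (range (T ^^ Suc n))"

text \<open>An integer, meaningful only if both numbers are finite. Infinite defects are treated by
  comparing \<open>nul\<close> and \<open>cod\<close> as extended naturals.\<close>

definition index_at :: "('a \<Rightarrow> 'a) \<Rightarrow> nat \<Rightarrow> int" where
  "index_at T n = int (the_enat (nul T n)) - int (the_enat (cod T n))"

text \<open>The drops of \<open>nul\<close> and of \<open>cod\<close> from \<open>n\<close> to
  \<open>Suc n\<close> are the dimension of one and the same quotient of kernel parts. The additive
  form keeps the identity valid for infinite values.\<close>

lemma nul_cod_Suc:
  assumes T: "bop sc T"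
  shows "cod T n + nul T (Suc n) = cod T (Suc n) + nul T n"
proof -
  let ?R = "\<lambda>n. range (T ^^ n)" and ?N = "{x. T x = 0}"
  have R: "subspace (?R n)" for n using T by (rule subspace_range_funpow)
  have N: "subspace ?N" using T by (rule subspace_ker)
  have sub: "?R (Suc n) \<subseteq> ?R n" by (rule range_funpow_antimono) simp
  let ?q = "qdim (?N \<inter> ?R n) (?N \<inter> ?R (Suc n))"
  have "cod T n = cod T (Suc n) + ?q"
    using qdim_rank_nullity[OF bop_linear[OF T] R R sub]
    unfolding cod_def range_funpow_Suc[symmetric] by (metis Int_commute)
  moreover have "nul T n = ?q + nul T (Suc n)"
    unfolding nul_def using sub N R subspace_0[OF N] subspace_0[OF R]
    by (intro qdim_add subspace_inter) (auto simp del: funpow.simps)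
  ultimately show ?thesis by (simp add: ac_simps)
qed

lemma nul_antimono: "n \<le> m \<Longrightarrow> nul T m \<le> nul T n"
  unfolding nul_def using range_funpow_antimono[of n m T] by (intro qdim_mono) auto

lemma cod_antimono: "bop sc T \<Longrightarrow> n \<le> m \<Longrightarrow> cod T m \<le> cod T n"
  unfolding cod_def by (rule codim_antimono)

lemma index_at_Suc:
  assumes T: "bop sc T" and fin: "nul T n \<noteq> \<infinity>" "cod T n \<noteq> \<infinity>"
  shows "index_at T (Suc n) = index_at T n"
proof -
  have "nul T (Suc n) \<noteq> \<infinity>" "cod T (Suc n) \<noteq> \<infinity>"
    using enat_finite_le[OF nul_antimono[of n "Suc n"] fin(1)]
      enat_finite_le[OF cod_antimono[OF T, of n "Suc n"] fin(2)] by simp_all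
  then obtain a b c d where "nul T n = enat a" "cod T n = enat b" "nul T (Suc n) = enat c" "cod T (Suc n) = enat d"
    using fin by (metis not_infinity_eq)
  with nul_cod_Suc[OF T, of n] show ?thesis unfolding index_at_def by simp
qed

lemma index_at_mono:
  assumes T: "bop sc T" and fin: "nul T n \<noteq> \<infinity>" "cod T n \<noteq> \<infinity>" and "n \<le> m"
  shows "index_at T m = index_at T n"
  using \<open>n \<le> m\<close>
proof (induction m rule: dec_induct)
  case (step m)
  then show ?case
    using index_at_Suc[OF T, of m] enat_finite_le[OF nul_antimono[of n m] fin(1)]
      enat_finite_le[OF cod_antimono[OF T, of n m] fin(2)] by simp
qed simp

lemma index_at_iterate:
  assumes T: "bop sc T"
  shows "nul T n \<noteq> \<infinity> \<Longrightarrow> cod T n \<noteq> \<infinity> \<Longrightarrow>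
    \<exists>a c. qdim ({x. (T ^^ m) x = 0} \<inter> range (T ^^ n)) {0} = enat a \<and>
      qdim (range (T ^^ n)) (range (T ^^ (n + m))) = enat c \<and>
      int a - int c = int m * index_at T n"
proof (induction m arbitrary: n)
  case 0
  have "{x. x = 0} \<inter> range (T ^^ n) \<subseteq> {0::'a}" by auto
  then show ?case by (intro exI[of _ 0]) (auto simp: qdim_eq_0 zero_enat_def[symmetric])
next
  case (Suc m)
  let ?R = "\<lambda>n. range (T ^^ n)" and ?N = "\<lambda>m. {x. (T ^^ m) x = 0}"
  have R: "subspace (?R n)" for n using T by (rule subspace_range_funpow)
  have N: "subspace (?N m)" for m using T by (rule subspace_ker_funpow)
  have fin: "nul T (Suc n) \<noteq> \<infinity>" "cod T (Suc n) \<noteq> \<infinity>"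
    using enat_finite_le[OF nul_antimono[of n "Suc n"] Suc.prems(1)]
      enat_finite_le[OF cod_antimono[OF T, of n "Suc n"] Suc.prems(2)] by simp_all
  obtain a c where ac: "qdim (?N m \<inter> ?R (Suc n)) {0} = enat a"
    "qdim (?R (Suc n)) (?R (Suc n + m)) = enat c" "int a - int c = int m * index_at T (Suc n)"
    using Suc.IH[OF fin] by blast
  obtain a0 c0 where ac0: "nul T n = enat a0" "cod T n = enat c0"
    using Suc.prems by (metis not_infinity_eq)
  let ?A = "?N (Suc m) \<inter> ?R n"
  \<comment> \<open>\<open>T\<close> trades one power for one level: it maps the kernel of
    \<open>T^(m+1)\<close> at level \<open>n\<close> onto the kernel of \<open>T^m\<close> at level
    \<open>n + 1\<close>. This is why the induction generalises over \<open>n\<close>.\<close>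
  have "T ` ?A = ?N m \<inter> ?R (Suc n)"
  proof
    show "T ` ?A \<subseteq> ?N m \<inter> ?R (Suc n)" by (auto simp: funpow_swap1)
    show "?N m \<inter> ?R (Suc n) \<subseteq> T ` ?A"
    proof
      fix y assume y: "y \<in> ?N m \<inter> ?R (Suc n)"
      then obtain x where "y = T ((T ^^ n) x)" by auto
      with y show "y \<in> T ` ?A" by (intro image_eqI[of _ _ "(T ^^ n) x"]) (auto simp: funpow_swap1)
    qed
  qed
  moreover have "?A \<inter> {x. T x = 0} = {x. T x = 0} \<inter> ?R n"
    using bop_0[OF bop_funpow[OF T]] by (auto simp: funpow_Suc_right simp del: funpow.simps)
  moreover have "subspace ?A" using N R by (rule subspace_inter)
  ultimately have 1: "qdim ?A {0} = enat (a + a0)"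
    using qdim_image_add_kernel[OF bop_linear[OF T], of ?A] ac ac0 by (simp add: nul_def)
  have "qdim (?R n) (?R (n + Suc m)) = qdim (?R n) (?R (Suc n)) + qdim (?R (Suc n)) (?R (n + Suc m))"
    using R range_funpow_antimono[of n "Suc n" T] range_funpow_antimono[of "Suc n" "n + Suc m" T]
    by (intro qdim_add) (auto simp del: funpow.simps)
  then have 2: "qdim (?R n) (?R (n + Suc m)) = enat (c0 + c)"
    using ac ac0 by (simp add: cod_def)
  have "int (a + a0) - int (c0 + c) = int (Suc m) * index_at T n"
  proof -
    have i: "index_at T n = int a0 - int c0" using ac0 by (simp add: index_at_def)
    show ?thesis using ac(3) unfolding index_at_Suc[OF T Suc.prems] i by (simp add: algebra_simps)
  qed
  with 1 2 show ?case by blast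
qed

text \<open>The index of \<open>T^m\<close> is \<open>m\<close> times the index of \<open>T\<close>, while the defect numbers of \<open>T^m\<close> and \<open>S^m\<close>
  differ by an amount independent of \<open>m\<close>.\<close>
lemma index_at_pert_le:
  assumes p: "pert T S d r"
    and finT: "nul T (n + d) \<noteq> \<infinity>" "cod T (n + d) \<noteq> \<infinity>"
    and finS: "nul S n \<noteq> \<infinity>" "cod S n \<noteq> \<infinity>"
  shows "index_at T (n + d) \<le> index_at S n"
proof -
  note T = pert_bop[OF p]
  note p' = pert_sym[OF p]
  let ?RT = "\<lambda>n. range (T ^^ n)" and ?NT = "\<lambda>m. {x. (T ^^ m) x = 0}"
  let ?RS = "\<lambda>n. range (S ^^ n)" and ?NS = "\<lambda>m. {x. (S ^^ m) x = 0}"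
  have RT: "subspace (?RT n)" and RS: "subspace (?RS n)" for n
    using T by (auto intro: subspace_range_funpow)
  have NT: "subspace (?NT n)" and NS: "subspace (?NS n)" for n
    using T by (auto intro: subspace_ker_funpow)
  \<comment> \<open>Costs of the surplus exponents, \<open>d\<close> on kernels and
    \<open>d + d\<close> on ranges; neither depends on \<open>m\<close>.\<close>
  obtain a1 where a1: "qdim (?NS d \<inter> ?RS n) {0} = enat a1"
    using index_at_iterate[OF T(2) finS, of d] by blast
  obtain c1 where c1: "qdim (?RS n) (?RS (n + (d + d))) = enat c1"
    using index_at_iterate[OF T(2) finS, of "d + d"] by blast
  \<comment> \<open>Two comparisons of cost \<open>r\<close> occur in the estimate for
    \<open>a\<close> and two in that for \<open>c'\<close>, which accounts for
    \<open>3 * r + r\<close>.\<close>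
  have main: "int m * index_at T (n + d) \<le> int m * index_at S n + int (3 * r + r + a1 + c1)" for m
  proof -
    obtain a c where ac: "qdim (?NT m \<inter> ?RT (n + d)) {0} = enat a"
      "qdim (?RT (n + d)) (?RT (n + d + m)) = enat c" "int a - int c = int m * index_at T (n + d)"
      using index_at_iterate[OF T(1) finT, of m] by blast
    obtain a' c' where ac': "qdim (?NS m \<inter> ?RS n) {0} = enat a'"
      "qdim (?RS n) (?RS (n + m)) = enat c'" "int a' - int c' = int m * index_at S n"
      using index_at_iterate[OF T(2) finS, of m] by blast
    have "qdim (?NT m \<inter> ?RT (n + d)) {0} \<le> qdim (?NT m \<inter> ?RT (n + d)) (?NT m \<inter> ?RS n) +
      (qdim (?NT m \<inter> ?RS n) (?NS (m + d) \<inter> ?RS n) + qdim (?NS (m + d) \<inter> ?RS n) {0})"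
      by (rule qdim_trans3)
    also have "\<dots> \<le> enat r + (enat r + enat (a1 + a'))"
    proof (intro add_mono)
      have "qdim (?NT m \<inter> ?RT (n + d)) (?NT m \<inter> ?RS n) \<le> qdim (?RT (n + d)) (?RS n)"
        using qdim_Int_mono[OF RT[of "n + d"] RS[of n] NT[of m]] by (simp add: Int_commute)
      also have "\<dots> \<le> enat r" using p' by (rule pert_range)
      finally show "qdim (?NT m \<inter> ?RT (n + d)) (?NT m \<inter> ?RS n) \<le> enat r" .
      show "qdim (?NT m \<inter> ?RS n) (?NS (m + d) \<inter> ?RS n) \<le> enat r" using p RS by (rule pert_kernel)
      let ?A = "?NS (m + d) \<inter> ?RS n"
      have "qdim ?A {0} = qdim ((S ^^ m) ` ?A) {0} + qdim (?A \<inter> ?NS m) {0}"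
        by (intro qdim_image_add_kernel bop_linear bop_funpow T subspace_inter NS RS)
      also have "\<dots> \<le> enat a1 + enat a'"
      proof (intro add_mono)
        have "(S ^^ m) ` ?A \<subseteq> ?NS d \<inter> ?RS n"
        proof
          fix y assume "y \<in> (S ^^ m) ` ?A"
          then obtain x z where xz: "y = (S ^^ m) x" "(S ^^ (m + d)) x = 0" "x = (S ^^ n) z" by auto
          have "(S ^^ d) y = (S ^^ (m + d)) x" unfolding xz(1) by (metis add.commute comp_apply funpow_add)
          moreover have "y = (S ^^ n) ((S ^^ m) z)" unfolding xz(1,3) by (metis add.commute comp_apply funpow_add)
          ultimately show "y \<in> ?NS d \<inter> ?RS n" using xz(2) by auto
        qed
        then show "qdim ((S ^^ m) ` ?A) {0} \<le> enat a1" unfolding a1[symmetric] by (intro qdim_mono) auto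
        show "qdim (?A \<inter> ?NS m) {0} \<le> enat a'" unfolding ac'(1)[symmetric] by (intro qdim_mono) auto
      qed
      finally show "qdim ?A {0} \<le> enat (a1 + a')" by simp
    qed
    finally have A: "a \<le> r + (r + (a1 + a'))" using ac(1) by simp
    have "qdim (?RS n) (?RS (n + m)) \<le> (qdim (?RS n) (?RS (n + (d + d))) + qdim (?RS (n + (d + d))) (?RT (n + d)))
       + (qdim (?RT (n + d)) (?RT (n + d + m)) + qdim (?RT (n + d + m)) (?RS (n + m)))"
      by (rule order_trans[OF qdim_trans add_mono[OF qdim_trans qdim_trans]])
    also have "\<dots> \<le> (enat c1 + enat r) + (enat c + enat r)"
      using pert_range[OF p, of "n + d"] pert_range[OF p', of "n + m"] c1 ac(2)
      by (intro add_mono) (simp_all add: ac_simps)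
    finally have C: "c' \<le> c1 + r + (c + r)" using ac'(2) by simp
    from A C have "int a - int c \<le> int a' - int c' + int (3 * r + r + a1 + c1)" by simp
    then show ?thesis using ac(3) ac'(3) by simp
  qed
  show ?thesis
  proof (rule ccontr)
    assume "\<not> ?thesis"
    then have 1: "index_at T (n + d) - index_at S n \<ge> 1" by simp
    \<comment> \<open>With \<open>m = K + 1\<close> an index gap of at least 1 would exceed the
      total error \<open>K\<close>.\<close>
    define K where "K = 3 * r + r + a1 + c1"
    have "int (Suc K) * 1 \<le> int (Suc K) * (index_at T (n + d) - index_at S n)"
      using 1 by (intro mult_left_mono) auto
    also have "\<dots> \<le> int K" using main[of "Suc K"] unfolding K_def[symmetric] by (simp only: right_diff_distrib)
    finally show False by simp
  qed
qed

section \<open>The defined notions expressed through quotient dimensions\<close>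

lemma cdim_eq: "subspace S \<Longrightarrow> cdim sc S = qdim S {0}"
proof -
  assume S: "subspace S"
  show ?thesis
  proof (cases "qdim S {0} = \<infinity>")
    case True
    have "\<not> (finite B \<and> S \<subseteq> span B)" for B
      using qdim_le[of B S "{0}"] True by auto
    then show ?thesis using True unfolding cdim_def by auto
  next
    case False
    have z: "{0} \<subseteq> S" using S by (simp add: subspace_0)
    obtain H where H: "finite H" "H \<subseteq> S" "independent H" "S = span ({0} \<union> H)" "qdim S {0} = enat (card H)"
      using qdim_attained_subset[OF S subspace_single_0 z False] by metis
    then have "dim S = card H" using dim_span_eq_card_independent[of H] by simp
    moreover have "S \<subseteq> span H" using H(4) by simp
    ultimately show ?thesis using H unfolding cdim_def by auto
  qed
qed

text \<open>A complement exists by \<open>relative_basis_exists\<close>, so the \<open>SOME\<close>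
  is meaningful, and \<open>qdim_sum\<close> shows that every complement has the dimension of the
  quotient.\<close>

lemma rcodim_eq:
  assumes M: "subspace M" and R: "subspace R" and RM: "R \<subseteq> M"
  shows "rcodim sc M R = qdim M R"
proof -
  obtain H where H: "H \<subseteq> M" "independent H" "span H \<inter> R = {0}" "M = span (R \<union> H)"
    using relative_basis_exists[OF M R RM] .
  have "is_complement sc M R (span H)"
    unfolding is_complement_def
    using H R M span_minimal[OF H(1) M] by (auto simp: span_Un span_of_subspace)
  then have c: "is_complement sc M R (SOME C. is_complement sc M R C)" by (rule someI)
  define C where "C = (SOME C. is_complement sc M R C)"
  have C: "subspace C" "C \<inter> R = {0}" "{x + y | x y. x \<in> R \<and> y \<in> C} = M"
    using c[folded C_def] unfolding is_complement_def by auto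
  have "span (C \<union> R) = M" using C R unfolding span_Un by (force simp: span_of_subspace add.commute)
  then have "qdim M R = qdim C {0}" using qdim_sum[OF C(1) R] C(2) by simp
  then show ?thesis unfolding rcodim_def C_def[symmetric] using cdim_eq[OF C(1)] by simp
qed

lemma alpha_on_eq: "bop sc T \<Longrightarrow> alpha_on sc T (range (T ^^ n)) = nul T n"
proof -
  assume T: "bop sc T"
  have "kern_on T (range (T ^^ n)) = {x. T x = 0} \<inter> range (T ^^ n)" by (auto simp: kern_on_def)
  then show ?thesis
    unfolding alpha_on_def nul_def
    by (simp add: cdim_eq subspace_inter subspace_ker[OF T] subspace_range_funpow[OF T])
qed

lemma rcodim_range: "bop sc T \<Longrightarrow> rcodim sc (range (T ^^ n)) (range (T ^^ Suc n)) = cod T n"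
  unfolding cod_def by (intro rcodim_eq subspace_range_funpow range_funpow_antimono) auto

lemma beta_on_eq: "bop sc T \<Longrightarrow> beta_on sc T (range (T ^^ n)) = cod T n"
  unfolding beta_on_def range_funpow_Suc[symmetric] by (rule rcodim_range)

lemma upper_sf_on_iff:
  "bop sc T \<Longrightarrow> closed (range (T ^^ n)) \<and> upper_sf_on sc T (range (T ^^ n)) \<longleftrightarrow> upper_at T n"
  unfolding upper_sf_on_def upper_at_def range_funpow_Suc[symmetric] nul_def[symmetric]
  by (simp add: alpha_on_eq)

lemma lower_sf_on_iff:
  "bop sc T \<Longrightarrow> closed (range (T ^^ n)) \<and> lower_sf_on sc T (range (T ^^ n)) \<longleftrightarrow> lower_at T n"
  unfolding lower_sf_on_def lower_at_def range_funpow_Suc[symmetric] cod_def[symmetric]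
  by (simp add: beta_on_eq)

text \<open>\<open>x\<close> lies in the kernel of \<open>T^(m+n)\<close> exactly if
  \<open>T^n x\<close> lies in that of \<open>T^m\<close>. Restriction to the range of
  \<open>T^n\<close> thus shifts the ascent by at most \<open>n\<close>, and its finiteness is the
  same at every level.\<close>

lemma asc_on_iff:
  assumes T: "bop sc T"
  shows "asc_on T (range (T ^^ n)) \<noteq> \<infinity> \<longleftrightarrow> (\<exists>q. {x. (T ^^ q) x = 0} = {x. (T ^^ Suc q) x = 0})"
proof -
  have "asc_on T (range (T ^^ n)) \<noteq> \<infinity> \<longleftrightarrow> (\<exists>m. kern_on (T ^^ m) (range (T ^^ n)) = kern_on (T ^^ Suc m) (range (T ^^ n)))"
    unfolding asc_on_def by (simp del: funpow.simps)
  also have "\<dots> \<longleftrightarrow> (\<exists>q. {x. (T ^^ q) x = 0} = {x. (T ^^ Suc q) x = 0})"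
  proof
    assume "\<exists>m. kern_on (T ^^ m) (range (T ^^ n)) = kern_on (T ^^ Suc m) (range (T ^^ n))"
    then obtain m where m: "kern_on (T ^^ m) (range (T ^^ n)) = kern_on (T ^^ Suc m) (range (T ^^ n))" by blast
    have "(T ^^ (m + n)) x = 0 \<longleftrightarrow> (T ^^ Suc (m + n)) x = 0" for x
    proof -
      have "(T ^^ (m + n)) x = 0 \<longleftrightarrow> (T ^^ n) x \<in> kern_on (T ^^ m) (range (T ^^ n))"
        by (simp add: funpow_add kern_on_def)
      also have "\<dots> \<longleftrightarrow> (T ^^ Suc (m + n)) x = 0"
        unfolding m by (simp add: funpow_add kern_on_def)
      finally show ?thesis .
    qed
    then show "\<exists>q. {x. (T ^^ q) x = 0} = {x. (T ^^ Suc q) x = 0}" by (intro exI[of _ "m + n"]) blast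
  next
    assume "\<exists>q. {x. (T ^^ q) x = 0} = {x. (T ^^ Suc q) x = 0}"
    then show "\<exists>m. kern_on (T ^^ m) (range (T ^^ n)) = kern_on (T ^^ Suc m) (range (T ^^ n))"
      unfolding kern_on_def by blast
  qed
  finally show ?thesis .
qed

lemma dsc_on_iff:
  "dsc_on T (range (T ^^ n)) \<noteq> \<infinity> \<longleftrightarrow> (\<exists>q. range (T ^^ q) = range (T ^^ Suc q))"
proof -
  have "dsc_on T (range (T ^^ n)) \<noteq> \<infinity> \<longleftrightarrow> (\<exists>m. (T ^^ m) ` range (T ^^ n) = (T ^^ Suc m) ` range (T ^^ n))"
    unfolding dsc_on_def by (simp del: funpow.simps)
  also have "\<dots> \<longleftrightarrow> (\<exists>m. range (T ^^ (m + n)) = range (T ^^ Suc (m + n)))"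
    unfolding range_funpow_add[symmetric] by simp
  also have "\<dots> \<longleftrightarrow> (\<exists>q. range (T ^^ q) = range (T ^^ Suc q))"
  proof
    assume "\<exists>q. range (T ^^ q) = range (T ^^ Suc q)"
    then obtain q where q: "range (T ^^ q) = range (T ^^ Suc q)" by blast
    have "range (T ^^ (q + n)) = range (T ^^ Suc (q + n))"
      using range_stable[OF q, of "q + n"] range_stable[OF q, of "Suc (q + n)"] by (simp del: funpow.simps)
    then show "\<exists>m. range (T ^^ (m + n)) = range (T ^^ Suc (m + n))" by blast
  qed blast
  finally show ?thesis .
qed

section \<open>Stability of the spectral properties\<close>

text \<open>Finite ascent and descent. Invertible operators are included, with
  \<open>q = 0\<close>.\<close>

definition pole :: "('a \<Rightarrow> 'a) \<Rightarrow> bool" where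
  "pole T \<longleftrightarrow> (\<exists>q. range (T ^^ q) = range (T ^^ Suc q)) \<and>
     (\<exists>q. {x. (T ^^ q) x = 0} = {x. (T ^^ Suc q) x = 0})"

text \<open>Stationary images write \<open>M\<close> as the sum of the image and a closed kernel
  part; injectivity of \<open>T\<close> on the image makes the sum direct, and
  \<open>closed_image_complemented\<close> then yields closedness.\<close>

lemma closed_stable_image:
  assumes T: "bop sc T" and M: "subspace M" "closed M" and inv: "T ` M \<subseteq> M"
    and st: "(T ^^ p) ` M = (T ^^ Suc p) ` M" and inj: "{x. T x = 0} \<inter> (T ^^ p) ` M \<subseteq> {0}"
  shows "closed ((T ^^ p) ` M)"
    and "M = {(T ^^ p) x + z | x z. x \<in> M \<and> z \<in> {x. (T ^^ p) x = 0} \<inter> M}"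
    and "(T ^^ p) ` M \<inter> {x. (T ^^ p) x = 0} \<subseteq> {0}"
proof -
  let ?L = "(T ^^ p) ` M" and ?Z = "{x. (T ^^ p) x = 0} \<inter> M"
  have Tp: "bop sc (T ^^ p)" using T by (rule bop_funpow)
  have "T ` ?L = (T ^^ Suc p) ` M" by (simp add: image_comp)
  then have TL: "T ` ?L = ?L" by (simp only: st[symmetric])
  have TkL: "(T ^^ k) ` ?L = ?L" for k
  proof (induction k)
    case (Suc k)
    have "(T ^^ Suc k) ` ?L = T ` (T ^^ k) ` ?L" by (simp only: funpow.simps image_comp[symmetric])
    then show ?case by (simp only: Suc TL)
  qed simp
  have invp: "(T ^^ k) ` M \<subseteq> M" for k
    by (induction k) (use inv in \<open>auto simp: image_subset_iff\<close>)
  have ker: "x = 0" if "x \<in> ?L" "(T ^^ k) x = 0" for x k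
    using that
  proof (induction k arbitrary: x)
    case (Suc k)
    have "T x \<in> ?L" using Suc.prems TL by blast
    moreover have "(T ^^ k) (T x) = 0" using Suc.prems by (simp add: funpow_swap1)
    ultimately have "T x = 0" by (rule Suc.IH)
    with Suc.prems inj show ?case by auto
  qed simp
  show dec: "M = {(T ^^ p) x + z | x z. x \<in> M \<and> z \<in> ?Z}"
  proof
    show "{(T ^^ p) x + z | x z. x \<in> M \<and> z \<in> ?Z} \<subseteq> M"
      using invp[of p] M by (auto intro: subspace_add)
    show "M \<subseteq> {(T ^^ p) x + z | x z. x \<in> M \<and> z \<in> ?Z}"
    proof
      fix x assume x: "x \<in> M"
      then have "(T ^^ p) x \<in> (T ^^ p) ` ?L" using TkL by auto
      then obtain y where y: "y \<in> M" "(T ^^ p) x = (T ^^ p) ((T ^^ p) y)" by auto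
      have "x - (T ^^ p) y \<in> ?Z"
        using x y invp[of p] M by (auto simp: bop_diff[OF Tp] intro!: subspace_diff)
      then show "x \<in> {(T ^^ p) x + z | x z. x \<in> M \<and> z \<in> ?Z}"
        using y by (intro CollectI exI[of _ y] exI[of _ "x - (T ^^ p) y"]) auto
    qed
  qed
  show int: "?L \<inter> {x. (T ^^ p) x = 0} \<subseteq> {0}" using ker by blast
  show "closed ?L"
    by (rule closed_image_complemented[OF bop_bounded_linear[OF Tp] real_subspace[OF M(1)] M(2)
          real_subspace[OF subspace_inter[OF subspace_ker[OF Tp] M(1)]]
          closed_Int[OF closed_ker[OF Tp] M(2)] M(2) dec[symmetric]])
      (use int in blast)
qed

lemma poleE:
  assumes T: "bop sc T" and "pole T"
  obtains p where "range (T ^^ p) = range (T ^^ Suc p)" "{x. T x = 0} \<inter> range (T ^^ p) \<subseteq> {0}"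
    "{x. (T ^^ p) x = 0} = {x. (T ^^ Suc p) x = 0}" "closed (range (T ^^ p))"
proof -
  obtain q q' where q: "range (T ^^ q) = range (T ^^ Suc q)"
    and q': "{x. (T ^^ q') x = 0} = {x. (T ^^ Suc q') x = 0}" using assms(2) by (auto simp: pole_def)
  define p where "p = max q q'"
  have 1: "range (T ^^ p) = range (T ^^ Suc p)"
    using range_stable[OF q, of p] range_stable[OF q, of "Suc p"] by (simp add: p_def del: funpow.simps)
  have 2: "{x. (T ^^ p) x = 0} = {x. (T ^^ Suc p) x = 0}"
    using ker_stable[OF q', of p] ker_stable[OF q', of "Suc p"] by (simp add: p_def del: funpow.simps)
  have 3: "{x. T x = 0} \<inter> range (T ^^ p) \<subseteq> {0}"
    using 2 by auto
  have "closed (range (T ^^ p))"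
    using 1 3 by (intro closed_stable_image(1)[OF T]) auto
  with 1 2 3 that show ?thesis by blast
qed

lemma ind_on_eq: "bop sc T \<Longrightarrow> ind_on sc T (range (T ^^ n)) = ereal_of_enat (nul T n) - ereal_of_enat (cod T n)"
  by (simp add: ind_on_def alpha_on_eq beta_on_eq)

lemma upper_at_nul: "upper_at T n \<Longrightarrow> nul T n \<noteq> \<infinity>"
  by (simp add: upper_at_def nul_def)

lemma lower_at_cod: "lower_at T n \<Longrightarrow> cod T n \<noteq> \<infinity>"
  by (simp add: lower_at_def cod_def)

lemma upper_lower_at: "upper_at T n \<Longrightarrow> cod T n \<noteq> \<infinity> \<Longrightarrow> lower_at T n"
  "lower_at T n \<Longrightarrow> nul T n \<noteq> \<infinity> \<Longrightarrow> upper_at T n"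
  by (simp_all add: upper_at_def lower_at_def nul_def cod_def)

lemma upper_sbf_iff: "bop sc T \<Longrightarrow> upper_sbf sc T \<longleftrightarrow> (\<exists>n. upper_at T n)"
  unfolding upper_sbf_def B_prop_def by (simp only: upper_sf_on_iff)

lemma lower_sbf_iff: "bop sc T \<Longrightarrow> lower_sbf sc T \<longleftrightarrow> (\<exists>n. lower_at T n)"
  unfolding lower_sbf_def B_prop_def by (simp only: lower_sf_on_iff)

lemma b_fredholm_iff: "bop sc T \<Longrightarrow> b_fredholm sc T \<longleftrightarrow> (\<exists>n. upper_at T n \<and> lower_at T n)"
  unfolding b_fredholm_def B_prop_def fredholm_on_def
  using upper_sf_on_iff[of T] lower_sf_on_iff[of T] by blast

lemma upper_sbw_iff: "bop sc T \<Longrightarrow> upper_sbw sc T \<longleftrightarrow> (\<exists>n. upper_at T n \<and> nul T n \<le> cod T n)"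
  unfolding upper_sbw_def B_prop_def
  using upper_sf_on_iff[of T] ind_on_eq[of T] ereal_of_enat_diff_le_0 upper_at_nul by metis

lemma lower_sbw_iff: "bop sc T \<Longrightarrow> lower_sbw sc T \<longleftrightarrow> (\<exists>n. lower_at T n \<and> cod T n \<le> nul T n)"
  unfolding lower_sbw_def B_prop_def
  using lower_sf_on_iff[of T] ind_on_eq[of T] ereal_of_enat_diff_ge_0 lower_at_cod by metis

lemma b_weyl_iff:
  assumes T: "bop sc T"
  shows "b_weyl sc T \<longleftrightarrow> (\<exists>n. upper_at T n \<and> lower_at T n \<and> nul T n = cod T n)"
proof -
  have "closed (range (T ^^ n)) \<and> fredholm_on sc T (range (T ^^ n)) \<and> ind_on sc T (range (T ^^ n)) = 0
    \<longleftrightarrow> upper_at T n \<and> lower_at T n \<and> nul T n = cod T n" for n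
  proof -
    have "ind_on sc T (range (T ^^ n)) = 0 \<longleftrightarrow> nul T n = cod T n" if "upper_at T n" "lower_at T n"
      using ereal_of_enat_diff_le_0[OF upper_at_nul[OF that(1)], of "cod T n"]
        ereal_of_enat_diff_ge_0[OF lower_at_cod[OF that(2)], of "nul T n"]
      unfolding ind_on_eq[OF T] by (metis antisym order_refl)
    then show ?thesis unfolding fredholm_on_def
      using upper_sf_on_iff[OF T, of n] lower_sf_on_iff[OF T, of n] by blast
  qed
  then show ?thesis unfolding b_weyl_def B_prop_def by simp
qed

lemma upper_sbb_iff:
  "bop sc T \<Longrightarrow> upper_sbb sc T \<longleftrightarrow> (\<exists>n. upper_at T n) \<and> (\<exists>q. {x. (T ^^ q) x = 0} = {x. (T ^^ Suc q) x = 0})"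
  unfolding upper_sbb_def B_prop_def upper_sb_on_def
  by (simp only: asc_on_iff conj_assoc[symmetric] upper_sf_on_iff) blast

lemma lower_sbb_iff:
  "bop sc T \<Longrightarrow> lower_sbb sc T \<longleftrightarrow> (\<exists>n. lower_at T n) \<and> (\<exists>q. range (T ^^ q) = range (T ^^ Suc q))"
  unfolding lower_sbb_def B_prop_def lower_sb_on_def
  by (simp only: dsc_on_iff conj_assoc[symmetric] lower_sf_on_iff) blast

text \<open>At a level where ranges and kernels are stationary \<open>T\<close> acts bijectively,
  hence is Browder there with ascent and descent 0.\<close>

lemma b_browder_iff:
  assumes T: "bop sc T"
  shows "b_browder sc T \<longleftrightarrow> pole T"
proof
  assume "b_browder sc T"
  then obtain n where "asc_on T (range (T ^^ n)) \<noteq> \<infinity>" "dsc_on T (range (T ^^ n)) \<noteq> \<infinity>"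
    unfolding b_browder_def B_prop_def browder_on_def by metis
  then show "pole T" unfolding asc_on_iff[OF T] dsc_on_iff pole_def by blast
next
  assume "pole T"
  then obtain p where p: "range (T ^^ p) = range (T ^^ Suc p)" "{x. T x = 0} \<inter> range (T ^^ p) \<subseteq> {0}"
    "closed (range (T ^^ p))" using poleE[OF T] by metis
  let ?M = "range (T ^^ p)"
  have "upper_at T p" "lower_at T p"
    using p(3) p(1)[symmetric] qdim_eq_0[OF p(2)] unfolding upper_at_def lower_at_def
    by (simp_all add: qdim_eq_0 del: funpow.simps)
  then have f: "fredholm_on sc T ?M"
    using upper_sf_on_iff[OF T] lower_sf_on_iff[OF T] by (auto simp: fredholm_on_def)
  have "kern_on (T ^^ 0) ?M = kern_on (T ^^ Suc 0) ?M"
    using p(2) bop_0[OF T] unfolding kern_on_def by auto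
  then have a: "asc_on T ?M = 0"
    unfolding asc_on_def by (metis (mono_tags, lifting) Least_eq_0 zero_enat_def)
  have "T ` ?M = ?M" using p(1) by (simp only: range_funpow_Suc)
  then have "(T ^^ 0) ` ?M = (T ^^ Suc 0) ` ?M" by simp
  then have "dsc_on T ?M = 0"
    unfolding dsc_on_def by (metis (mono_tags, lifting) Least_eq_0 zero_enat_def)
  with a f p(3) show "b_browder sc T" unfolding b_browder_def B_prop_def browder_on_def by (intro exI[of _ p]) simp
qed

lemma dsc_iff: "dsc T \<noteq> \<infinity> \<longleftrightarrow> (\<exists>q. range (T ^^ q) = range (T ^^ Suc q))"
  using dsc_on_iff[of T 0] by (simp add: dsc_def)

lemma dsc_e_iff: "bop sc T \<Longrightarrow> dsc_e sc T \<noteq> \<infinity> \<longleftrightarrow> (\<exists>n. cod T n \<noteq> \<infinity>)"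
  unfolding dsc_e_def c_num_def by (simp only: rcodim_range) simp

text \<open>Cancelling the finite \<open>nul\<close> values in \<open>nul_cod_Suc\<close> carries
  the inequality one level up, also when \<open>cod\<close> is infinite.\<close>

lemma upper_weyl_mono:
  assumes T: "bop sc T" and u: "upper_at T n" "nul T n \<le> cod T n" and "n \<le> m"
  shows "nul T m \<le> cod T m"
  using \<open>n \<le> m\<close>
proof (induction m rule: dec_induct)
  case (step m)
  have "nul T m \<noteq> \<infinity>" "nul T (Suc m) \<noteq> \<infinity>"
    using upper_at_nul upper_at_mono[OF T u(1)] step(1) by auto
  then show ?case using nul_cod_Suc[OF T, of m] step(3)
    by (cases "nul T m"; cases "nul T (Suc m)"; cases "cod T m"; cases "cod T (Suc m)") auto
qed (use u in simp)

lemma lower_weyl_mono: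
  assumes T: "bop sc T" and u: "lower_at T n" "cod T n \<le> nul T n" and "n \<le> m"
  shows "cod T m \<le> nul T m"
  using \<open>n \<le> m\<close>
proof (induction m rule: dec_induct)
  case (step m)
  have "cod T m \<noteq> \<infinity>" "cod T (Suc m) \<noteq> \<infinity>"
    using lower_at_cod lower_at_mono[OF T u(1)] step(1) by auto
  then show ?case using nul_cod_Suc[OF T, of m] step(3)
    by (cases "nul T m"; cases "nul T (Suc m)"; cases "cod T m"; cases "cod T (Suc m)") auto
qed (use u in simp)

lemma index_at_le_0: "nul T n \<noteq> \<infinity> \<Longrightarrow> cod T n \<noteq> \<infinity> \<Longrightarrow> index_at T n \<le> 0 \<longleftrightarrow> nul T n \<le> cod T n"
  and index_at_ge_0: "nul T n \<noteq> \<infinity> \<Longrightarrow> cod T n \<noteq> \<infinity> \<Longrightarrow> index_at T n \<ge> 0 \<longleftrightarrow> cod T n \<le> nul T n"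
  by (cases "nul T n"; cases "cod T n"; simp add: index_at_def)+

text \<open>The inequality is trivial if the codimension for \<open>S\<close> is infinite. Otherwise
  both operators have finite defect numbers at high levels, and their indices can be
  compared.\<close>

lemma upper_weyl_pert:
  assumes p: "pert T S d r" and u: "upper_at T n" "nul T n \<le> cod T n"
  shows "upper_at S (n + d) \<and> nul S (n + d) \<le> cod S (n + d)"
proof -
  note T = pert_bop[OF p]
  have uS: "upper_at S (n + d)" using p u(1) by (rule upper_at_pert)
  have "nul S (n + d) \<le> cod S (n + d)"
  proof (cases "cod S (n + d) = \<infinity>")
    case False
    then have "lower_at S (n + d)" using upper_lower_at uS by blast
    then have lT: "lower_at T (n + d + d)" using pert_sym[OF p] lower_at_pert by blast
    have uT: "upper_at T m" if "m \<ge> n" for m using upper_at_mono[OF T(1) u(1) that] .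
    \<comment> \<open>The level rises by \<open>d\<close> for the passage from \<open>S\<close> back
      to \<open>T\<close>, and once more because \<open>index_at_pert_le\<close> compares
      \<open>n + d\<close> with \<open>n\<close>.\<close>
    have "nul S (n + d + d + d) \<noteq> \<infinity>" "cod S (n + d + d + d) \<noteq> \<infinity>"
      using upper_at_nul[OF upper_at_mono[OF T(2) uS]] enat_finite_le[OF cod_antimono[OF T(2)] False] by simp_all
    moreover have fT: "nul T (n + d + d) \<noteq> \<infinity>" "cod T (n + d + d) \<noteq> \<infinity>"
      using upper_at_nul[OF uT] lower_at_cod[OF lT] by simp_all
    ultimately have "index_at S (n + d + d + d) \<le> index_at T (n + d + d)"
      using index_at_pert_le[OF pert_sym[OF p], of "n + d + d"] by blast
    also have "\<dots> \<le> 0" using index_at_le_0[OF fT] upper_weyl_mono[OF T(1) u, of "n + d + d"] by simp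
    finally have "index_at S (n + d) \<le> 0"
      using index_at_mono[OF T(2) upper_at_nul[OF uS] False, of "n + d + d + d"] by simp
    then show ?thesis using index_at_le_0[OF upper_at_nul[OF uS] False] by simp
  qed simp
  with uS show ?thesis by simp
qed

lemma lower_weyl_pert:
  assumes p: "pert T S d r" and u: "lower_at T n" "cod T n \<le> nul T n"
  shows "lower_at S (n + d) \<and> cod S (n + d) \<le> nul S (n + d)"
proof -
  note T = pert_bop[OF p]
  have uS: "lower_at S (n + d)" using p u(1) by (rule lower_at_pert)
  have "cod S (n + d) \<le> nul S (n + d)"
  proof (cases "nul S (n + d) = \<infinity>")
    case False
    then have "upper_at S (n + d)" using upper_lower_at uS by blast
    then have lT: "upper_at T (n + d + d)" using pert_sym[OF p] upper_at_pert by blast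
    have uT: "lower_at T m" if "m \<ge> n" for m using lower_at_mono[OF T(1) u(1) that] .
    have fT: "nul T (n + d + d) \<noteq> \<infinity>" "cod T (n + d + d) \<noteq> \<infinity>"
      using upper_at_nul[OF lT] lower_at_cod[OF uT] by simp_all
    then have "index_at T (n + d + d) \<le> index_at S (n + d)"
      using index_at_pert_le[OF p fT False lower_at_cod[OF uS]] by blast
    moreover have "0 \<le> index_at T (n + d + d)"
      using index_at_ge_0[OF fT] lower_weyl_mono[OF T(1) u, of "n + d + d"] by simp
    ultimately show ?thesis using index_at_ge_0[OF False lower_at_cod[OF uS]] by simp
  qed simp
  with uS show ?thesis by simp
qed

theorem spec_prop_pert:
  assumes p: "pert T S d r" and "spec_prop sc k T"
  shows "spec_prop sc k S"
proof -
  note T = pert_bop[OF p]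
  have u: "(\<exists>n. upper_at T n) \<longrightarrow> (\<exists>n. upper_at S n)" using upper_at_pert[OF p] by blast
  have l: "(\<exists>n. lower_at T n) \<longrightarrow> (\<exists>n. lower_at S n)" using lower_at_pert[OF p] by blast
  have uw: "(\<exists>n. upper_at T n \<and> nul T n \<le> cod T n) \<longrightarrow> (\<exists>n. upper_at S n \<and> nul S n \<le> cod S n)"
    using upper_weyl_pert[OF p] by blast
  have lw: "(\<exists>n. lower_at T n \<and> cod T n \<le> nul T n) \<longrightarrow> (\<exists>n. lower_at S n \<and> cod S n \<le> nul S n)"
    using lower_weyl_pert[OF p] by blast
  have a: "(\<exists>q. {x. (T ^^ q) x = 0} = {x. (T ^^ Suc q) x = 0}) \<longrightarrow> (\<exists>q. {x. (S ^^ q) x = 0} = {x. (S ^^ Suc q) x = 0})"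
    using asc_pert[OF p] by blast
  have d: "(\<exists>q. range (T ^^ q) = range (T ^^ Suc q)) \<longrightarrow> (\<exists>q. range (S ^^ q) = range (S ^^ Suc q))"
    using dsc_pert[OF p] by blast
  have f: "(\<exists>n. upper_at T n \<and> lower_at T n) \<longrightarrow> (\<exists>n. upper_at S n \<and> lower_at S n)"
    using upper_at_pert[OF p] lower_at_pert[OF p] by blast
  have w: "(\<exists>n. upper_at T n \<and> lower_at T n \<and> nul T n = cod T n) \<longrightarrow> (\<exists>n. upper_at S n \<and> lower_at S n \<and> nul S n = cod S n)"
    using upper_weyl_pert[OF p] lower_weyl_pert[OF p] by (metis antisym order_refl)
  have e: "(\<exists>n. cod T n \<noteq> \<infinity>) \<longrightarrow> (\<exists>n. cod S n \<noteq> \<infinity>)"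
    using edsc_pert[OF p, of _ 1] unfolding cod_def by (metis Suc_eq_plus1)
  note iffs = dsc_iff dsc_e_iff[OF T(1)] dsc_e_iff[OF T(2)] upper_sbf_iff[OF T(1)] upper_sbf_iff[OF T(2)]
    lower_sbf_iff[OF T(1)] lower_sbf_iff[OF T(2)] b_fredholm_iff[OF T(1)] b_fredholm_iff[OF T(2)]
    upper_sbw_iff[OF T(1)] upper_sbw_iff[OF T(2)] lower_sbw_iff[OF T(1)] lower_sbw_iff[OF T(2)]
    b_weyl_iff[OF T(1)] b_weyl_iff[OF T(2)] upper_sbb_iff[OF T(1)] upper_sbb_iff[OF T(2)]
    lower_sbb_iff[OF T(1)] lower_sbb_iff[OF T(2)] b_browder_iff[OF T(1)] b_browder_iff[OF T(2)] pole_def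
  show ?thesis using assms(2)
    by (cases k; simp only: spec_prop.simps iffs;
        use u l uw lw a d f w e in argo)
qed

lemma bop_shift: "bop sc T \<Longrightarrow> bop sc (shift sc T l)"
  unfolding shift_def using bop_sub[OF _ bop_sc[OF bop_id(2)]] by blast

theorem spectrum_power_finite_rank_invariant:
  assumes F: "bop sc F" and T: "bop sc T" and comm: "T \<circ> F = F \<circ> T" and fr: "finite_rank sc (F ^^ n)"
  shows "spectrum_k sc k (opadd T F) = spectrum_k sc k T"
proof -
  have "qdim (range (F ^^ n)) {0} \<noteq> \<infinity>"
    using fr cdim_eq[OF subspace_range_funpow[OF F]] by (simp add: finite_rank_def)
  then obtain r where r: "qdim (range (F ^^ n)) {0} = enat r" by auto
  have c: "T (F x) = F (T x)" for x using comm by (metis comp_apply)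
  have S: "bop sc (opadd T F)" unfolding opadd_def using T F by (rule bop_plus)
  have p: "pert (shift sc T l) (shift sc (opadd T F) l) n r" for l
    unfolding pert_def
  proof (intro conjI allI bop_shift T S)
    show "shift sc T l (shift sc (opadd T F) l x) = shift sc (opadd T F) l (shift sc T l x)" for x
      by (simp add: shift_def opadd_def bop_add[OF T] bop_add[OF F] bop_diff[OF T] bop_diff[OF F]
          bop_scale[OF T] bop_scale[OF F] c scale_right_diff_distrib scale_right_distrib)
    have "(\<lambda>x. shift sc (opadd T F) l x - shift sc T l x) = F" by (simp add: shift_def opadd_def)
    then show "qdim (range ((\<lambda>x. shift sc (opadd T F) l x - shift sc T l x) ^^ n)) {0} \<le> enat r" using r by simp
  qed
  have "spec_prop sc k (shift sc (opadd T F) l) \<longleftrightarrow> spec_prop sc k (shift sc T l)" for l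
    using spec_prop_pert[OF p] spec_prop_pert[OF pert_sym[OF p]] by blast
  then show ?thesis by (simp add: spectrum_k_def)
qed

section \<open>Uniform descent and poles\<close>

text \<open>Topological uniform descent in the sense of Grabiner; the preimage under \<open>T^p\<close> is
  \<open>R(T^n) + N(T^p)\<close>.\<close>
definition uniform_descent :: "('a \<Rightarrow> 'a) \<Rightarrow> bool" where
  "uniform_descent T \<longleftrightarrow> (\<exists>p. (\<forall>n. closed {x. (T ^^ p) x \<in> range (T ^^ (n + p))}) \<and>
     (\<forall>n. {x. T x = 0} \<inter> range (T ^^ p) \<subseteq> range (T ^^ n)))"

lemma closed_preimage: "bop sc T \<Longrightarrow> closed M \<Longrightarrow> closed {x. T x \<in> M}"
  using closed_vimage[of M T] linear_continuous_on[OF bop_bounded_linear] by (simp add: vimage_def)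

text \<open>The decreasing spaces \<open>N(T) \<inter> R(T^k)\<close> are finite-dimensional from
  level \<open>n\<close> on, hence stationary from some level; closedness is inherited from the
  closed ranges by continuity of the power of \<open>T\<close>.\<close>

lemma upper_at_uniform_descent:
  assumes T: "bop sc T" and u: "upper_at T n"
  shows "uniform_descent T"
proof -
  let ?N = "{x. T x = 0}"
  define V where "V k = ?N \<inter> range (T ^^ (n + k))" for k
  have V: "subspace (V k)" for k
    unfolding V_def using subspace_ker[OF T] subspace_range_funpow[OF T] by (rule subspace_inter)
  have dec: "V (Suc k) \<subseteq> V k" for k
    unfolding V_def using range_funpow_antimono[of "n + k" "n + Suc k" T] by auto
  obtain r where r: "nul T n = enat r" using upper_at_nul[OF u] by auto
  have "qdim (V 0) (V k) \<le> enat r" for k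
    using qdim_mono[of "V 0" "V 0" "{0}" "V k"] subspace_0[OF V, of k] r by (simp add: V_def nul_def)
  then obtain k0 where k0: "\<And>k. k \<ge> k0 \<Longrightarrow> V (Suc k) = V k"
    using decreasing_subspaces_stabilise[of V r] V dec by blast
  have st: "V k = V k0" if "k \<ge> k0" for k
    using that by (induction k rule: dec_induct) (auto simp: k0)
  let ?p = "n + k0"
  have "?N \<inter> range (T ^^ ?p) \<subseteq> range (T ^^ m)" for m
  proof (cases "m \<ge> ?p")
    case True
    then have "V (m - n) = V k0" by (intro st) simp
    with True show ?thesis by (auto simp: V_def)
  next
    case False
    then show ?thesis using range_funpow_antimono[of m ?p T] by auto
  qed
  moreover have "closed {x. (T ^^ ?p) x \<in> range (T ^^ (m + ?p))}" for m
    using upper_at_mono[OF T u, of "m + ?p"] by (intro closed_preimage bop_funpow T) (simp add: upper_at_def)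
  ultimately show ?thesis unfolding uniform_descent_def by blast
qed

lemma closed_sum_finite_codim:
  assumes T: "bop sc T" and Z: "subspace Z" "closed Z"
    and q: "qdim UNIV {T x + z | x z. z \<in> Z} \<noteq> \<infinity>"
  shows "closed {T x + z | x z. z \<in> Z}"
proof -
  let ?E = "{T x + z | x z. z \<in> Z}" and ?f = "\<lambda>p. T (fst p) + snd p"
  have E: "?f ` (UNIV \<times> Z) = ?E" by force
  have sE: "subspace ?E"
    using subspace_sums[OF subspace_range[OF T] Z(1)] by (rule back_subst[of subspace]) auto
  obtain H where H: "finite H" "span H \<inter> ?E = {0}" "UNIV = span (?E \<union> H)"
    by (rule qdim_attained_subset[OF subspace_UNIV sE subset_UNIV q])
  have sum: "{?f x + z | x z. x \<in> UNIV \<times> Z \<and> z \<in> span H} = UNIV"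
  proof -
    have "UNIV = {a + z | a z. a \<in> ?E \<and> z \<in> span H}"
      using H(3) unfolding span_Un span_of_subspace[OF sE] .
    then have x: "x \<in> {a + z | a z. a \<in> ?E \<and> z \<in> span H}" for x by blast
    have "x \<in> {?f x + z | x z. x \<in> UNIV \<times> Z \<and> z \<in> span H}" for x
    proof -
      from x[of x] obtain t w z where "x = T t + w + z" "w \<in> Z" "z \<in> span H" by blast
      then show ?thesis by (intro CollectI exI[of _ "(t, w)"] exI[of _ z]) simp
    qed
    then show ?thesis by blast
  qed
  have "bounded_linear ?f"
    by (intro bounded_linear_add bounded_linear_compose[OF bop_bounded_linear[OF T]]
        bounded_linear_fst bounded_linear_snd)
  then have "closed (?f ` (UNIV \<times> Z))"
    using sum H(2) Z
    by (intro closed_image_complemented[of ?f "UNIV \<times> Z" "span H" UNIV])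
      (auto simp: E closed_span_finite[OF H(1)] real_subspace closed_Times intro!: subspace_Pair_Times)
  then show ?thesis unfolding E .
qed

lemma descent_preimage:
  assumes T: "bop sc T"
  shows "{x. (T ^^ p) x \<in> range (T ^^ (n + p))} = {(T ^^ n) x + z | x z. z \<in> {z. (T ^^ p) z = 0}}"
proof -
  have Tp: "bop sc (T ^^ p)" using T by (rule bop_funpow)
  have e: "(T ^^ (n + p)) x = (T ^^ p) ((T ^^ n) x)" for x
    by (metis add.commute comp_apply funpow_add)
  show ?thesis
  proof
    show "{x. (T ^^ p) x \<in> range (T ^^ (n + p))} \<subseteq> {(T ^^ n) x + z | x z. z \<in> {z. (T ^^ p) z = 0}}"
    proof
      fix x assume "x \<in> {x. (T ^^ p) x \<in> range (T ^^ (n + p))}"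
      then obtain y where "(T ^^ p) x = (T ^^ p) ((T ^^ n) y)" by (auto simp: e)
      then show "x \<in> {(T ^^ n) x + z | x z. z \<in> {z. (T ^^ p) z = 0}}"
        by (intro CollectI exI[of _ y] exI[of _ "x - (T ^^ n) y"]) (simp add: bop_diff[OF Tp])
    qed
  qed (auto simp: bop_add[OF Tp] e)
qed

text \<open>The nonincreasing sequence \<open>cod T\<close> attains a minimal value at some
  \<open>p\<close>. Constancy beyond \<open>p\<close> makes the kernel parts stationary by
  rank-nullity, and \<open>R(T^m) + N(T^p)\<close> has finite codimension in the whole space, hence
  is closed although the ranges themselves may not be.\<close>

lemma cod_uniform_descent:
  assumes T: "bop sc T" and c: "cod T n \<noteq> \<infinity>"
  shows "uniform_descent T"
proof -
  let ?N = "{x. T x = 0}" and ?R = "\<lambda>n. range (T ^^ n)"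
  let ?P = "\<lambda>c. \<exists>m\<ge>n. cod T m = c"
  have "?P (LEAST c. ?P c)" by (rule LeastI[of ?P "cod T n"]) auto
  then obtain p where p: "p \<ge> n" "cod T p = (LEAST c. ?P c)" by auto
  have cp: "cod T m = cod T p" if "m \<ge> p" for m
  proof (rule antisym)
    show "cod T m \<le> cod T p" using T that by (rule cod_antimono)
    show "cod T p \<le> cod T m" unfolding p(2) using that p(1) by (intro Least_le exI[of _ m]) auto
  qed
  have fin: "cod T p \<noteq> \<infinity>" using enat_finite_le[OF cod_antimono[OF T p(1)] c] .
  have R: "subspace (?R n)" for n using T by (rule subspace_range_funpow)
  have step: "?N \<inter> ?R m \<subseteq> ?R (Suc m)" if "m \<ge> p" for m
  proof -
    have sub: "?R (Suc m) \<subseteq> ?R m" by (rule range_funpow_antimono) simp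
    have "cod T m = cod T (Suc m) + qdim (?R m \<inter> ?N) (?R (Suc m) \<inter> ?N)"
      using qdim_rank_nullity[OF bop_linear[OF T] R R sub]
      unfolding cod_def range_funpow_Suc[symmetric] .
    then have "cod T p = cod T p + qdim (?R m \<inter> ?N) (?R (Suc m) \<inter> ?N)"
      by (simp only: cp[OF that] cp[OF le_SucI[OF that]])
    then have "qdim (?R m \<inter> ?N) (?R (Suc m) \<inter> ?N) = 0"
      using fin enat_eq_add_self by blast
    then show ?thesis
      using qdim_eq_0_iff[OF subspace_inter[OF R subspace_ker[OF T]], of "?R m \<inter> ?N" "Suc m"]
      by (metis Int_commute le_infE)
  qed
  have "?N \<inter> ?R p \<subseteq> ?R m" for m
  proof (cases "m \<ge> p")
    case True
    then show ?thesis
    proof (induction m rule: dec_induct)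
      case (step m)
      then show ?case using \<open>\<And>m. p \<le> m \<Longrightarrow> ?N \<inter> ?R m \<subseteq> ?R (Suc m)\<close>[OF step(1)] by blast
    qed simp
  next
    case False
    then show ?thesis using range_funpow_antimono[of m p T] by auto
  qed
  moreover have "closed {x. (T ^^ p) x \<in> ?R (m + p)}" for m
  proof -
    have Tp: "bop sc (T ^^ p)" and Tm: "bop sc (T ^^ m)" using T by (auto intro: bop_funpow)
    let ?E = "{x. (T ^^ p) x \<in> ?R (m + p)}"
    have E: "subspace ?E" using Tp R by (rule subspace_preimage)
    have sub: "?R (m + p) \<subseteq> ?R p" by (rule range_funpow_antimono) simp
    have im: "(T ^^ p) ` ?E = ?R (m + p)"
    proof
      show "?R (m + p) \<subseteq> (T ^^ p) ` ?E"
      proof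
        fix y assume y: "y \<in> ?R (m + p)"
        with sub obtain x where "y = (T ^^ p) x" by blast
        then have "y = (T ^^ p) x" "x \<in> ?E" using y by auto
        then show "y \<in> (T ^^ p) ` ?E" by (rule image_eqI)
      qed
    qed auto
    have k: "?E \<inter> {x. (T ^^ p) x = 0} = {x. (T ^^ p) x = 0}" using subspace_0[OF R] by auto
    have "qdim UNIV ?E = qdim (?R p) (?R (m + p))"
      using qdim_rank_nullity[OF bop_linear[OF Tp] subspace_UNIV E] unfolding im k by (simp add: qdim_eq_0)
    then have "qdim UNIV ?E \<noteq> \<infinity>"
      using finite_codim_iterate[OF T fin[unfolded cod_def], of m] by (simp add: add.commute)
    then show ?thesis
      unfolding descent_preimage[OF T]
      by (rule closed_sum_finite_codim[OF Tm subspace_ker[OF Tp] closed_ker[OF Tp]])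
  qed
  ultimately show ?thesis unfolding uniform_descent_def by blast
qed

section \<open>Boundary points of the resolvent set are poles\<close>

lemma bop_sum: "bop sc T \<Longrightarrow> T (sum f A) = (\<Sum>i\<in>A. T (f i))"
  by (simp add: bop_def bounded_linear.linear linear_sum)

text \<open>The vector \<open>y = x\<^sub>0 + \<mu> x\<^sub>1 + \<mu>\<^sup>2 x\<^sub>2 + \<dots>\<close> solves \<open>(T - \<mu>) y = T x\<^sub>0\<close> modulo \<open>Z\<close>
  if \<open>T\<close> shifts the sequence modulo \<open>Z\<close>.\<close>
lemma chain_sum:
  assumes T: "bop sc T" and Z: "subspace Z" "closed Z" and M: "subspace M" "closed M"
    and x: "\<And>i. x i \<in> M" "\<And>i. T (x (Suc i)) - x i \<in> Z" "\<And>i. norm (x i) \<le> K ^ i * B"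
    and K: "K \<ge> 0" "cmod \<mu> * K \<le> 1 / 2"
  shows "\<exists>y\<in>M. norm (y - x 0) \<le> 2 * cmod \<mu> * K * B \<and> T y - sc \<mu> y - T (x 0) \<in> Z"
proof -
  define s where "s i = sc (\<mu> ^ i) (x i)" for i
  have B: "B \<ge> 0" using x(3)[of 0] by (metis mult_1 norm_ge_zero order_trans power_0)
  have "norm (s (Suc i)) \<le> cmod \<mu> * K * B * (1 / 2) ^ i" for i
  proof -
    have "norm (s (Suc i)) \<le> cmod \<mu> ^ Suc i * (K ^ Suc i * B)"
      unfolding s_def norm_sc norm_power using x(3)[of "Suc i"] by (intro mult_left_mono) auto
    also have "\<dots> = cmod \<mu> * K * B * (cmod \<mu> * K) ^ i" by (simp add: power_mult_distrib)
    also have "\<dots> \<le> cmod \<mu> * K * B * (1 / 2) ^ i"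
      using K B by (intro mult_left_mono power_mono) auto
    finally show ?thesis .
  qed
  note sb = this
  have geo: "(\<lambda>i. cmod \<mu> * K * B * (1 / 2) ^ i) sums (cmod \<mu> * K * B * 2)"
    using sums_mult[OF geometric_sums[of "1/2::real"], of "cmod \<mu> * K * B"] by simp
  have sn: "summable (\<lambda>i. norm (s (Suc i)))"
    using sb by (intro summable_comparison_test[OF _ sums_summable[OF geo]]) auto
  then have sS: "summable (\<lambda>i. s (Suc i))" by (rule summable_norm_cancel)
  then have ss: "summable s" by (simp add: summable_Suc_iff)
  define y where "y = suminf s"
  have "y - x 0 = (\<Sum>i. s (Suc i))" using suminf_split_head[OF ss] by (simp add: y_def s_def)
  then have "norm (y - x 0) \<le> (\<Sum>i. norm (s (Suc i)))" using summable_norm[OF sn] by simp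
  also have "\<dots> \<le> (\<Sum>i. cmod \<mu> * K * B * (1 / 2) ^ i)"
    using sb sn geo by (intro suminf_le) (auto simp: sums_summable)
  also have "\<dots> = 2 * cmod \<mu> * K * B" using geo by (simp add: sums_unique[symmetric])
  finally have 1: "norm (y - x 0) \<le> 2 * cmod \<mu> * K * B" .
  have lim: "(\<lambda>n. \<Sum>i<n. s i) \<longlonglongrightarrow> y" using ss unfolding y_def by (rule summable_LIMSEQ)
  have "(\<Sum>i<n. s i) \<in> M" for n using M x(1) by (auto simp: s_def intro!: subspace_sum subspace_scale)
  then have 2: "y \<in> M" using closed_sequentially[OF M(2) _ lim] by blast
  have inZ: "T (\<Sum>i<Suc n. s i) - sc \<mu> (\<Sum>i<n. s i) - T (x 0) \<in> Z" for n
  proof (induction n)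
    case 0
    then show ?case using subspace_0[OF Z(1)] by (simp add: s_def)
  next
    case (Suc n)
    have "T (\<Sum>i<Suc (Suc n). s i) - sc \<mu> (\<Sum>i<Suc n. s i) - T (x 0)
      = (T (\<Sum>i<Suc n. s i) - sc \<mu> (\<Sum>i<n. s i) - T (x 0)) + (T (s (Suc n)) - sc \<mu> (s n))"
      by (simp add: bop_add[OF T] scale_right_distrib)
    also have "T (s (Suc n)) - sc \<mu> (s n) = sc (\<mu> ^ Suc n) (T (x (Suc n)) - x n)"
      by (simp add: s_def bop_scale[OF T] scale_right_diff_distrib)
    finally show ?case by (simp only: subspace_add[OF Z(1) Suc subspace_scale[OF Z(1) x(2)]])
  qed
  have "(\<lambda>n. T (\<Sum>i<Suc n. s i) - sc \<mu> (\<Sum>i<n. s i) - T (x 0)) \<longlonglongrightarrow> T y - sc \<mu> y - T (x 0)"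
    using lim LIMSEQ_Suc[OF lim] by (intro tendsto_diff bop_tendsto[OF T] tendsto_sc tendsto_const)
  then have "T y - sc \<mu> y - T (x 0) \<in> Z" by (rule closed_sequentially[OF Z(2) inZ])
  with 1 2 show ?thesis by blast
qed

lemma bounded_chain_exists:
  assumes x0: "x0 \<in> M" and K: "\<And>x. x \<in> M \<Longrightarrow> \<exists>y\<in>M. Q x y \<and> norm y \<le> K * norm (x::'a)" and "K \<ge> 0"
  obtains x where "x 0 = x0" "\<And>i::nat. x i \<in> M" "\<And>i. Q (x i) (x (Suc i))" "\<And>i. norm (x i) \<le> K ^ i * norm x0"
proof -
  obtain g where g: "\<And>x. x \<in> M \<Longrightarrow> g x \<in> M \<and> Q x (g x) \<and> norm (g x) \<le> K * norm x" using K by metis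
  define x where "x i = (g ^^ i) x0" for i
  have xM: "x i \<in> M" for i by (induction i) (auto simp: x_def x0 g)
  show ?thesis
  proof
    show "norm (x i) \<le> K ^ i * norm x0" for i
    proof (induction i)
      case (Suc i)
      have "norm (x (Suc i)) \<le> K * norm (x i)" using g[OF xM[of i]] by (simp add: x_def)
      also have "\<dots> \<le> K * (K ^ i * norm x0)" using Suc \<open>K \<ge> 0\<close> by (intro mult_left_mono)
      finally show ?case by (simp add: mult.assoc)
    qed (simp add: x_def)
  qed (use xM g x_def in auto)
qed

lemma bij_shift_imp:
  assumes T: "bop sc T" and b: "bij (shift sc T \<mu>)"
  shows "T x = sc \<mu> x \<Longrightarrow> x = 0" and "\<exists>x. T x - sc \<mu> x = y"
proof -
  show "x = 0" if "T x = sc \<mu> x"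
  proof -
    have "shift sc T \<mu> x = shift sc T \<mu> 0" using that bop_0[OF T] by (simp add: shift_def)
    then show ?thesis using b bij_is_inj injD by metis
  qed
  show "\<exists>x. T x - sc \<mu> x = y" using bij_is_surj[OF b] unfolding shift_def surj_def by metis
qed

lemma bij_shiftI:
  assumes T: "bop sc T" and i: "\<And>x. T x = sc \<mu> x \<Longrightarrow> x = 0" and s: "\<And>y. \<exists>x. T x - sc \<mu> x = y"
  shows "bij (shift sc T \<mu>)"
proof (rule bijI)
  show "inj (shift sc T \<mu>)"
  proof (rule injI)
    fix x y assume "shift sc T \<mu> x = shift sc T \<mu> y"
    then have "T (x - y) = sc \<mu> (x - y)"
      by (simp add: shift_def bop_diff[OF T] scale_right_diff_distrib algebra_simps)
    from i[OF this] show "x = y" by simp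
  qed
  show "surj (shift sc T \<mu>)" using s unfolding shift_def surj_def by metis
qed

text \<open>If \<open>T\<close> is a limit of invertible operators \<open>T - \<mu>\<close>, a nonzero element of the kernel of \<open>T\<close> on
  the range of \<open>T^p\<close> would extend to a kernel vector of \<open>T - \<mu>\<close>.\<close>
lemma uniform_descent_boundary_kernel:
  assumes T: "bop sc T"
    and cl: "\<And>n. closed {x. (T ^^ p) x \<in> range (T ^^ (n + p))}"
    and ker: "\<And>n. {x. T x = 0} \<inter> range (T ^^ p) \<subseteq> range (T ^^ n)"
    and inv: "\<And>e. e > 0 \<Longrightarrow> \<exists>\<mu>. cmod \<mu> < e \<and> bij (shift sc T \<mu>)"
  shows "{x. T x = 0} \<inter> range (T ^^ p) \<subseteq> {0}"
proof
  fix d assume d: "d \<in> {x. T x = 0} \<inter> range (T ^^ p)"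
  then obtain x0 where x0: "d = (T ^^ p) x0" by auto
  have Tp: "bop sc (T ^^ p)" using T by (rule bop_funpow)
  let ?Z = "{x. (T ^^ p) x = 0}"
  \<comment> \<open>The preimage under \<open>T^p\<close> of the intersection of all ranges. It
    contains \<open>?Z\<close>, and modulo \<open>?Z\<close> the operator \<open>T\<close> maps it
    onto itself.\<close>
  define E where "E = (\<Inter>n. {x. (T ^^ p) x \<in> range (T ^^ (n + p))})"
  have Z: "subspace ?Z" "closed ?Z" using subspace_ker[OF Tp] closed_ker[OF Tp] by auto
  have sE: "subspace E" unfolding E_def
    by (intro subspace_Int subspace_preimage[OF Tp] subspace_range_funpow[OF T])
  have cE: "closed E" unfolding E_def using cl by auto
  have inE: "x \<in> E \<longleftrightarrow> (\<forall>n. (T ^^ p) x \<in> range (T ^^ n))" for x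
  proof
    assume x: "x \<in> E"
    show "\<forall>n. (T ^^ p) x \<in> range (T ^^ n)"
    proof
      fix n show "(T ^^ p) x \<in> range (T ^^ n)"
        using x range_funpow_antimono[of n "n + p" T] unfolding E_def by fastforce
    qed
  qed (auto simp: E_def)
  have comm: "(T ^^ n) (T x) = T ((T ^^ n) x)" for n x by (simp add: funpow_swap1)
  have TE: "T x \<in> E" if "x \<in> E" for x
    unfolding inE comm
  proof
    fix n
    show "T ((T ^^ p) x) \<in> range (T ^^ n)"
    proof (cases n)
      case (Suc m)
      from that obtain w where "(T ^^ p) x = (T ^^ m) w" unfolding inE by blast
      with Suc show ?thesis by auto
    qed simp
  qed
  have ZE: "?Z \<subseteq> E" using inE subspace_0[OF subspace_range_funpow[OF T]] by auto
  have lift: "\<exists>y\<in>E. x - T y \<in> ?Z" if x: "x \<in> E" for x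
  proof -
    have "\<exists>w. (T ^^ p) x = T ((T ^^ p) ((T ^^ n) w))" for n
    proof -
      from x obtain w where "(T ^^ p) x = (T ^^ Suc (p + n)) w" unfolding inE by blast
      then show ?thesis by (intro exI[of _ w]) (simp add: funpow_add)
    qed
    then obtain w where w: "\<And>n. (T ^^ p) x = T ((T ^^ p) ((T ^^ n) (w n)))" by metis
    \<comment> \<open>The lift must work for all \<open>n\<close> at once: after \<open>T^p\<close>
      two candidates differ by a kernel vector in \<open>R(T^p)\<close>, which by \<open>ker\<close>
      lies in every range.\<close>
    have "w 0 \<in> E"
      unfolding inE
    proof
      fix n
      have "(T ^^ p) (w 0) - (T ^^ p) ((T ^^ n) (w n)) \<in> {x. T x = 0}"
        using w[of 0] w[of n] by (simp add: bop_diff[OF T])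
      moreover have "(T ^^ p) (w 0) - (T ^^ p) ((T ^^ n) (w n)) \<in> range (T ^^ p)"
        unfolding bop_diff[OF Tp, symmetric] by simp
      ultimately have "(T ^^ p) (w 0) - (T ^^ p) ((T ^^ n) (w n)) \<in> range (T ^^ n)" using ker by blast
      moreover have "(T ^^ p) ((T ^^ n) (w n)) = (T ^^ n) ((T ^^ p) (w n))"
        by (metis add.commute comp_apply funpow_add)
      then have "(T ^^ p) ((T ^^ n) (w n)) \<in> range (T ^^ n)" by simp
      ultimately have "((T ^^ p) (w 0) - (T ^^ p) ((T ^^ n) (w n))) + (T ^^ p) ((T ^^ n) (w n)) \<in> range (T ^^ n)"
        by (rule subspace_add[OF subspace_range_funpow[OF T]])
      then show "(T ^^ p) (w 0) \<in> range (T ^^ n)" by simp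
    qed
    moreover have "x - T (w 0) \<in> ?Z" using w[of 0] by (simp add: bop_diff[OF Tp] comm)
    ultimately show ?thesis by blast
  qed
  have sum: "{T x + z | x z. x \<in> E \<and> z \<in> ?Z} = E"
  proof
    show "{T x + z | x z. x \<in> E \<and> z \<in> ?Z} \<subseteq> E" using TE ZE subspace_add[OF sE] by blast
    show "E \<subseteq> {T x + z | x z. x \<in> E \<and> z \<in> ?Z}"
    proof
      fix x assume "x \<in> E"
      from lift[OF this] obtain y where y: "y \<in> E" "x - T y \<in> ?Z" by blast
      then show "x \<in> {T x + z | x z. x \<in> E \<and> z \<in> ?Z}"
        by (intro CollectI exI[of _ y] exI[of _ "x - T y"] conjI) simp_all
    qed
  qed
  obtain K where K: "K > 0" "\<And>y. y \<in> E \<Longrightarrow> \<exists>x\<in>E. \<exists>z\<in>?Z. T x + z = y \<and> norm x \<le> K * norm y \<and> norm z \<le> K * norm y"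
    using open_mapping_bound_sum[OF bop_bounded_linear[OF T] real_subspace[OF sE] cE real_subspace[OF Z(1)] Z(2) cE sum]
    by blast
  have x0E: "x0 \<in> E" unfolding inE x0[symmetric] using d ker by blast
  have step: "\<exists>y\<in>E. T y - x \<in> ?Z \<and> norm y \<le> K * norm x" if "x \<in> E" for x
  proof -
    from K(2)[OF that] obtain y z where y: "y \<in> E" "z \<in> ?Z" "T y + z = x" "norm y \<le> K * norm x" by blast
    have "T y - x = - z" using y(3) by (simp add: algebra_simps)
    then have "T y - x \<in> ?Z" using subspace_neg[OF Z(1) y(2)] by simp
    with y show ?thesis by blast
  qed
  obtain x where x: "x 0 = x0" "\<And>i::nat. x i \<in> E" "\<And>i. T (x (Suc i)) - x i \<in> ?Z" "\<And>i. norm (x i) \<le> K ^ i * norm x0"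
    using bounded_chain_exists[OF x0E step] K(1) by (metis less_imp_le)
  have x0Z: "T x0 \<in> ?Z" using d x0 by (simp add: comm)
  have near: "\<exists>y\<in>?Z. dist y x0 < e" if e: "e > 0" for e
  proof -
    \<comment> \<open>The first bound makes the chain series converge with ratio 1/2, the second
      keeps its sum within \<open>e\<close> of \<open>x0\<close>; the added 1 avoids a zero
      denominator.\<close>
    define e' where "e' = min (1 / (2 * K)) (e / (2 * K * norm x0 + 1))"
    have pos: "2 * K * norm x0 + 1 > 0" using K(1) by (simp add: add_nonneg_pos)
    have "e' > 0" unfolding e'_def using K(1) e pos by simp
    then obtain \<mu> where \<mu>: "cmod \<mu> < e'" "bij (shift sc T \<mu>)" using inv by blast
    have "cmod \<mu> < 1 / (2 * K)" using \<mu>(1) by (simp add: e'_def)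
    then have mK: "cmod \<mu> * K \<le> 1 / 2" using K(1) by (simp add: field_simps)
    obtain y where y: "norm (y - x0) \<le> 2 * cmod \<mu> * K * norm x0" "T y - sc \<mu> y - T x0 \<in> ?Z"
      using chain_sum[OF T Z sE cE x(2,3,4) less_imp_le[OF K(1)] mK] x(1) by auto
    \<comment> \<open>Thus \<open>T^p\<close> maps \<open>y\<close> to a solution of
      \<open>T v = \<mu> v\<close>, which is 0 by injectivity of \<open>T - \<mu>\<close>: points of
      \<open>?Z\<close> approach \<open>x0\<close>.\<close>
    have "(T y - sc \<mu> y - T x0) + T x0 \<in> ?Z" using y(2) x0Z Z(1) by (intro subspace_add) auto
    then have "T ((T ^^ p) y) = sc \<mu> ((T ^^ p) y)" by (simp add: bop_diff[OF Tp] bop_scale[OF Tp] comm)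
    then have "(T ^^ p) y = 0" using bij_shift_imp(1)[OF T \<mu>(2)] by blast
    moreover have "dist y x0 < e"
    proof -
      have "dist y x0 \<le> cmod \<mu> * (2 * K * norm x0)" using y(1) by (simp add: dist_norm algebra_simps)
      also have "\<dots> \<le> cmod \<mu> * (2 * K * norm x0 + 1)" by (simp add: algebra_simps)
      also have "\<dots> < e"
      proof -
        have "cmod \<mu> < e / (2 * K * norm x0 + 1)" using \<mu>(1) by (simp add: e'_def)
        then show ?thesis using pos by (simp add: field_simps)
      qed
      finally show ?thesis .
    qed
    ultimately show ?thesis by blast
  qed
  then have "x0 \<in> closure ?Z" unfolding closure_approachable by blast
  then have "x0 \<in> ?Z" using Z(2) by simp
  with x0 show "d \<in> {0}" by simp
qed

text \<open>Modulo \<open>N(T^p)\<close> the operator is injective with closed range, hence bounded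
  below. Solutions of \<open>(T - \<mu>) x = y\<close> therefore stay at bounded distance from this
  kernel as \<mu> tends to 0, so that modulo the kernel the term \<open>\<mu> x\<close> becomes
  negligible and \<open>y\<close> is a limit of points of \<open>R(T) + N(T^p)\<close>.\<close>

lemma uniform_descent_boundary_range:
  assumes T: "bop sc T"
    and cl: "closed {x. (T ^^ p) x \<in> range (T ^^ (1 + p))}"
    and ker: "{x. T x = 0} \<inter> range (T ^^ p) \<subseteq> {0}"
    and inv: "\<And>e. e > 0 \<Longrightarrow> \<exists>\<mu>. cmod \<mu> < e \<and> bij (shift sc T \<mu>)"
  shows "range (T ^^ p) = range (T ^^ Suc p)"
proof -
  have Tp: "bop sc (T ^^ p)" using T by (rule bop_funpow)
  let ?Z = "{x. (T ^^ p) x = 0}" and ?E = "{x. (T ^^ p) x \<in> range (T ^^ (1 + p))}"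
  have Z: "subspace ?Z" "closed ?Z" using subspace_ker[OF Tp] closed_ker[OF Tp] by auto
  have comm: "(T ^^ n) (T x) = T ((T ^^ n) x)" for n x by (simp add: funpow_swap1)
  have TZ: "T z \<in> ?Z \<longleftrightarrow> z \<in> ?Z" for z using ker bop_0[OF T] by (auto simp: comm)
  have eqE: "{T x + z | x z. x \<in> UNIV \<and> z \<in> ?Z} = ?E"
    using descent_preimage[OF T, of p 1] by auto
  obtain K where K: "K > 0" "\<And>y. y \<in> ?E \<Longrightarrow> \<exists>x\<in>UNIV. \<exists>z\<in>?Z. T x + z = y \<and> norm x \<le> K * norm y \<and> norm z \<le> K * norm y"
    using open_mapping_bound_sum[OF bop_bounded_linear[OF T] real_subspace[OF subspace_UNIV] closed_UNIV
        real_subspace[OF Z(1)] Z(2) cl eqE] by blast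
  have "y \<in> ?E" for y
  proof -
    have "\<exists>w\<in>?E. dist w y < e" if e: "e > 0" for e
    proof -
      \<comment> \<open>\<open>C\<close> comes from solving
        \<open>\<delta> \<le> K * norm y + (\<delta> + 1) / 2\<close> for
        \<open>\<delta> + 1\<close>; the extra 1 is the slack in choosing \<open>z0\<close>.\<close>
      define C where "C = 2 * K * norm y + 2"
      have C: "C > 0" unfolding C_def using K(1) by (simp add: add_nonneg_pos)
      define e' where "e' = min (1 / (2 * K)) (e / C)"
      have "e' > 0" unfolding e'_def using K(1) e C by simp
      then obtain \<mu> where \<mu>: "cmod \<mu> < e'" "bij (shift sc T \<mu>)" using inv by blast
      have "cmod \<mu> < 1 / (2 * K)" "cmod \<mu> < e / C" using \<mu>(1) by (simp_all add: e'_def)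
      then have mK: "K * cmod \<mu> \<le> 1 / 2" and mC: "cmod \<mu> * C < e" using K(1) C by (simp_all add: field_simps)
      obtain x where x: "T x - sc \<mu> x = y" using bij_shift_imp(2)[OF T \<mu>(2)] by blast
      define \<delta> where "\<delta> = infdist x ?Z"
      have "?Z \<noteq> {}" using subspace_0[OF Z(1)] by blast
      then obtain z0 where "z0 \<in> ?Z" "dist x z0 < \<delta> + 1"
        unfolding \<delta>_def by (rule infdist_approx[where e = 1]) simp_all
      then have z0: "z0 \<in> ?Z" "norm (x - z0) \<le> \<delta> + 1" by (simp_all add: dist_norm)
      let ?x = "x - z0" and ?z = "T z0 - sc \<mu> z0"
      have zZ: "?z \<in> ?Z" using z0(1) TZ Z(1) by (intro subspace_diff subspace_scale) auto
      have w: "y + sc \<mu> ?x = T ?x + ?z"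
        using x by (simp add: bop_diff[OF T] scale_right_diff_distrib algebra_simps)
      have wE: "y + sc \<mu> ?x \<in> ?E" unfolding eqE[symmetric] w using zZ by blast
      from K(2)[OF this] obtain x'' z'' where x'': "z'' \<in> ?Z" "T x'' + z'' = y + sc \<mu> ?x"
        "norm x'' \<le> K * norm (y + sc \<mu> ?x)" by blast
      have "T (?x - x'') = z'' - ?z"
      proof -
        have "T x'' + z'' = T ?x + ?z" using x''(2) w by simp
        then show ?thesis unfolding bop_diff[OF T, of ?x] by (simp add: algebra_simps)
      qed
      also have "\<dots> \<in> ?Z" using Z(1) x''(1) zZ by (rule subspace_diff)
      finally have "?x - x'' \<in> ?Z" using TZ by blast
      then have "z0 + (?x - x'') \<in> ?Z" using z0(1) Z(1) by (intro subspace_add) auto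
      then have "\<delta> \<le> dist x (z0 + (?x - x''))" unfolding \<delta>_def by (rule infdist_le)
      also have "\<dots> = norm x''" by (simp add: dist_norm)
      also have "\<dots> \<le> K * (norm y + cmod \<mu> * (\<delta> + 1))"
      proof -
        have "norm (y + sc \<mu> ?x) \<le> norm y + cmod \<mu> * norm ?x" using norm_triangle_ineq[of y "sc \<mu> ?x"] by simp
        also have "\<dots> \<le> norm y + cmod \<mu> * (\<delta> + 1)" using z0(2) by (intro add_left_mono mult_left_mono) auto
        finally show ?thesis using x''(3) K(1) by (meson less_imp_le mult_left_mono order_trans)
      qed
      also have "\<dots> = K * norm y + (K * cmod \<mu>) * (\<delta> + 1)" by (simp add: algebra_simps)
      also have "\<dots> \<le> K * norm y + 1 / 2 * (\<delta> + 1)"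
        using mK infdist_nonneg[of x ?Z] by (intro add_left_mono mult_right_mono) (auto simp: \<delta>_def)
      finally have "\<delta> + 1 \<le> C" unfolding C_def by (simp add: field_simps)
      then have "norm ?x \<le> C" using z0(2) by simp
      then have "cmod \<mu> * norm ?x \<le> cmod \<mu> * C" by (intro mult_left_mono) auto
      then have "dist (y + sc \<mu> ?x) y < e" using mC by (simp add: dist_norm)
      with wE show ?thesis by blast
    qed
    then have "y \<in> closure ?E" unfolding closure_approachable by blast
    then show ?thesis using cl by simp
  qed
  then have "range (T ^^ p) \<subseteq> range (T ^^ Suc p)" by auto
  moreover have "range (T ^^ Suc p) \<subseteq> range (T ^^ p)" by (rule range_funpow_antimono) simp
  ultimately show ?thesis by blast
qed

theorem uniform_descent_boundary_pole:
  assumes T: "bop sc T" and W: "uniform_descent T"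
    and inv: "\<And>e. e > 0 \<Longrightarrow> \<exists>\<mu>. cmod \<mu> < e \<and> bij (shift sc T \<mu>)"
  shows "pole T"
proof -
  obtain p where p: "\<And>n. closed {x. (T ^^ p) x \<in> range (T ^^ (n + p))}"
    "\<And>n. {x. T x = 0} \<inter> range (T ^^ p) \<subseteq> range (T ^^ n)"
    using W unfolding uniform_descent_def by blast
  have k: "{x. T x = 0} \<inter> range (T ^^ p) \<subseteq> {0}"
    using uniform_descent_boundary_kernel[OF T p inv] .
  have "range (T ^^ p) = range (T ^^ Suc p)"
    using uniform_descent_boundary_range[OF T p(1)[of 1] k inv] .
  moreover have "{x. (T ^^ p) x = 0} = {x. (T ^^ Suc p) x = 0}" using k bop_0[OF T] by auto
  ultimately show ?thesis unfolding pole_def by blast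
qed

section \<open>The resolvent set and isolated poles\<close>

lemma shift_shift: "shift sc (shift sc T a) b = shift sc T (a + b)"
  by (auto simp: shift_def scale_left_distrib algebra_simps)

lemma shift_0 [simp]: "shift sc T 0 = T"
  by (auto simp: shift_def)

text \<open>Neumann series in contraction form: \<open>x\<close> solves \<open>T x - l x = y\<close>
  exactly if it is a fixed point of \<open>(T x - y) / l\<close>, whose Lipschitz constant is at
  most 1/2 once \<open>cmod l > 2 * K\<close>.\<close>

lemma bij_shift_large:
  assumes T: "bop sc T"
  obtains R where "R > 0" "\<And>l. cmod l > R \<Longrightarrow> bij (shift sc T l)"
proof -
  obtain K where K: "K > 0" "\<And>x. norm (T x) \<le> norm x * K"
    using bounded_linear.pos_bounded[OF bop_bounded_linear[OF T]] by blast
  have "bij (shift sc T l)" if l: "cmod l > 2 * K" for l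
  proof -
    have l0: "l \<noteq> 0" using l K(1) by auto
    have "cmod l > 0" using l0 by simp
    then have Kl: "K / cmod l \<le> 1 / 2" using l by (simp add: field_simps)
    have ex: "\<exists>!x. sc (1 / l) (T x - y) = x" for y
    proof (rule banach_fix_type[of "1 / 2"])
      show "\<forall>u v. dist (sc (1 / l) (T u - y)) (sc (1 / l) (T v - y)) \<le> 1 / 2 * dist u v"
      proof (intro allI)
        fix u v
        have "sc (1 / l) (T u - y) - sc (1 / l) (T v - y) = sc (1 / l) (T (u - v))"
          by (simp add: bop_diff[OF T] scale_right_diff_distrib[symmetric])
        then have "dist (sc (1 / l) (T u - y)) (sc (1 / l) (T v - y)) = norm (T (u - v)) / cmod l"
          by (simp add: dist_norm norm_divide)
        also have "\<dots> \<le> norm (u - v) * K / cmod l" using K by (intro divide_right_mono) auto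
        also have "\<dots> = (K / cmod l) * norm (u - v)" by simp
        also have "\<dots> \<le> 1 / 2 * norm (u - v)" using Kl by (rule mult_right_mono) simp
        finally show "dist (sc (1 / l) (T u - y)) (sc (1 / l) (T v - y)) \<le> 1 / 2 * dist u v"
          by (simp add: dist_norm)
      qed
    qed auto
    have eq: "sc (1 / l) (T x - y) = x \<longleftrightarrow> T x - sc l x = y" for x y
    proof
      assume "sc (1 / l) (T x - y) = x"
      then have "sc l (sc (1 / l) (T x - y)) = sc l x" by (rule arg_cong)
      then have "T x - y = sc l x" using l0 by (simp only: scale_scale) simp
      then have "T x = sc l x + y" by (simp only: diff_eq_eq)
      then show "T x - sc l x = y" by simp
    next
      assume "T x - sc l x = y"
      then have "T x - y = sc l x" by (metis add_diff_cancel_left' diff_add_cancel)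
      then show "sc (1 / l) (T x - y) = x" using l0 by simp
    qed
    show ?thesis
    proof (rule bij_shiftI[OF T])
      show "\<exists>x. T x - sc l x = y" for y using ex[of y] unfolding eq by blast
      show "x = 0" if "T x = sc l x" for x
      proof -
        have "T x - sc l x = 0" "T 0 - sc l 0 = 0" using that bop_0[OF T] by simp_all
        with ex[of 0] show ?thesis unfolding eq by blast
      qed
    qed
  qed
  then show ?thesis using that[of "2 * K"] K(1) by simp
qed

text \<open>\<open>T - \<mu>\<close> divides \<open>T^p - \<mu>^p\<close>. For nonzero \<mu> this
  reduces solving \<open>(T - \<mu>) x = y\<close> to right-hand sides in the range of
  \<open>T^p\<close>.\<close>

lemma funpow_shift_factor:
  assumes T: "bop sc T"
  shows "\<exists>g. (T ^^ p) x - sc (\<mu> ^ p) x = T g - sc \<mu> g"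
proof (induction p)
  case 0
  show ?case using bop_0[OF T] by (intro exI[of _ 0]) simp
next
  case (Suc p)
  then obtain g where g: "(T ^^ p) x - sc (\<mu> ^ p) x = T g - sc \<mu> g" by blast
  have "(T ^^ Suc p) x - sc (\<mu> ^ Suc p) x = T ((T ^^ p) x - sc (\<mu> ^ p) x) + (T (sc (\<mu> ^ p) x) - sc \<mu> (sc (\<mu> ^ p) x))"
    by (simp add: bop_diff[OF T])
  also have "\<dots> = T (T g + sc (\<mu> ^ p) x) - sc \<mu> (T g + sc (\<mu> ^ p) x)"
    unfolding g by (simp add: bop_diff[OF T] bop_add[OF T] bop_scale[OF T] scale_right_distrib algebra_simps)
  finally show ?case by blast
qed

text \<open>On \<open>R(T^p)\<close> the operator is bijective with bounded inverse, and
  \<open>T - \<mu>\<close> stays bijective there for \<open>cmod \<mu> < 1 / (2 * K)\<close>.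
  Eigenvectors for nonzero \<mu> lie in this range, and divisibility of \<open>T^p - \<mu>^p\<close>
  by \<open>T - \<mu>\<close> extends solvability to the whole space.\<close>

lemma pole_isolated:
  assumes T: "bop sc T" and "pole T"
  obtains \<delta> where "\<delta> > 0" "\<And>\<mu>. \<mu> \<noteq> 0 \<Longrightarrow> cmod \<mu> < \<delta> \<Longrightarrow> bij (shift sc T \<mu>)"
proof -
  obtain p where p: "range (T ^^ p) = range (T ^^ Suc p)" "{x. T x = 0} \<inter> range (T ^^ p) \<subseteq> {0}"
    "closed (range (T ^^ p))"
    using poleE[OF assms] by metis
  let ?M = "range (T ^^ p)"
  have M: "subspace ?M" using T by (rule subspace_range_funpow)
  have TM: "T ` ?M = ?M" using p(1) by (simp only: range_funpow_Suc)
  obtain K where K: "K > 0" "\<And>y. y \<in> ?M \<Longrightarrow> \<exists>x\<in>?M. T x = y \<and> norm x \<le> K * norm y"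
    using open_mapping_bound[OF bop_bounded_linear[OF T] real_subspace[OF M] p(3) p(3) TM] by blast
  have "bij (shift sc T \<mu>)" if \<mu>: "\<mu> \<noteq> 0" "cmod \<mu> < 1 / (2 * K)" for \<mu>
  proof -
    have mK: "cmod \<mu> * K \<le> 1 / 2" using \<mu>(2) K(1) by (simp add: field_simps)
    show ?thesis
    proof (rule bij_shiftI[OF T])
      fix x assume x: "T x = sc \<mu> x"
      have "(T ^^ k) x = sc (\<mu> ^ k) x" for k
        by (induction k) (simp_all add: bop_scale[OF T] x mult.commute)
      then have "(T ^^ p) (sc (1 / \<mu> ^ p) x) = x" using \<mu>(1) by (simp add: bop_scale[OF bop_funpow[OF T]])
      then have xM: "x \<in> ?M" by (metis rangeI)
      then have "sc \<mu> x \<in> ?M" using M by (simp add: subspace_scale)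
      from K(2)[OF this] obtain u where u: "u \<in> ?M" "T u = sc \<mu> x" "norm u \<le> K * (cmod \<mu> * norm x)" by auto
      have "u - x \<in> {x. T x = 0} \<inter> ?M" using u x xM M by (auto simp: bop_diff[OF T] intro!: subspace_diff)
      then have "u = x" using p(2) by auto
      then have "norm x \<le> (cmod \<mu> * K) * norm x" using u(3) by (simp add: mult_ac)
      also have "\<dots> \<le> 1 / 2 * norm x" using mK by (rule mult_right_mono) simp
      finally show "x = 0" by simp
    next
      fix y
      define m where "m = (T ^^ p) y"
      have "m \<in> ?M" by (simp add: m_def)
      then obtain x0 where x0: "x0 \<in> ?M" "T x0 = m" using TM by (metis imageE)
      obtain x where x: "x 0 = x0" "\<And>i::nat. x i \<in> ?M" "\<And>i. T (x (Suc i)) = x i" "\<And>i. norm (x i) \<le> K ^ i * norm x0"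
        using bounded_chain_exists[of x0 ?M "\<lambda>x y. T y = x", OF x0(1) K(2)] K(1) by (metis less_imp_le)
      have "T (x (Suc i)) - x i \<in> {0}" for i using x(3) by simp
      then obtain a where a: "T a - sc \<mu> a - T x0 \<in> {0}"
        using chain_sum[OF T subspace_single_0 _ M p(3) x(2) _ x(4) less_imp_le[OF K(1)] mK] x(1) by auto
      obtain g where g: "(T ^^ p) y - sc (\<mu> ^ p) y = T g - sc \<mu> g" using funpow_shift_factor[OF T] by blast
      define b where "b = a - g"
      have "sc (\<mu> ^ p) y = T b - sc \<mu> b"
        using a g x0(2) by (simp add: b_def m_def bop_diff[OF T] scale_right_diff_distrib algebra_simps)
      then have "sc (1 / \<mu> ^ p) (sc (\<mu> ^ p) y) = sc (1 / \<mu> ^ p) (T b - sc \<mu> b)" by simp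
      then have "T (sc (1 / \<mu> ^ p) b) - sc \<mu> (sc (1 / \<mu> ^ p) b) = y"
        using \<mu>(1) by (simp add: bop_scale[OF T] scale_right_diff_distrib mult.commute)
      then show "\<exists>x. T x - sc \<mu> x = y" by blast
    qed
  qed
  then show ?thesis using that[of "1 / (2 * K)"] K(1) by simp
qed

theorem uniform_descent_everywhere:
  assumes T: "bop sc T" and W: "\<And>l. uniform_descent (shift sc T l)"
  shows "pole (shift sc T l)" and "finite {l. \<not> bij (shift sc T l)}"
proof -
  let ?\<rho> = "{l. bij (shift sc T l)}"
  have pole_cl: "pole (shift sc T l)" if l: "l \<in> closure ?\<rho>" for l
  proof (rule uniform_descent_boundary_pole[OF bop_shift[OF T] W])
    fix e :: real assume "e > 0"
    with l obtain m where m: "m \<in> ?\<rho>" "dist m l < e" unfolding closure_approachable by blast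
    then show "\<exists>\<mu>. cmod \<mu> < e \<and> bij (shift sc (shift sc T l) \<mu>)"
      by (intro exI[of _ "m - l"]) (simp add: shift_shift dist_norm)
  qed
  have iso: "\<exists>\<delta>>0. \<forall>m. m \<noteq> l \<and> dist m l < \<delta> \<longrightarrow> m \<in> ?\<rho>" if p: "pole (shift sc T l)" for l
  proof -
    obtain \<delta> where \<delta>: "\<delta> > 0" "\<And>\<mu>. \<mu> \<noteq> 0 \<Longrightarrow> cmod \<mu> < \<delta> \<Longrightarrow> bij (shift sc (shift sc T l) \<mu>)"
      using pole_isolated[OF bop_shift[OF T] p] by blast
    have "m \<in> ?\<rho>" if "m \<noteq> l" "dist m l < \<delta>" for m
      using \<delta>(2)[of "m - l"] that by (simp add: shift_shift dist_norm)
    with \<delta>(1) show ?thesis by blast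
  qed
  obtain R where R: "R > 0" "\<And>l. cmod l > R \<Longrightarrow> bij (shift sc T l)" using bij_shift_large[OF T] by blast
  have "open (closure ?\<rho>)"
    unfolding open_dist
  proof
    fix l assume l: "l \<in> closure ?\<rho>"
    obtain \<delta> where \<delta>: "\<delta> > 0" "\<And>m. m \<noteq> l \<Longrightarrow> dist m l < \<delta> \<Longrightarrow> m \<in> ?\<rho>"
      using iso[OF pole_cl[OF l]] by blast
    have "m \<in> closure ?\<rho>" if "dist m l < \<delta>" for m
      using l closure_subset[THEN subsetD, OF \<delta>(2)[OF _ that]] by (cases "m = l") simp_all
    with \<delta>(1) show "\<exists>e>0. \<forall>y. dist y l < e \<longrightarrow> y \<in> closure ?\<rho>" by blast
  qed
  moreover have "closure ?\<rho> \<noteq> {}"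
  proof -
    have "complex_of_real (R + 1) \<in> ?\<rho>" using R by simp
    then show ?thesis using closure_subset by blast
  qed
  \<comment> \<open>By connectedness of the plane the resolvent set is dense, so every shift falls
    under \<open>pole_cl\<close>.\<close>
  ultimately have UN: "closure ?\<rho> = UNIV" using clopen[of "closure ?\<rho>"] by auto
  then show all: "pole (shift sc T l)" for l using pole_cl by blast
  let ?\<sigma> = "{l. \<not> bij (shift sc T l)}"
  show "finite ?\<sigma>"
  proof (rule ccontr)
    assume inf: "infinite ?\<sigma>"
    \<comment> \<open>The spectrum lies in a disc, so an infinite one accumulates somewhere; but
      around every point there is a punctured disc of regular points.\<close>
    have "?\<sigma> \<subseteq> cball 0 R" using R(2) by (auto simp: not_less[symmetric])
    then obtain l where "l islimpt ?\<sigma>"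
      using compact_cball[of 0 R] inf unfolding compact_eq_Bolzano_Weierstrass by blast
    moreover obtain \<delta> where "\<delta> > 0" "\<And>m. m \<noteq> l \<Longrightarrow> dist m l < \<delta> \<Longrightarrow> m \<in> ?\<rho>" using iso[OF all] by blast
    ultimately show False unfolding islimpt_approachable by blast
  qed
qed

end

section \<open>The Hahn-Banach theorem\<close>

definition sublinear :: "('a::real_vector \<Rightarrow> real) \<Rightarrow> bool" where
  "sublinear q \<longleftrightarrow> (\<forall>x y. q (x + y) \<le> q x + q y) \<and> (\<forall>r x. r > 0 \<longrightarrow> q (r *\<^sub>R x) = r * q x)"

lemma sublinearI:
  assumes "\<And>x y. q (x + y) \<le> q x + q y" "\<And>r x. r > 0 \<Longrightarrow> q (r *\<^sub>R x) \<le> r * q x"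
  shows "sublinear q"
  unfolding sublinear_def
proof (intro conjI allI impI assms(1) antisym)
  fix r :: real and x assume r: "r > 0"
  then show "q (r *\<^sub>R x) \<le> r * q x" by (rule assms(2))
  have "q x \<le> (1 / r) * q (r *\<^sub>R x)" using assms(2)[of "1 / r" "r *\<^sub>R x"] r by simp
  then show "r * q x \<le> q (r *\<^sub>R x)" using r by (simp add: field_simps)
qed

lemma sublinear_0: "sublinear q \<Longrightarrow> q 0 = 0"
proof -
  assume "sublinear q"
  then have "q (2 *\<^sub>R 0) = 2 * q 0" unfolding sublinear_def by (metis zero_less_numeral)
  then show ?thesis by simp
qed

lemma sublinear_neg: "sublinear q \<Longrightarrow> - q (- x) \<le> q x"
proof -
  assume q: "sublinear q"
  then have "q (x + - x) \<le> q x + q (- x)" unfolding sublinear_def by blast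
  then show ?thesis using sublinear_0[OF q] by simp
qed

text \<open>The infimum of \<open>q (x + t y) - t q y\<close> over \<open>t \<ge> 0\<close> is the
  standard lowering of \<open>q\<close> in the direction \<open>- y\<close>. It serves twice: on a
  minimal functional, to show that it is odd, and on a distance function, to prescribe the sign of a
  functional at a point.\<close>

lemma sublinear_tilt:
  assumes q: "sublinear q"
  obtains q' where "sublinear q'" "\<And>x. q' x \<le> q x" "q' (- y) \<le> - q y"
proof -
  define g where "g x t = q (x + t *\<^sub>R y) - t * q y" for x t
  define q' where "q' x = (INF t\<in>{0..}. g x t)" for x
  have sub: "q (a + b) \<le> q a + q b" and hom: "r > 0 \<Longrightarrow> q (r *\<^sub>R a) = r * q a" for a b r
    using q by (auto simp: sublinear_def)
  have hom0: "q (t *\<^sub>R y) = t * q y" if "t \<ge> 0" for t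
    using hom[of t y] that sublinear_0[OF q] by (cases "t = 0") auto
  have bd: "- q (- x) \<le> g x t" if "t \<ge> 0" for x t
  proof -
    have "q ((x + t *\<^sub>R y) + - x) \<le> q (x + t *\<^sub>R y) + q (- x)" by (rule sub)
    then show ?thesis using hom0[OF that] by (simp add: g_def)
  qed
  have le: "q' x \<le> g x t" if "t \<ge> 0" for x t
    unfolding q'_def using bd that by (intro cINF_lower bdd_belowI2[of _ "- q (- x)"]) auto
  have ge: "c \<le> q' x" if "\<And>t. t \<ge> 0 \<Longrightarrow> c \<le> g x t" for c x
    unfolding q'_def using that by (intro cINF_greatest) auto
  have "sublinear q'"
  proof (rule sublinearI)
    fix x x'
    have "q' (x + x') - g x t \<le> q' x'" if t: "t \<ge> 0" for t
    proof (rule ge)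
      fix s :: real assume s: "s \<ge> 0"
      have "q' (x + x') \<le> g (x + x') (t + s)" using t s by (intro le) simp
      also have "\<dots> \<le> g x t + g x' s"
        using sub[of "x + t *\<^sub>R y" "x' + s *\<^sub>R y"] by (simp add: g_def algebra_simps)
      finally show "q' (x + x') - g x t \<le> g x' s" by simp
    qed
    then have "q' (x + x') - q' x' \<le> q' x" by (intro ge) (simp add: algebra_simps)
    then show "q' (x + x') \<le> q' x + q' x'" by simp
  next
    fix r :: real and x assume r: "r > 0"
    have "q' (r *\<^sub>R x) / r \<le> q' x"
    proof (rule ge)
      fix t :: real assume t: "t \<ge> 0"
      have "q' (r *\<^sub>R x) \<le> g (r *\<^sub>R x) (r * t)" using r t by (intro le) simp
      also have "\<dots> = r * g x t"
        using hom[OF r, of "x + t *\<^sub>R y"] by (simp add: g_def algebra_simps)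
      finally show "q' (r *\<^sub>R x) / r \<le> g x t" using r by (simp add: field_simps)
    qed
    then show "q' (r *\<^sub>R x) \<le> r * q' x" using r by (simp add: field_simps)
  qed
  moreover have "q' x \<le> q x" for x using le[of 0 x] by (simp add: g_def)
  moreover have "q' (- y) \<le> - q y" using le[of 1 "- y"] sublinear_0[OF q] by (simp add: g_def)
  ultimately show ?thesis using that by blast
qed

text \<open>A minimal sublinear functional is odd, hence linear.\<close>
theorem sublinear_dominates_linear:
  fixes p :: "'a::real_vector \<Rightarrow> real"
  assumes p: "sublinear p"
  obtains f where "linear f" "\<And>x. f x \<le> p x"
proof -
  define A where "A = {q. sublinear q \<and> (\<forall>x. q x \<le> p x)}"
  \<comment> \<open>\<open>?P m a\<close> puts \<open>a\<close> below \<open>m\<close>, so Zorn's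
    maximal element is a pointwise minimal sublinear functional.\<close>
  let ?P = "\<lambda>a b :: 'a \<Rightarrow> real. \<forall>x. b x \<le> a x"
  have "\<exists>m\<in>A. \<forall>a\<in>A. ?P m a \<longrightarrow> a = m"
  proof (rule predicate_Zorn)
    show "partial_order_on A (relation_of ?P A)"
      by (rule partial_order_on_relation_ofI) (auto intro: order_trans intro!: ext antisym)
    fix C assume C: "C \<in> Chains (relation_of ?P A)"
    have CA: "C \<subseteq> A" and tot: "\<And>a b. a \<in> C \<Longrightarrow> b \<in> C \<Longrightarrow> ?P a b \<or> ?P b a"
      using C unfolding Chains_def relation_of_def by blast+
    show "\<exists>u\<in>A. \<forall>a\<in>C. ?P a u"
    proof (cases "C = {}")
      case True
      then show ?thesis using p by (auto simp: A_def)
    next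
      case False
      define u where "u x = (INF q\<in>C. q x)" for x
      have Cs: "sublinear q" "q x \<le> p x" if "q \<in> C" for q x using that CA by (auto simp: A_def)
      have bd: "- p (- x) \<le> q x" if "q \<in> C" for q x
        using sublinear_neg[OF Cs(1)[OF that], of x] Cs(2)[OF that, of "- x"] by simp
      have le: "u x \<le> q x" if "q \<in> C" for q x
        unfolding u_def using bd that by (intro cINF_lower bdd_belowI2[of _ "- p (- x)"]) auto
      have ge: "c \<le> u x" if "\<And>q. q \<in> C \<Longrightarrow> c \<le> q x" for c x
        unfolding u_def using that False by (intro cINF_greatest) auto
      have "sublinear u"
      proof (rule sublinearI)
        fix x y
        have "u (x + y) - q x \<le> u y" if q: "q \<in> C" for q
        proof (rule ge)
          fix q' assume q': "q' \<in> C"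
          obtain m where m: "m \<in> C" "\<And>x. m x \<le> q x" "\<And>x. m x \<le> q' x"
            using tot[OF q q'] q q' by blast
          have "u (x + y) \<le> m (x + y)" using m(1) by (rule le)
          also have "\<dots> \<le> m x + m y" using Cs(1)[OF m(1)] by (auto simp: sublinear_def)
          also have "\<dots> \<le> q x + q' y" using m(2)[of x] m(3)[of y] by simp
          finally show "u (x + y) - q x \<le> q' y" by simp
        qed
        then have "u (x + y) - u y \<le> u x" by (intro ge) (simp add: algebra_simps)
        then show "u (x + y) \<le> u x + u y" by simp
      next
        fix r :: real and x assume r: "r > 0"
        have "u (r *\<^sub>R x) / r \<le> u x"
        proof (rule ge)
          fix q assume q: "q \<in> C"
          have "u (r *\<^sub>R x) \<le> r * q x" using le[OF q, of "r *\<^sub>R x"] Cs(1)[OF q] r by (auto simp: sublinear_def)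
          then show "u (r *\<^sub>R x) / r \<le> q x" using r by (simp add: field_simps)
        qed
        then show "u (r *\<^sub>R x) \<le> r * u x" using r by (simp add: field_simps)
      qed
      moreover have "u x \<le> p x" for x
        using False le Cs(2) by (meson ex_in_conv order_trans)
      ultimately show ?thesis using le by (auto simp: A_def)
    qed
  qed
  then obtain f where f: "sublinear f" "\<And>x. f x \<le> p x"
    and min: "\<And>a. sublinear a \<Longrightarrow> (\<And>x. a x \<le> f x) \<Longrightarrow> a = f"
    unfolding A_def by (auto intro: order_trans) (meson order_trans)
  have odd: "f (- y) = - f y" for y
  proof -
    obtain q' where q': "sublinear q'" "\<And>x. q' x \<le> f x" "q' (- y) \<le> - f y"
      using sublinear_tilt[OF f(1)] by blast
    have "q' = f" using q' by (intro min)
    then show ?thesis using q'(3) sublinear_neg[OF f(1), of y] by simp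
  qed
  have sub: "f (a + b) \<le> f a + f b" and hom: "r > 0 \<Longrightarrow> f (r *\<^sub>R a) = r * f a" for a b r
    using f(1) by (auto simp: sublinear_def)
  have "linear f"
  proof (rule linearI)
    fix a b
    have "f (- a + - b) \<le> f (- a) + f (- b)" by (rule sub)
    then have "f a + f b \<le> f (a + b)" using odd[of "a + b"] odd[of a] odd[of b] by (simp add: add.commute)
    with sub[of a b] show "f (a + b) = f a + f b" by simp
  next
    fix r :: real and a
    consider "r > 0" | "r = 0" | "r < 0" by linarith
    then show "f (r *\<^sub>R a) = r *\<^sub>R f a"
    proof cases
      case 3
      then have "f ((- r) *\<^sub>R a) = - r * f a" by (intro hom) simp
      then show ?thesis using odd[of "r *\<^sub>R a"] by simp
    qed (use hom sublinear_0[OF f(1)] in auto)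
  qed
  with f(2) that show ?thesis by blast
qed

context cbanach
begin

definition cfunctional :: "('a \<Rightarrow> complex) \<Rightarrow> bool" where
  "cfunctional g \<longleftrightarrow> bounded_linear g \<and> (\<forall>c x. g (sc c x) = c * g x)"

lemma sublinear_infdist:
  assumes M: "subspace M"
  shows "sublinear (\<lambda>x. infdist x M)"
proof (rule sublinearI)
  have ne: "M \<noteq> {}" using subspace_0[OF M] by auto
  fix x y
  show "infdist (x + y) M \<le> infdist x M + infdist y M"
  proof (rule field_le_epsilon)
    fix e :: real assume e: "e > 0"
    obtain a where a: "a \<in> M" "dist x a < infdist x M + e / 2" using infdist_approx[OF ne half_gt_zero[OF e]] .
    obtain b where b: "b \<in> M" "dist y b < infdist y M + e / 2" using infdist_approx[OF ne half_gt_zero[OF e]] .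
    have "infdist (x + y) M \<le> dist (x + y) (a + b)" using a b M by (intro infdist_le subspace_add)
    also have "\<dots> \<le> dist x a + dist y b" by (rule dist_triangle_add)
    finally show "infdist (x + y) M \<le> infdist x M + infdist y M + e" using a b by simp
  qed
next
  have ne: "M \<noteq> {}" using subspace_0[OF M] by auto
  fix r :: real and x assume r: "r > 0"
  show "infdist (r *\<^sub>R x) M \<le> r * infdist x M"
  proof (rule field_le_epsilon)
    fix e :: real assume e: "e > 0"
    obtain a where a: "a \<in> M" "dist x a < infdist x M + e / r" using infdist_approx[OF ne divide_pos_pos[OF e r]] .
    have "r *\<^sub>R a \<in> M" unfolding sc_of_real[symmetric] using M a by (intro subspace_scale)
    then have "infdist (r *\<^sub>R x) M \<le> dist (r *\<^sub>R x) (r *\<^sub>R a)" by (rule infdist_le)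
    also have "\<dots> = r * dist x a" using r by (simp add: dist_norm scaleR_right_diff_distrib[symmetric])
    also have "\<dots> \<le> r * (infdist x M + e / r)" using a r by (intro mult_left_mono) auto
    also have "\<dots> = r * infdist x M + e" using r by (simp add: field_simps)
    finally show "infdist (r *\<^sub>R x) M \<le> r * infdist x M + e" .
  qed
qed

text \<open>The distance to \<open>M\<close> is sublinear and vanishes on \<open>M\<close>, so a
  linear functional below it vanishes there; tilting the distance at \<open>x0\<close> beforehand
  makes the value at \<open>x0\<close> positive.\<close>

theorem hahn_banach_separation:
  assumes M: "subspace M" "closed M" and x0: "x0 \<notin> M"
  obtains g where "cfunctional g" "\<And>m. m \<in> M \<Longrightarrow> g m = 0" "g x0 = 1"
proof -
  have z: "0 \<in> M" using M(1) by (rule subspace_0)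
  have d: "infdist x0 M > 0" using M z x0 by (intro infdist_pos_not_in_closed) auto
  obtain q where q: "sublinear q" "\<And>x. q x \<le> infdist x M" "q (- x0) \<le> - infdist x0 M"
    using sublinear_tilt[OF sublinear_infdist[OF M(1)]] by blast
  obtain f where f: "linear f" "\<And>x. f x \<le> q x" using sublinear_dominates_linear[OF q(1)] by blast
  have f': "f x \<le> infdist x M" for x using f(2) q(2) order_trans by blast
  have fx0: "f x0 > 0" using f(2)[of "- x0"] q(3) d linear_neg[OF f(1), of x0] by linarith
  have fM: "f m = 0" if "m \<in> M" for m
    using f'[of m] f'[of "- m"] that subspace_neg[OF M(1) that] linear_neg[OF f(1), of m] by simp
  have fb: "\<bar>f x\<bar> \<le> norm x" for x
    using f'[of x] f'[of "- x"] infdist_le[OF z, of x] infdist_le[OF z, of "- x"] linear_neg[OF f(1), of x] by simp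
  \<comment> \<open>The usual passage from a real functional to the complex-linear one with real
    part \<open>f\<close>.\<close>
  define h where "h x = complex_of_real (f x) - \<i> * complex_of_real (f (sc \<i> x))" for x
  have hadd: "h (x + y) = h x + h y" for x y
    by (simp add: h_def scale_right_distrib linear_add[OF f(1)] algebra_simps)
  have hR: "h (r *\<^sub>R x) = r *\<^sub>R h x" for r x
  proof -
    have "sc \<i> (r *\<^sub>R x) = r *\<^sub>R sc \<i> x" by (simp add: sc_of_real[symmetric] mult.commute)
    then show ?thesis by (simp add: h_def linear_scale[OF f(1)] scaleR_conv_of_real algebra_simps)
  qed
  have hi: "h (sc \<i> x) = \<i> * h x" for x
    by (simp add: h_def linear_neg[OF f(1)] algebra_simps)
  have hsc: "h (sc c x) = c * h x" for c x
  proof -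
    have "sc c x = Re c *\<^sub>R x + Im c *\<^sub>R sc \<i> x"
      unfolding sc_of_real[symmetric] scale_scale scale_left_distrib[symmetric]
      by (simp add: complex_eq mult.commute)
    then have "h (sc c x) = Re c *\<^sub>R h x + Im c *\<^sub>R (\<i> * h x)" by (simp add: hadd hR hi)
    also have "\<dots> = (complex_of_real (Re c) + \<i> * complex_of_real (Im c)) * h x"
      by (simp add: scaleR_conv_of_real algebra_simps)
    also have "\<dots> = c * h x" by (simp add: complex_eq[symmetric])
    finally show ?thesis .
  qed
  have hb: "norm (h x) \<le> norm x * 2" for x
  proof -
    have "norm (h x) \<le> \<bar>f x\<bar> + \<bar>f (sc \<i> x)\<bar>"
      unfolding h_def by (rule order_trans[OF norm_triangle_ineq4]) (simp add: norm_mult)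
    then show ?thesis using fb[of x] fb[of "sc \<i> x"] by simp
  qed
  have "bounded_linear h" using hadd hR hb by (rule bounded_linear_intro)
  then have "bounded_linear (\<lambda>x. h x * (1 / h x0))" by (rule bounded_linear_mult_const)
  then have "cfunctional (\<lambda>x. h x * (1 / h x0))" unfolding cfunctional_def by (simp add: hsc)
  moreover have "h m * (1 / h x0) = 0" if "m \<in> M" for m
    using fM[OF that] fM[OF subspace_scale[OF M(1) that]] by (simp add: h_def)
  moreover have "h x0 * (1 / h x0) = 1"
  proof -
    have "Re (h x0) = f x0" by (simp add: h_def)
    then have "h x0 \<noteq> 0" using fx0 by auto
    then show ?thesis by simp
  qed
  ultimately show ?thesis using that[of "\<lambda>x. h x * (1 / h x0)"] by blast
qed

section \<open>Operators with everywhere uniform descent\<close>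

text \<open>By Liouville: the resolvent of \<open>T\<close> on \<open>Y\<close>, applied to
  \<open>y0\<close> and tested against a functional, would be entire and vanish at infinity.\<close>

theorem empty_spectrum_trivial:
  assumes T: "bop sc T" and Y: "subspace Y" "closed Y" and inv: "T ` Y \<subseteq> Y"
    and inj: "\<And>l x. x \<in> Y \<Longrightarrow> T x = sc l x \<Longrightarrow> x = 0"
    and surj: "\<And>l y. y \<in> Y \<Longrightarrow> \<exists>x\<in>Y. T x - sc l x = y"
  shows "Y \<subseteq> {0}"
proof
  fix y0 assume y0: "y0 \<in> Y"
  define R where "R l y = (SOME x. x \<in> Y \<and> T x - sc l x = y)" for l y
  have R: "R l y \<in> Y" "T (R l y) - sc l (R l y) = y" if "y \<in> Y" for l y
  proof -
    have "R l y \<in> Y \<and> T (R l y) - sc l (R l y) = y"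
      unfolding R_def by (rule someI_ex) (use surj[OF that] in blast)
    then show "R l y \<in> Y" "T (R l y) - sc l (R l y) = y" by auto
  qed
  have uniq: "x = R l y" if x: "x \<in> Y" "T x - sc l x = y" and y: "y \<in> Y" for x l y
  proof -
    have "T (x - R l y) = sc l (x - R l y)"
      using x(2) R(2)[OF y, of l] by (simp add: bop_diff[OF T] scale_right_diff_distrib algebra_simps)
    then have "x - R l y = 0" by (rule inj[rotated]) (use x R y Y in \<open>auto intro: subspace_diff\<close>)
    then show ?thesis by simp
  qed
  have bnd: "\<exists>K>0. \<forall>y\<in>Y. norm (R l y) \<le> K * norm y" for l
  proof -
    have im: "shift sc T l ` Y = Y"
    proof
      show "shift sc T l ` Y \<subseteq> Y"
        using inv Y(1) unfolding shift_def by (auto intro!: subspace_diff subspace_scale)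
      show "Y \<subseteq> shift sc T l ` Y"
      proof
        fix y assume y: "y \<in> Y"
        then have "y = shift sc T l (R l y)" using R(2) by (simp add: shift_def)
        then show "y \<in> shift sc T l ` Y" using R(1)[OF y] by (rule image_eqI)
      qed
    qed
    obtain K where K: "K > 0" "\<And>y. y \<in> Y \<Longrightarrow> \<exists>x\<in>Y. shift sc T l x = y \<and> norm x \<le> K * norm y"
      using open_mapping_bound[OF bop_bounded_linear[OF bop_shift[OF T]] real_subspace[OF Y(1)] Y(2) Y(2) im] by blast
    have "norm (R l y) \<le> K * norm y" if y: "y \<in> Y" for y
    proof -
      from K(2)[OF y] obtain x where x: "x \<in> Y" "T x - sc l x = y" "norm x \<le> K * norm y"
        by (auto simp: shift_def)
      with uniq[OF x(1,2) y] show ?thesis by simp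
    qed
    with K(1) show ?thesis by blast
  qed
  define u where "u l = R l y0" for l
  have u: "u l \<in> Y" "T (u l) = y0 + sc l (u l)" for l
    using R[OF y0, of l] by (simp_all add: u_def algebra_simps)
  \<comment> \<open>The resolvent identity; continuity and differentiability of \<open>u\<close>
    both follow from it.\<close>
  have diff: "u m - u l = sc (m - l) (R l (u m))" for l m
  proof -
    have eq: "T (u m - u l) - sc l (u m - u l) = sc (m - l) (u m)"
      by (simp add: bop_diff[OF T] u(2) scale_right_diff_distrib scale_left_diff_distrib algebra_simps)
    have "T (sc (m - l) (R l (u m))) - sc l (sc (m - l) (R l (u m))) = sc (m - l) (T (R l (u m)) - sc l (R l (u m)))"
      by (simp add: bop_scale[OF T] scale_right_diff_distrib mult.commute)
    also have "\<dots> = sc (m - l) (u m)" by (simp only: R(2)[OF u(1)])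
    finally have eq': "T (sc (m - l) (R l (u m))) - sc l (sc (m - l) (R l (u m))) = sc (m - l) (u m)" .
    have sY: "sc (m - l) (u m) \<in> Y" using Y(1) u(1) by (intro subspace_scale)
    have "u m - u l = R l (sc (m - l) (u m))"
      using u(1) Y(1) by (intro uniq[OF _ eq sY] subspace_diff)
    moreover have "sc (m - l) (R l (u m)) = R l (sc (m - l) (u m))"
      using R(1)[OF u(1)] Y(1) by (intro uniq[OF _ eq' sY] subspace_scale)
    ultimately show ?thesis by simp
  qed
  have lim: "((\<lambda>m. R l (u m)) \<longlongrightarrow> R l (u l)) (at l)" for l
  proof -
    obtain K where K: "K > 0" "\<And>y. y \<in> Y \<Longrightarrow> norm (R l y) \<le> K * norm y" using bnd[of l] by blast
    \<comment> \<open>For \<open>cmod (m - l) * K \<le> 1 / 2\<close> the resolvent identity lets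
      half of \<open>norm (u m)\<close> be absorbed.\<close>
    have near: "norm (u m) \<le> 2 * norm (u l)" if m: "dist m l < 1 / (2 * K)" for m
    proof -
      have mK: "cmod (m - l) * K \<le> 1 / 2" using m K(1) by (simp add: dist_norm field_simps)
      have "norm (u m - u l) = cmod (m - l) * norm (R l (u m))" unfolding diff by simp
      also have "\<dots> \<le> cmod (m - l) * (K * norm (u m))" using K(2)[OF u(1)] by (intro mult_left_mono) auto
      also have "\<dots> \<le> 1 / 2 * norm (u m)"
        using mult_right_mono[OF mK norm_ge_zero[of "u m"]] by (simp add: mult.assoc)
      finally show ?thesis using norm_triangle_sub[of "u m" "u l"] by simp
    qed
    have Rd: "R l (u m) - R l (u l) = R l (u m - u l)" for m
      by (rule uniq)
        (use R[OF u(1), of l] u(1) Y(1) in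
          \<open>auto simp: bop_diff[OF T] scale_right_diff_distrib algebra_simps intro: subspace_diff\<close>)
    have bd: "norm (R l (u m) - R l (u l)) \<le> cmod (m - l) * (K * K * (2 * norm (u l)))"
      if m: "dist m l < 1 / (2 * K)" for m
    proof -
      have "norm (R l (u m - u l)) \<le> K * norm (u m - u l)" using u(1) Y(1) by (intro K(2) subspace_diff)
      also have "norm (u m - u l) = cmod (m - l) * norm (R l (u m))" unfolding diff by simp
      also have "K * \<dots> \<le> K * (cmod (m - l) * (K * (2 * norm (u l))))"
        using K(1) near[OF m] by (intro mult_left_mono order_trans[OF K(2)[OF u(1)]]) auto
      finally show ?thesis unfolding Rd by (simp add: mult_ac)
    qed
    have "((\<lambda>m. R l (u m) - R l (u l)) \<longlongrightarrow> 0) (at l)"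
    proof (rule Lim_null_comparison)
      show "\<forall>\<^sub>F m in at l. norm (R l (u m) - R l (u l)) \<le> cmod (m - l) * (K * K * (2 * norm (u l)))"
        unfolding eventually_at using bd K(1) by (intro exI[of _ "1 / (2 * K)"]) auto
      have "((\<lambda>m. cmod (m - l) * (K * K * (2 * norm (u l)))) \<longlongrightarrow> cmod (l - l) * (K * K * (2 * norm (u l)))) (at l)"
        by (intro tendsto_intros)
      then show "((\<lambda>m. cmod (m - l) * (K * K * (2 * norm (u l)))) \<longlongrightarrow> 0) (at l)" by simp
    qed
    then show ?thesis by (rule LIM_zero_cancel)
  qed
  have "g (u 0) = 0" if g: "cfunctional g" for g
  proof (rule Liouville_weak_0[of "\<lambda>l. g (u l)" 0])
    have gl: "bounded_linear g" and gs: "\<And>c x. g (sc c x) = c * g x" using g by (auto simp: cfunctional_def)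
    show "(\<lambda>l. g (u l)) holomorphic_on UNIV"
      unfolding holomorphic_on_def
    proof
      fix l :: complex
      have "((\<lambda>m. (g (u m) - g (u l)) / (m - l)) \<longlongrightarrow> g (R l (u l))) (at l)"
      proof (rule Lim_transform_eventually)
        show "((\<lambda>m. g (R l (u m))) \<longlongrightarrow> g (R l (u l))) (at l)" using gl lim by (rule bounded_linear.tendsto)
        have "g (R l (u m)) = (g (u m) - g (u l)) / (m - l)" if "m \<noteq> l" for m
        proof -
          have "g (u m) - g (u l) = g (u m - u l)" using gl by (simp add: bounded_linear.linear linear_diff)
          also have "\<dots> = (m - l) * g (R l (u m))" unfolding diff gs ..
          finally show ?thesis using that by simp
        qed
        then show "\<forall>\<^sub>F m in at l. g (R l (u m)) = (g (u m) - g (u l)) / (m - l)"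
          unfolding eventually_at by (intro exI[of _ 1]) auto
      qed
      then have "((\<lambda>l. g (u l)) has_field_derivative g (R l (u l))) (at l within UNIV)"
        unfolding has_field_derivative_iff .
      then show "(\<lambda>l. g (u l)) field_differentiable at l within UNIV"
        unfolding field_differentiable_def by blast
    qed
    obtain K where K: "K > 0" "\<And>x. norm (T x) \<le> norm x * K"
      using bounded_linear.pos_bounded[OF bop_bounded_linear[OF T]] by blast
    obtain G where G: "G > 0" "\<And>x. norm (g x) \<le> norm x * G" using bounded_linear.pos_bounded[OF gl] by blast
    have ub: "norm (u l) * cmod l \<le> 2 * norm y0" if l: "cmod l \<ge> 2 * K" for l
    proof -
      have "sc l (u l) = T (u l) - y0" using u(2)[of l] by simp
      then have "norm (u l) * cmod l = norm (T (u l) - y0)" by (metis mult.commute norm_sc)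
      also have "\<dots> \<le> norm (u l) * K + norm y0" using norm_triangle_ineq4[of "T (u l)" y0] K(2)[of "u l"] by linarith
      finally have "norm (u l) * cmod l \<le> norm (u l) * K + norm y0" .
      moreover have "norm (u l) * (2 * K) \<le> norm (u l) * cmod l" using l by (intro mult_left_mono) auto
      ultimately show ?thesis by linarith
    qed
    show "((\<lambda>l. g (u l)) \<longlongrightarrow> 0) at_infinity"
    proof (rule Lim_null_comparison)
      show "\<forall>\<^sub>F l in at_infinity. norm (g (u l)) \<le> norm (complex_of_real (2 * norm y0 * G) / l)"
        unfolding eventually_at_infinity
      proof (intro exI[of _ "2 * K"] allI impI)
        fix l assume l: "2 * K \<le> cmod l"
        then have l0: "cmod l > 0" using K(1) by linarith
        have "norm (g (u l)) * cmod l \<le> (norm (u l) * cmod l) * G"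
          using mult_right_mono[OF G(2)[of "u l"] norm_ge_zero[of l]] by (simp add: mult_ac)
        also have "\<dots> \<le> 2 * norm y0 * G" using ub[OF l] G(1) by (intro mult_right_mono) auto
        finally show "norm (g (u l)) \<le> norm (complex_of_real (2 * norm y0 * G) / l)"
          using l0 G(1) by (simp add: norm_divide norm_mult field_simps)
      qed
      have "((\<lambda>l. complex_of_real (2 * norm y0 * G) / l) \<longlongrightarrow> 0) at_infinity"
        by (rule tendsto_divide_0[OF tendsto_const filterlim_ident])
      then show "((\<lambda>l. norm (complex_of_real (2 * norm y0 * G) / l)) \<longlongrightarrow> 0) at_infinity"
        using tendsto_norm_zero by fastforce
    qed
  qed
  then have "u 0 = 0"
    using hahn_banach_separation[OF subspace_single_0 closed_singleton, of "u 0"]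
    by (metis singletonD zero_neq_one)
  then show "y0 \<in> {0}" using u(2)[of 0] bop_0[OF T] by simp
qed

definition shift_invertible_on :: "('a \<Rightarrow> 'a) \<Rightarrow> complex \<Rightarrow> 'a set \<Rightarrow> bool" where
  "shift_invertible_on T l Y \<longleftrightarrow> (\<forall>x\<in>Y. T x = sc l x \<longrightarrow> x = 0) \<and> (\<forall>y\<in>Y. \<exists>x\<in>Y. T x - sc l x = y)"

text \<open>Closed invariant subspaces are represented as ranges of operators \<open>Q\<close>
  commuting with \<open>T\<close>, so that the part split off is recorded by the kernel of
  \<open>Q\<close>.\<close>

definition commuting_range :: "('a \<Rightarrow> 'a) \<Rightarrow> ('a \<Rightarrow> 'a) \<Rightarrow> bool" where
  "commuting_range T Q \<longleftrightarrow> bop sc Q \<and> (\<forall>x. Q (T x) = T (Q x)) \<and> closed (range Q)"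

lemma commuting_shift:
  assumes "bop sc Q" "\<And>x. Q (T x) = T (Q x)"
  shows "Q (shift sc T l x) = shift sc T l (Q x)" "Q ((shift sc T l ^^ p) x) = (shift sc T l ^^ p) (Q x)"
proof -
  show 1: "Q (shift sc T l x) = shift sc T l (Q x)" for x
    by (simp add: shift_def bop_diff[OF assms(1)] bop_scale[OF assms(1)] assms(2))
  show "Q ((shift sc T l ^^ p) x) = (shift sc T l ^^ p) (Q x)"
    by (induction p) (simp_all add: 1)
qed

lemma shift_invertible_on_range:
  assumes "commuting_range T Q" "bop sc T" "bij (shift sc T l)"
  shows "shift_invertible_on T l (range Q)"
  unfolding shift_invertible_on_def
proof (intro conjI ballI impI)
  fix x assume "T x = sc l x"
  then show "x = 0" using bij_shift_imp(1)[OF assms(2,3)] by blast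
next
  fix y assume "y \<in> range Q"
  then obtain a where a: "y = Q a" by auto
  obtain x where "T x - sc l x = a" using bij_shift_imp(2)[OF assms(2,3)] by blast
  then have "Q (shift sc T l x) = y" using a by (simp add: shift_def)
  then have "T (Q x) - sc l (Q x) = y"
    using commuting_shift(1)[of Q T l x] assms(1) by (simp add: commuting_range_def shift_def)
  then show "\<exists>x\<in>range Q. T x - sc l x = y" by blast
qed

text \<open>A high power of \<open>T - l\<close> cuts off the generalised kernel at
  \<open>l\<close>. It commutes with every \<open>T - m\<close>, so invertibility already gained on
  the range of \<open>Q\<close> is kept.\<close>

lemma commuting_range_step:
  assumes T: "bop sc T" and Q: "commuting_range T Q" and pole: "pole (shift sc T l)"
  obtains p where "commuting_range T (\<lambda>x. (shift sc T l ^^ p) (Q x))"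
    "shift_invertible_on T l (range (\<lambda>x. (shift sc T l ^^ p) (Q x)))"
    "\<And>m. shift_invertible_on T m (range Q) \<Longrightarrow> shift_invertible_on T m (range (\<lambda>x. (shift sc T l ^^ p) (Q x)))"
proof -
  let ?S = "shift sc T l"
  have S: "bop sc ?S" using T by (rule bop_shift)
  have Sk: "bop sc (?S ^^ k)" for k using S by (rule bop_funpow)
  have Qb: "bop sc Q" and QT: "\<And>x. Q (T x) = T (Q x)" and Qc: "closed (range Q)"
    using Q by (auto simp: commuting_range_def)
  obtain p where p: "range (?S ^^ p) = range (?S ^^ Suc p)" "{x. ?S x = 0} \<inter> range (?S ^^ p) \<subseteq> {0}"
    using poleE[OF S pole] by metis
  let ?Q = "\<lambda>x. (?S ^^ p) (Q x)"
  have QS: "Q ((?S ^^ k) x) = (?S ^^ k) (Q x)" for k x using commuting_shift(2)[where Q = Q and T = T, OF Qb QT] .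
  have im: "(?S ^^ k) ` range Q = Q ` range (?S ^^ k)" for k
    by (simp add: image_image QS)
  have rQ: "range ?Q = (?S ^^ p) ` range Q" by (simp add: image_image)
  have stab: "(?S ^^ p) ` range Q = (?S ^^ Suc p) ` range Q" unfolding im p(1) ..
  have inv: "?S ` range Q \<subseteq> range Q" using commuting_shift(1)[where Q = Q and T = T, OF Qb QT] by (auto simp: image_iff) metis
  have TS: "T ((?S ^^ k) x) = (?S ^^ k) (T x)" for k x using commuting_shift(2)[where Q = T and T = T, OF T refl] .
  have ker: "{x. ?S x = 0} \<inter> (?S ^^ p) ` range Q \<subseteq> {0}" using p(2) by auto
  have cl: "closed (range ?Q)" unfolding rQ
    using closed_stable_image(1)[OF S subspace_range[OF Qb] Qc inv stab ker] .
  have sub: "range ?Q \<subseteq> range Q" using QS by (metis image_subsetI rangeI)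
  show ?thesis
  proof
    show "commuting_range T ?Q"
      unfolding commuting_range_def
      using bop_compose[OF Sk Qb] cl by (simp add: o_def QT TS)
    show "shift_invertible_on T l (range ?Q)"
      unfolding shift_invertible_on_def
    proof (intro conjI ballI impI)
      fix x assume "x \<in> range ?Q" "T x = sc l x"
      then show "x = 0" using ker unfolding rQ by (auto simp: shift_def)
    next
      fix y assume "y \<in> range ?Q"
      then obtain a where "y = (?S ^^ Suc p) (Q a)" unfolding rQ stab by blast
      then have "T (?Q a) - sc l (?Q a) = y" by (simp add: shift_def)
      then show "\<exists>x\<in>range ?Q. T x - sc l x = y" by blast
    qed
    show "shift_invertible_on T m (range ?Q)" if m: "shift_invertible_on T m (range Q)" for m
      unfolding shift_invertible_on_def
    proof (intro conjI ballI impI)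
      fix x assume "x \<in> range ?Q" "T x = sc m x"
      then show "x = 0" using m sub unfolding shift_invertible_on_def by blast
    next
      fix y assume "y \<in> range ?Q"
      then obtain a where a: "y = (?S ^^ p) (Q a)" by blast
      obtain x where x: "x \<in> range Q" "T x - sc m x = Q a" using m unfolding shift_invertible_on_def by blast
      then obtain b where b: "x = Q b" by blast
      have "T (?Q b) - sc m (?Q b) = (?S ^^ p) (T x - sc m x)"
        unfolding b by (simp add: TS bop_diff[OF Sk] bop_scale[OF Sk])
      also have "\<dots> = y" unfolding x(2) a ..
      finally show "\<exists>x\<in>range ?Q. T x - sc m x = y" by blast
    qed
  qed
qed

text \<open>Otherwise powers of \<open>F - l\<close> over the nonzero spectrum multiply to some
  \<open>Q\<close> with finite-dimensional kernel. After a further power of \<open>F\<close> the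
  range carries no spectrum at all, so \<open>F^p Q = 0\<close> and the range of \<open>F^p\<close>
  lies in that kernel. The point 0 is handled separately, as its generalised kernel may be
  infinite-dimensional.\<close>

theorem infinite_dim_eigenspace:
  assumes F: "bop sc F" and W: "\<And>l. uniform_descent (shift sc F l)"
    and nfr: "\<And>n. \<not> finite_rank sc (F ^^ n)"
  obtains l n where "l \<noteq> 0" "qdim {x. (shift sc F l ^^ n) x = 0} {0} = \<infinity>"
proof (rule ccontr)
  assume "\<not> thesis"
  with that have fin: "qdim {x. (shift sc F l ^^ n) x = 0} {0} \<noteq> \<infinity>" if "l \<noteq> 0" for l n
    using that by blast
  note pole = uniform_descent_everywhere(1)[OF F W]
  have prod: "\<exists>Q. commuting_range F Q \<and> (\<forall>l\<in>L. shift_invertible_on F l (range Q)) \<and> qdim {x. Q x = 0} {0} \<noteq> \<infinity>"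
    if "finite L" "0 \<notin> L" for L
    using that
  proof (induction L)
    case empty
    have "{x. x = 0} = {0::'a}" by auto
    then show ?case
      by (intro exI[of _ "\<lambda>x. x"]) (auto simp: commuting_range_def bop_id qdim_eq_0)
  next
    case (insert l L)
    then obtain Q where Q: "commuting_range F Q" "\<And>m. m \<in> L \<Longrightarrow> shift_invertible_on F m (range Q)"
      "qdim {x. Q x = 0} {0} \<noteq> \<infinity>" by auto
    let ?S = "shift sc F l"
    obtain p where p: "commuting_range F (\<lambda>x. (?S ^^ p) (Q x))"
      "shift_invertible_on F l (range (\<lambda>x. (?S ^^ p) (Q x)))"
      "\<And>m. shift_invertible_on F m (range Q) \<Longrightarrow> shift_invertible_on F m (range (\<lambda>x. (?S ^^ p) (Q x)))"
      using commuting_range_step[OF F Q(1) pole] by metis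
    have Qb: "bop sc Q" and Q'b: "bop sc (\<lambda>x. (?S ^^ p) (Q x))" using Q(1) p(1) by (auto simp: commuting_range_def)
    let ?A = "{x. (?S ^^ p) (Q x) = 0}"
    \<comment> \<open>The kernel of the product is finite-dimensional: \<open>Q\<close> maps it into
      the kernel of \<open>(F - l)^p\<close>, and what \<open>Q\<close> annihilates lies in its own
      kernel.\<close>
    have "qdim ?A {0} = qdim (Q ` ?A) {0} + qdim (?A \<inter> {x. Q x = 0}) {0}"
      using subspace_ker[OF Q'b] by (intro qdim_image_add_kernel bop_linear Qb)
    moreover have "qdim (Q ` ?A) {0} \<noteq> \<infinity>"
      using insert.prems by (intro qdim_finite_mono[OF fin[of l p]]) auto
    moreover have "qdim (?A \<inter> {x. Q x = 0}) {0} \<noteq> \<infinity>"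
      by (intro qdim_finite_mono[OF Q(3)]) auto
    ultimately have "qdim ?A {0} \<noteq> \<infinity>" by (metis enat_finite_le_add order_refl)
    with p Q(2) show ?case by (intro exI[of _ "\<lambda>x. (?S ^^ p) (Q x)"]) auto
  qed
  let ?\<sigma> = "{l. \<not> bij (shift sc F l)}"
  have "finite ?\<sigma>" using uniform_descent_everywhere(2)[OF F W] .
  then obtain Q where Q: "commuting_range F Q" "\<And>l. l \<in> ?\<sigma> - {0} \<Longrightarrow> shift_invertible_on F l (range Q)"
    "qdim {x. Q x = 0} {0} \<noteq> \<infinity>" using prod[of "?\<sigma> - {0}"] by auto
  obtain p where p: "commuting_range F (\<lambda>x. (shift sc F 0 ^^ p) (Q x))"
    "shift_invertible_on F 0 (range (\<lambda>x. (shift sc F 0 ^^ p) (Q x)))"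
    "\<And>m. shift_invertible_on F m (range Q) \<Longrightarrow> shift_invertible_on F m (range (\<lambda>x. (shift sc F 0 ^^ p) (Q x)))"
    using commuting_range_step[OF F Q(1) pole] by metis
  let ?Q = "\<lambda>x. (F ^^ p) (Q x)"
  have Qb: "bop sc Q" and QF: "\<And>x. Q (F x) = F (Q x)" and Q'b: "bop sc ?Q" and cl: "closed (range ?Q)"
    and Q'F: "\<And>x. ?Q (F x) = F (?Q x)"
    using Q(1) p(1) by (auto simp: commuting_range_def)
  have inv: "shift_invertible_on F l (range ?Q)" for l
  proof (cases "bij (shift sc F l)")
    case True
    then show ?thesis using shift_invertible_on_range[OF _ F] p(1) by simp
  next
    case False
    then show ?thesis using Q(2)[of l] p(2) p(3)[of l] by (cases "l = 0") simp_all
  qed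
  have FY: "F ` range ?Q \<subseteq> range ?Q"
  proof
    fix y assume "y \<in> F ` range ?Q"
    then obtain x where "y = ?Q (F x)" using Q'F by auto
    then show "y \<in> range ?Q" by blast
  qed
  have "range ?Q \<subseteq> {0}"
    using inv unfolding shift_invertible_on_def
    by (intro empty_spectrum_trivial[OF F subspace_range[OF Q'b] cl FY]) blast+
  then have "(F ^^ p) (Q x) = 0" for x by blast
  moreover have "Q ((F ^^ p) x) = (F ^^ p) (Q x)" for x using commuting_shift(2)[where Q = Q and T = F and l = 0 and p = p and x = x, OF Qb QF] by simp
  ultimately have "range (F ^^ p) \<subseteq> {x. Q x = 0}" by auto
  then have "qdim (range (F ^^ p)) {0} \<noteq> \<infinity>" by (intro qdim_finite_mono[OF Q(3)]) auto
  then have "finite_rank sc (F ^^ p)"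
    using cdim_eq[OF subspace_range_funpow[OF F]] by (simp add: finite_rank_def)
  with nfr show False by blast
qed

section \<open>Operators with infinite spectrum in the commutant\<close>

lemma cfunctional_0: "cfunctional g \<Longrightarrow> g 0 = 0"
  and cfunctional_add: "cfunctional g \<Longrightarrow> g (x + y) = g x + g y"
  and cfunctional_diff: "cfunctional g \<Longrightarrow> g (x - y) = g x - g y"
  and cfunctional_scale: "cfunctional g \<Longrightarrow> g (sc c x) = c * g x"
  by (auto simp: cfunctional_def bounded_linear.linear linear_0 linear_add linear_diff)

lemma subspace_cfunctional_ker: "cfunctional g \<Longrightarrow> subspace {x. g x = 0}"
  by (simp add: subspace_def cfunctional_0 cfunctional_add cfunctional_scale)

lemma qdim_cfunctional_ker:
  assumes A: "subspace A" and g: "cfunctional g"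
  shows "qdim A (A \<inter> {x. g x = 0}) \<noteq> \<infinity>"
proof (cases "\<exists>a\<in>A. g a \<noteq> 0")
  case True
  then obtain a where a: "a \<in> A" "g a \<noteq> 0" by blast
  have "A \<subseteq> span ((A \<inter> {x. g x = 0}) \<union> {a})"
  proof
    fix x assume x: "x \<in> A"
    let ?y = "x - sc (g x / g a) a"
    have "?y \<in> A \<inter> {x. g x = 0}"
      using x a A by (auto simp: cfunctional_diff[OF g] cfunctional_scale[OF g] intro!: subspace_diff subspace_scale)
    then have "?y + sc (g x / g a) a \<in> span ((A \<inter> {x. g x = 0}) \<union> {a})"
      by (intro span_add span_scale span_base) auto
    then show "x \<in> span ((A \<inter> {x. g x = 0}) \<union> {a})" by simp
  qed
  then have "qdim A (A \<inter> {x. g x = 0}) \<le> enat (card {a})" by (intro qdim_le) auto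
  then show ?thesis by (rule enat_finite_le_enat)
next
  case False
  then have "qdim A (A \<inter> {x. g x = 0}) = 0" by (intro qdim_eq_0) auto
  then show ?thesis by simp
qed

lemma infinite_dim_cfunctional_kers:
  assumes U: "subspace U" "qdim U {0} = \<infinity>" and "finite G" "\<And>g. g \<in> G \<Longrightarrow> cfunctional g"
  shows "subspace (U \<inter> {u. \<forall>g\<in>G. g u = 0})" "qdim (U \<inter> {u. \<forall>g\<in>G. g u = 0}) {0} = \<infinity>"
proof -
  have "subspace (U \<inter> {u. \<forall>g\<in>G. g u = 0}) \<and> qdim (U \<inter> {u. \<forall>g\<in>G. g u = 0}) {0} = \<infinity>"
    using assms(3,4)
  proof (induction G)
    case empty
    then show ?case using U by simp
  next
    case (insert g G)
    let ?A = "U \<inter> {u. \<forall>g\<in>G. g u = 0}"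
    have A: "subspace ?A" "qdim ?A {0} = \<infinity>" and g: "cfunctional g" using insert by auto
    have eq: "U \<inter> {u. \<forall>h\<in>insert g G. h u = 0} = ?A \<inter> {x. g x = 0}" by auto
    have "qdim (?A \<inter> {x. g x = 0}) {0} = \<infinity>"
      using qdim_finite_trans[OF qdim_cfunctional_ker[OF A(1) g]] A(2) by blast
    then show ?case unfolding eq using A(1) subspace_cfunctional_ker[OF g] by (simp add: subspace_inter)
  qed
  then show "subspace (U \<inter> {u. \<forall>g\<in>G. g u = 0})" "qdim (U \<inter> {u. \<forall>g\<in>G. g u = 0}) {0} = \<infinity>" by auto
qed

text \<open>The common kernel of finitely many functionals in \<open>U\<close> is still
  infinite-dimensional, so it cannot lie in \<open>C\<close> plus a finite-dimensional space,
  because \<open>U \<inter> C\<close> is finite-dimensional. That sum is closed, and Hahn-Banach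
  separates a vector \<open>u\<close> from it.\<close>

lemma biorthogonal_step:
  assumes U: "subspace U" "qdim U {0} = \<infinity>" and C: "subspace C" "closed C" and UC: "qdim (U \<inter> C) {0} \<noteq> \<infinity>"
    and P: "finite P" "\<And>p. p \<in> P \<Longrightarrow> cfunctional (snd p)"
  shows "\<exists>u f. u \<in> U \<and> (\<forall>p\<in>P. snd p u = 0) \<and> cfunctional f \<and> (\<forall>x\<in>C. f x = 0) \<and> (\<forall>p\<in>P. f (fst p) = 0) \<and> f u = (1::complex)"
proof -
  let ?A = "U \<inter> {u. \<forall>g\<in>snd ` P. g u = 0}" and ?D = "span (C \<union> fst ` P)"
  have A: "subspace ?A" "qdim ?A {0} = \<infinity>"
  proof -
    have c: "cfunctional g" if "g \<in> snd ` P" for g using that P(2) by auto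
    show "subspace ?A" "qdim ?A {0} = \<infinity>"
      using infinite_dim_cfunctional_kers[OF U finite_imageI[OF P(1)] c] by blast+
  qed
  have D: "closed ?D" using C P(1) by (intro closed_span_Un) auto
  have "\<not> ?A \<subseteq> ?D"
  proof
    assume sub: "?A \<subseteq> ?D"
    have "?A \<subseteq> span (C \<union> fst ` P)" using sub .
    then have "qdim ?A C \<le> enat (card (fst ` P))" using P(1) by (intro qdim_le) auto
    then have "qdim ?A (?A \<inter> C) \<noteq> \<infinity>" using qdim_Int[OF A(1) C(1)] enat_finite_le_enat by simp
    moreover have "qdim (?A \<inter> C) {0} \<noteq> \<infinity>" by (intro qdim_finite_mono[OF UC]) auto
    ultimately show False using qdim_finite_trans A(2) by blast
  qed
  then obtain u where u: "u \<in> ?A" "u \<notin> ?D" by blast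
  obtain f where f: "cfunctional f" "\<And>m. m \<in> ?D \<Longrightarrow> f m = 0" "f u = 1"
    using hahn_banach_separation[OF subspace_span D u(2)] by blast
  have "f x = 0" if "x \<in> C \<union> fst ` P" for x using that by (intro f(2) span_base)
  then show ?thesis using u(1) f(1,3) by (intro exI[of _ u] exI[of _ f]) auto
qed

lemma biorthogonal_sequence:
  assumes U: "subspace U" "qdim U {0} = \<infinity>" and C: "subspace C" "closed C" and UC: "qdim (U \<inter> C) {0} \<noteq> \<infinity>"
  obtains u f where "\<And>n::nat. u n \<in> U" "\<And>n. cfunctional (f n)" "\<And>n x. x \<in> C \<Longrightarrow> f n x = 0"
    "\<And>m n. f m (u n) = (if m = n then 1 else 0 :: complex)"
proof -
  define Q where "Q P p \<longleftrightarrow> fst p \<in> U \<and> (\<forall>p'\<in>P. snd p' (fst p) = 0) \<and> cfunctional (snd p) \<and> (\<forall>x\<in>C. snd p x = 0)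
    \<and> (\<forall>p'\<in>P. snd p (fst p') = 0) \<and> snd p (fst p) = 1" for P :: "('a \<times> ('a \<Rightarrow> complex)) set" and p
  have ex: "\<exists>p. Q P p" if "finite P" "\<And>p. p \<in> P \<Longrightarrow> cfunctional (snd p)" for P
  proof -
    note P = that
    obtain u f where "u \<in> U" "\<forall>p\<in>P. snd p u = 0" "cfunctional f" "\<forall>x\<in>C. f x = 0"
      "\<forall>p\<in>P. f (fst p) = 0" "f u = (1::complex)"
      using biorthogonal_step[OF U C UC P] by blast
    then have "Q P (u, f)" unfolding Q_def by simp
    then show ?thesis by blast
  qed
  define e where "e P = (SOME p. Q P p)" for P
  \<comment> \<open>\<open>S n\<close> holds the first \<open>n\<close> pairs. \<open>Q\<close>
    constrains both components of a new pair against all earlier ones, which gives the zeros on both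
    sides of the diagonal.\<close>
  define S where "S = rec_nat {} (\<lambda>_ P. insert (e P) P)"
  have S: "S 0 = {}" "S (Suc n) = insert (e (S n)) (S n)" for n by (simp_all add: S_def)
  have Sf: "finite (S n) \<and> (\<forall>p\<in>S n. cfunctional (snd p))" for n
  proof (induction n)
    case (Suc n)
    then have "\<exists>p. Q (S n) p" by (intro ex) auto
    then have "Q (S n) (e (S n))" unfolding e_def by (rule someI_ex)
    then have "cfunctional (snd (e (S n)))" by (simp add: Q_def)
    with Suc show ?case by (simp add: S)
  qed (simp add: S)
  have Qe: "Q (S n) (e (S n))" for n
  proof -
    have "\<exists>p. Q (S n) p" using Sf[of n] by (intro ex) auto
    then show ?thesis unfolding e_def by (rule someI_ex)
  qed
  have inS: "e (S m) \<in> S n" if "m < n" for m n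
    using that by (induction n) (auto simp: S less_Suc_eq)
  show ?thesis
  proof
    show "fst (e (S n)) \<in> U" "cfunctional (snd (e (S n)))" for n using Qe[of n] by (auto simp: Q_def)
    show "snd (e (S n)) x = 0" if "x \<in> C" for n x using Qe[of n] that by (auto simp: Q_def)
    show "snd (e (S m)) (fst (e (S n))) = (if m = n then 1 else 0)" for m n
    proof -
      consider "m = n" | "m < n" | "n < m" by linarith
      then show ?thesis
        using Qe[of m] Qe[of n] inS[of m n] inS[of n m] by cases (auto simp: Q_def)
    qed
  qed
qed

lemma bop_suminf:
  assumes A: "\<And>n. bop sc (A n)" and b: "\<And>n x. norm (A n x) \<le> (1 / 2) ^ n * norm x"
  shows "bop sc (\<lambda>x. \<Sum>n. A n x)" "\<And>x. summable (\<lambda>n. A n x)"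
proof -
  have geo: "(\<lambda>n. (1 / 2) ^ n * norm x) sums (2 * norm x)" for x :: 'a
    using sums_mult2[OF geometric_sums[of "1/2::real"], of "norm x"] by simp
  have sn: "summable (\<lambda>n. norm (A n x))" for x
    using b by (intro summable_comparison_test[OF _ sums_summable[OF geo[of x]]]) auto
  show s: "summable (\<lambda>n. A n x)" for x using sn by (rule summable_norm_cancel)
  show "bop sc (\<lambda>x. \<Sum>n. A n x)"
    unfolding bop_def
  proof
    show "bounded_linear (\<lambda>x. \<Sum>n. A n x)"
    proof (rule bounded_linear_intro)
      show "(\<Sum>n. A n (x + y)) = (\<Sum>n. A n x) + (\<Sum>n. A n y)" for x y
        using suminf_add[OF s s] by (simp add: bop_add[OF A])
      show "(\<Sum>n. A n (r *\<^sub>R x)) = r *\<^sub>R (\<Sum>n. A n x)" for r x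
        using suminf_scaleR_right[OF s, of r x] by (simp add: sc_of_real[symmetric] bop_scale[OF A])
      show "norm (\<Sum>n. A n x) \<le> norm x * 2" for x
      proof -
        have "norm (\<Sum>n. A n x) \<le> (\<Sum>n. norm (A n x))" using sn by (rule summable_norm)
        also have "\<dots> \<le> (\<Sum>n. (1 / 2) ^ n * norm x)"
          using sn b sums_summable[OF geo[of x]] by (intro suminf_le) auto
        also have "\<dots> = 2 * norm x" using geo by (rule sums_unique[symmetric])
        finally show ?thesis by simp
      qed
    qed
    show "\<forall>c x. (\<Sum>n. A n (sc c x)) = sc c (\<Sum>n. A n x)"
      using bounded_linear.suminf[OF bounded_bilinear.bounded_linear_right[OF bounded_bilinear_sc] s]
      by (simp add: bop_scale[OF A])
  qed
qed

text \<open>The operator \<open>\<Sum>\<^sub>i N^i (x \<otimes> f) N^(q-i)\<close> commutes with \<open>N\<close> as soon as \<open>x\<close> is killed by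
  \<open>N^(q+1)\<close> and \<open>f\<close> vanishes on the range of \<open>N^(q+1)\<close>.\<close>
definition jordan_op :: "('a \<Rightarrow> 'a) \<Rightarrow> nat \<Rightarrow> 'a \<Rightarrow> ('a \<Rightarrow> complex) \<Rightarrow> 'a \<Rightarrow> 'a" where
  "jordan_op N q x f y = (\<Sum>i\<le>q. sc (f ((N ^^ (q - i)) y)) ((N ^^ i) x))"

lemma bop_sum_fun: "(\<And>i. bop sc (g i)) \<Longrightarrow> bop sc (\<lambda>y. \<Sum>i\<le>(q::nat). g i y)"
  by (induction q) (auto intro: bop_plus)

lemma bop_jordan_op:
  assumes N: "bop sc N" and f: "cfunctional f" shows "bop sc (jordan_op N q x f)"
proof -
  have "bop sc (\<lambda>y. sc (f ((N ^^ (q - i)) y)) ((N ^^ i) x))" for i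
    unfolding bop_def
  proof
    have "bounded_linear (\<lambda>y. f ((N ^^ (q - i)) y))"
      using f bop_bounded_linear[OF bop_funpow[OF N]] by (auto simp: cfunctional_def intro: bounded_linear_compose)
    then show "bounded_linear (\<lambda>y. sc (f ((N ^^ (q - i)) y)) ((N ^^ i) x))"
      by (rule bounded_linear_compose[OF bounded_bilinear.bounded_linear_left[OF bounded_bilinear_sc]])
  qed (simp add: bop_scale[OF bop_funpow[OF N]] cfunctional_scale[OF f])
  then show ?thesis unfolding jordan_op_def by (rule bop_sum_fun)
qed

lemma jordan_op_commute:
  assumes N: "bop sc N" and x: "(N ^^ Suc q) x = 0" and f: "\<And>y. f ((N ^^ Suc q) y) = 0"
  shows "jordan_op N q x f (N y) = N (jordan_op N q x f y)"
proof -
  have "jordan_op N q x f (N y) = (\<Sum>i\<le>q. sc (f ((N ^^ (Suc q - i)) y)) ((N ^^ i) x))"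
    unfolding jordan_op_def by (intro sum.cong) (auto simp: Suc_diff_le funpow_swap1)
  \<comment> \<open>The extra term vanishes because \<open>N^(q+1)\<close> kills \<open>x\<close>;
    after the index shift the term for 0 vanishes because \<open>f\<close> kills the range of
    \<open>N^(q+1)\<close>.\<close>
  also have "\<dots> = (\<Sum>i\<le>Suc q. sc (f ((N ^^ (Suc q - i)) y)) ((N ^^ i) x))"
    using x by (simp del: funpow.simps)
  also have "\<dots> = sc (f ((N ^^ Suc q) y)) x + (\<Sum>i\<le>q. sc (f ((N ^^ (q - i)) y)) ((N ^^ Suc i) x))"
    by (subst sum.atMost_Suc_shift) simp
  also have "\<dots> = N (jordan_op N q x f y)"
    using f unfolding jordan_op_def by (simp add: bop_sum[OF N] bop_scale[OF N])
  finally show ?thesis .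
qed

lemma jordan_op_range:
  assumes f: "\<And>y. f ((N ^^ Suc q) y) = 0"
  shows "jordan_op N q x f ((N ^^ Suc q) y) = 0"
proof -
  have "f ((N ^^ k) ((N ^^ Suc q) y)) = 0" for k
    using f[of "(N ^^ k) y"] by (metis add.commute comp_apply funpow_add)
  then show ?thesis unfolding jordan_op_def by (simp del: funpow.simps)
qed

text \<open>In each term with \<open>i < q\<close> the functional is applied to
  \<open>N^(2 q - i) z\<close>, where the exponent is at least \<open>q + 1\<close>, so only
  \<open>i = q\<close> survives. If \<open>f\<close> is 1 on \<open>N^q x\<close>, the choice
  \<open>z = x\<close> makes that vector an eigenvector for 1.\<close>

lemma jordan_op_eigenvector:
  assumes N: "bop sc N" and f: "cfunctional f" and z: "(N ^^ Suc q) z = 0"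
  shows "jordan_op N q x f ((N ^^ q) z) = sc (f ((N ^^ q) z)) ((N ^^ q) x)"
proof -
  have "f ((N ^^ (q - i)) ((N ^^ q) z)) = 0" if "i < q" for i
  proof -
    have "(N ^^ (q - i)) ((N ^^ q) z) = (N ^^ (q - i - 1)) ((N ^^ Suc q) z)"
    proof -
      have "q - i + q = (q - i - 1) + Suc q" using that by simp
      then show ?thesis by (metis comp_apply funpow_add)
    qed
    also have "\<dots> = 0" using z bop_0[OF bop_funpow[OF N]] by (simp del: funpow.simps)
    finally show ?thesis using cfunctional_0[OF f] by simp
  qed
  then have "(\<Sum>i<q. sc (f ((N ^^ (q - i)) ((N ^^ q) z))) ((N ^^ i) x)) = 0" by (intro sum.neutral) simp
  then show ?thesis unfolding jordan_op_def lessThan_Suc_atMost[symmetric] by simp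
qed

text \<open>A weighted sum of the operators \<open>J n\<close> has each \<open>u n\<close> as
  eigenvector for the weight \<open>a n\<close>, because biorthogonality removes the other
  terms.\<close>

theorem infinite_spectrum_commuting:
  assumes N: "bop sc N" and U: "subspace U" "qdim U {0} = \<infinity>"
    and UN: "U = (N ^^ q) ` {x. (N ^^ Suc q) x = 0}"
    and C: "closed (range (N ^^ Suc q))" "qdim (U \<inter> range (N ^^ Suc q)) {0} \<noteq> \<infinity>"
  obtains T where "bop sc T" "\<And>x. T (N x) = N (T x)" "\<And>x. T ((N ^^ Suc q) x) = 0"
    "infinite {l. \<not> bij (shift sc T l)}"
proof -
  obtain u f where u: "\<And>n::nat. u n \<in> U" and f: "\<And>n. cfunctional (f n)"
    and fC: "\<And>n x. x \<in> range (N ^^ Suc q) \<Longrightarrow> f n x = 0"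
    and fu: "\<And>m n. f m (u n) = (if m = n then 1 else 0 :: complex)"
    using biorthogonal_sequence[OF U subspace_range_funpow[OF N] C] by blast
  have "\<exists>x. (N ^^ Suc q) x = 0 \<and> u n = (N ^^ q) x" for n using u[of n] unfolding UN by blast
  then obtain x where x: "\<And>n. (N ^^ Suc q) (x n) = 0" "\<And>n. u n = (N ^^ q) (x n)" by metis
  define J where "J n = jordan_op N q (x n) (f n)" for n
  have J: "bop sc (J n)" for n unfolding J_def using N f by (rule bop_jordan_op)
  have f0: "f n ((N ^^ Suc q) y) = 0" for n y using fC by blast
  have JN: "J n (N y) = N (J n y)" for n y unfolding J_def using N x(1) f0 by (rule jordan_op_commute)
  have JR: "J n ((N ^^ Suc q) y) = 0" for n y unfolding J_def using f0 by (rule jordan_op_range)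
  have Ju: "J m (u n) = (if m = n then u n else 0)" for m n
    using jordan_op_eigenvector[OF N f[of m] x(1)[of n], of "x m"] fu[of m n] x(2) by (auto simp: J_def)
  have "\<exists>B>0. \<forall>y. norm (J n y) \<le> norm y * B" for n
    using bounded_linear.pos_bounded[OF bop_bounded_linear[OF J]] by blast
  then obtain B where B: "\<And>n. B n > 0" "\<And>n y. norm (J n y) \<le> norm y * B n" by metis
  \<comment> \<open>Equal to \<open>(1 / 2)^n / (B n + 1)\<close>: small enough both to make the
    series of operators converge and to send the eigenvalues to 0.\<close>
  define a where "a n = (1 / 2) ^ n / B n / (1 + 1 / B n)" for n
  have a: "a n > 0" "a n \<le> (1 / 2) ^ n" "a n * B n \<le> (1 / 2) ^ n" for n
  proof -
    have e: "a n = (1 / 2) ^ n / (B n + 1)" using B(1)[of n] by (simp add: a_def field_simps)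
    show "a n > 0" unfolding e using B(1)[of n] by simp
    show "a n \<le> (1 / 2) ^ n" unfolding e using B(1)[of n] by (simp add: divide_le_eq)
    show "a n * B n \<le> (1 / 2) ^ n" unfolding e using B(1)[of n] by (simp add: divide_le_eq)
  qed
  define A where "A n y = sc (of_real (a n)) (J n y)" for n y
  have A: "bop sc (A n)" for n unfolding A_def using J by (rule bop_sc)
  have Ab: "norm (A n y) \<le> (1 / 2) ^ n * norm y" for n y
  proof -
    have "norm (A n y) \<le> a n * (norm y * B n)"
      unfolding A_def using a(1)[of n] B(2)[of n y] by (simp add: mult_left_mono)
    also have "\<dots> = (a n * B n) * norm y" by simp
    also have "\<dots> \<le> (1 / 2) ^ n * norm y" using a(3) by (rule mult_right_mono) simp
    finally show ?thesis .
  qed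
  define T where "T y = (\<Sum>n. A n y)" for y
  have T: "bop sc T" and s: "\<And>y. summable (\<lambda>n. A n y)"
    using bop_suminf[of A, OF A Ab] by (auto simp: T_def[abs_def])
  have Tu: "T (u n) = sc (of_real (a n)) (u n)" for n
  proof -
    have "T (u n) = (\<Sum>m\<in>{n}. A m (u n))" unfolding T_def by (rule suminf_finite) (auto simp: A_def Ju)
    then show ?thesis by (simp add: A_def Ju)
  qed
  show ?thesis
  proof
    show "bop sc T" by fact
    show "T (N y) = N (T y)" for y
    proof -
      have "N (T y) = (\<Sum>n. N (A n y))" unfolding T_def
        using bounded_linear.suminf[OF bop_bounded_linear[OF N] s] by simp
      also have "\<dots> = T (N y)" unfolding T_def A_def by (simp add: JN bop_scale[OF N])
      finally show ?thesis by simp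
    qed
    show "T ((N ^^ Suc q) y) = 0" for y unfolding T_def A_def by (simp add: JR del: funpow.simps)
    have ev: "complex_of_real (a n) \<in> {l. \<not> bij (shift sc T l)}" for n
    proof -
      have "u n \<noteq> 0" using fu[of n n] cfunctional_0[OF f, of n] by auto
      then show ?thesis using bij_shift_imp(1)[OF T _ Tu] by blast
    qed
    \<comment> \<open>Positive weights with infimum 0 take infinitely many values.\<close>
    have "infinite (range a)"
    proof
      assume fin: "finite (range a)"
      have "Min (range a) > 0" using fin a(1) by (subst Min_gr_iff) auto
      then obtain n where "(1 / 2) ^ n < Min (range a)" using real_arch_pow_inv[of _ "1 / 2"] by auto
      moreover have "Min (range a) \<le> a n" using fin by simp
      ultimately show False using a(2)[of n] by linarith
    qed
    then have "infinite (complex_of_real ` range a)" by (subst finite_image_iff) (auto simp: inj_on_def)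
    then show "infinite {l. \<not> bij (shift sc T l)}" by (rule infinite_super[rotated]) (use ev in auto)
  qed
qed

section \<open>Poles, the spectral properties and uniform descent\<close>

lemma pole_imp_spec_prop:
  assumes T: "bop sc T" and p: "pole T" shows "spec_prop sc k T"
proof -
  obtain p where p': "range (T ^^ p) = range (T ^^ Suc p)" "{x. T x = 0} \<inter> range (T ^^ p) \<subseteq> {0}"
    "{x. (T ^^ p) x = 0} = {x. (T ^^ Suc p) x = 0}" "closed (range (T ^^ p))"
    using poleE[OF T p] by metis
  have n0: "nul T p = 0" unfolding nul_def using p'(2) by (rule qdim_eq_0)
  have c0: "cod T p = 0" unfolding cod_def p'(1)[symmetric] by (simp add: qdim_eq_0)
  have u: "upper_at T p" and l: "lower_at T p"
    using p'(4) p'(1)[symmetric] n0 c0 unfolding upper_at_def lower_at_def nul_def cod_def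
    by (simp_all del: funpow.simps)
  note iffs = dsc_iff dsc_e_iff[OF T] upper_sbf_iff[OF T] lower_sbf_iff[OF T] b_fredholm_iff[OF T]
    upper_sbw_iff[OF T] lower_sbw_iff[OF T] b_weyl_iff[OF T] upper_sbb_iff[OF T] lower_sbb_iff[OF T]
    b_browder_iff[OF T]
  have e: "cod T p \<noteq> \<infinity>" using c0 by simp
  have w: "nul T p = cod T p" "nul T p \<le> cod T p" "cod T p \<le> nul T p" using n0 c0 by simp_all
  show ?thesis
    by (cases k; simp only: spec_prop.simps iffs; use p'(1,3) u l e w p in blast)
qed

text \<open>Every property yields an upper semi-Fredholm level or a finite codimension between two
  consecutive ranges.\<close>

lemma spec_prop_imp_uniform_descent:
  assumes T: "bop sc T" and s: "spec_prop sc k T" shows "uniform_descent T"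
proof -
  have u: "uniform_descent T" if "\<exists>n. upper_at T n" using that upper_at_uniform_descent[OF T] by blast
  have c: "uniform_descent T" if "\<exists>n. cod T n \<noteq> \<infinity>" using that cod_uniform_descent[OF T] by blast
  have l: "uniform_descent T" if "\<exists>n. lower_at T n" using that c lower_at_cod by blast
  have d: "uniform_descent T" if "\<exists>q. range (T ^^ q) = range (T ^^ Suc q)"
  proof -
    from that obtain q where q: "range (T ^^ q) = range (T ^^ Suc q)" by blast
    have "cod T q = 0" unfolding cod_def q[symmetric] by (simp add: qdim_eq_0)
    then show ?thesis using c by (metis infinity_ne_i0)
  qed
  note iffs = dsc_iff dsc_e_iff[OF T] upper_sbf_iff[OF T] lower_sbf_iff[OF T] b_fredholm_iff[OF T]
    upper_sbw_iff[OF T] lower_sbw_iff[OF T] b_weyl_iff[OF T] upper_sbb_iff[OF T] lower_sbb_iff[OF T]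
    b_browder_iff[OF T] pole_def
  show ?thesis using s
    by (cases k; simp only: spec_prop.simps iffs; use u c l d in blast)
qed

lemma infinite_dim_level:
  assumes "qdim (V 0) {0} = \<infinity>" "qdim (V p) {0} \<noteq> \<infinity>"
  obtains q where "q < p" "qdim (V q) {0} = \<infinity>" "qdim (V (Suc q)) {0} \<noteq> \<infinity>"
proof -
  define m where "m = (LEAST k. qdim (V k) {0} \<noteq> \<infinity>)"
  have m: "qdim (V m) {0} \<noteq> \<infinity>" unfolding m_def using assms(2) by (rule LeastI)
  have mp: "m \<le> p" unfolding m_def using assms(2) by (rule Least_le)
  from m assms(1) obtain q where q: "m = Suc q" by (metis not0_implies_Suc)
  have "\<not> qdim (V q) {0} \<noteq> \<infinity>"
    using not_less_Least[of q "\<lambda>k. qdim (V k) {0} \<noteq> \<infinity>", folded m_def] q by simp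
  with that[of q] m mp q show ?thesis by simp
qed

text \<open>The level \<open>q\<close> is the last at which \<open>N^q Z\<close> is
  infinite-dimensional. There \<open>U\<close> is still infinite-dimensional, while its intersection
  with \<open>R(N^(q+1))\<close> lies in the finite-dimensional \<open>N^(q+1) Z\<close>; this
  leaves enough functionals vanishing on that range.\<close>

lemma commuting_infinite_spectrum:
  assumes N: "bop sc N" and pole: "pole N" and inf: "qdim {x. (N ^^ n) x = 0} {0} = \<infinity>"
  obtains T p where "bop sc T" "\<And>x. T (N x) = N (T x)" "\<And>x. T ((N ^^ p) x) = 0"
    "infinite {l. \<not> bij (shift sc T l)}" "{x. N x = 0} \<inter> range (N ^^ p) \<subseteq> {0}"
    "range (N ^^ p) = range (N ^^ Suc p)"
proof -
  obtain p where p: "range (N ^^ p) = range (N ^^ Suc p)" "{x. N x = 0} \<inter> range (N ^^ p) \<subseteq> {0}"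
    "{x. (N ^^ p) x = 0} = {x. (N ^^ Suc p) x = 0}" "closed (range (N ^^ p))"
    using poleE[OF N pole] by metis
  have Nb: "bop sc (N ^^ k)" for k using N by (rule bop_funpow)
  let ?Z = "{x. (N ^^ p) x = 0}" and ?M = "range (N ^^ p)"
  have Z: "subspace ?Z" using Nb by (rule subspace_ker)
  have M: "subspace ?M" using Nb by (rule subspace_range)
  have st: "(N ^^ p) ` UNIV = (N ^^ Suc p) ` UNIV" using p(1) .
  have dec: "UNIV = {(N ^^ p) x + z | x z. x \<in> UNIV \<and> z \<in> ?Z \<inter> UNIV}" and ZM: "?M \<inter> ?Z \<subseteq> {0}"
    using closed_stable_image(2,3)[OF N subspace_UNIV closed_UNIV _ st] p(2) by auto
  have Zinf: "qdim ?Z {0} = \<infinity>"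
  proof -
    have "{x. (N ^^ n) x = 0} \<subseteq> ?Z"
    proof (cases "n \<le> p")
      case True then show ?thesis by (rule ker_funpow_mono[OF N])
    next
      case False then show ?thesis using ker_stable[OF p(3), of n] by simp
    qed
    then show ?thesis using qdim_finite_mono[of ?Z "{0}" _ "{0}"] inf by blast
  qed
  define V where "V k = (N ^^ k) ` ?Z" for k
  have V: "subspace (V k)" for k unfolding V_def using Nb Z by (rule subspace_image)
  have "qdim (V p) {0} = 0" unfolding V_def by (intro qdim_eq_0) auto
  then have "qdim (V p) {0} \<noteq> \<infinity>" by simp
  moreover have "qdim (V 0) {0} = \<infinity>" using Zinf by (simp add: V_def)
  ultimately obtain q where q: "q < p" "qdim (V q) {0} = \<infinity>" "qdim (V (Suc q)) {0} \<noteq> \<infinity>"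
    using infinite_dim_level[of V p] by blast
  define U where "U = (N ^^ q) ` {x. (N ^^ Suc q) x = 0}"
  have U: "subspace U" unfolding U_def using Nb subspace_ker[OF Nb] by (rule subspace_image)
  have Uinf: "qdim U {0} = \<infinity>"
  proof -
    have "qdim (V q) {0} = qdim (N ` V q) {0} + qdim (V q \<inter> {x. N x = 0}) {0}"
      using bop_linear[OF N] V by (rule qdim_image_add_kernel)
    moreover have "N ` V q = V (Suc q)" by (simp add: V_def image_comp)
    ultimately have "qdim (V q \<inter> {x. N x = 0}) {0} = \<infinity>"
      using q(2,3) by (metis enat_finite_le_add order_refl)
    moreover have "V q \<inter> {x. N x = 0} \<subseteq> U" by (auto simp: V_def U_def)
    ultimately show ?thesis using qdim_finite_mono[of U "{0}" _ "{0}"] by blast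
  qed
  let ?C = "range (N ^^ Suc q)"
  have C: "subspace ?C" using Nb by (rule subspace_range)
  have NZ: "(N ^^ k) z \<in> ?Z" if "z \<in> ?Z" for k z
  proof -
    have "(N ^^ p) ((N ^^ k) z) = (N ^^ k) ((N ^^ p) z)" by (metis add.commute comp_apply funpow_add)
    then show ?thesis using that bop_0[OF Nb] by simp
  qed
  have MC: "?M \<subseteq> ?C" using q(1) by (intro range_funpow_antimono) simp
  have split: "\<exists>v\<in>V (Suc q). \<exists>m\<in>?M. c = m + v" if "c \<in> ?C" for c
  proof -
    from that obtain y where y: "c = (N ^^ Suc q) y" by blast
    have "y \<in> {(N ^^ p) x + z | x z. x \<in> UNIV \<and> z \<in> ?Z \<inter> UNIV}" using dec by blast
    then obtain x z where xz: "y = (N ^^ p) x + z" "z \<in> ?Z" by blast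
    have "(N ^^ Suc q) ((N ^^ p) x) = (N ^^ p) ((N ^^ Suc q) x)" by (metis add.commute comp_apply funpow_add)
    then have "c = (N ^^ p) ((N ^^ Suc q) x) + (N ^^ Suc q) z"
      unfolding y xz(1) by (simp add: bop_add[OF Nb] del: funpow.simps)
    then show ?thesis using xz(2) unfolding V_def by blast
  qed
  \<comment> \<open>The range \<open>?C\<close> is not given as closed; it is a finite-dimensional
    extension of the closed space \<open>?M\<close>.\<close>
  have "qdim ?C ?M \<le> qdim (V (Suc q)) {0}"
    using split V by (intro qdim_sum_le) blast+
  then have "qdim ?C ?M \<noteq> \<infinity>" using q(3) by (rule enat_finite_le)
  then have Cc: "closed ?C" using M p(4) C MC by (intro closed_finite_extension[of ?M ?C])
  have "U \<inter> ?C \<subseteq> V (Suc q)"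
  proof
    fix w assume w: "w \<in> U \<inter> ?C"
    then obtain v m where vm: "v \<in> V (Suc q)" "m \<in> ?M" "w = m + v" using split by blast
    have "w \<in> ?Z"
    proof -
      from w obtain x where "w = (N ^^ q) x" "(N ^^ Suc q) x = 0" by (auto simp: U_def)
      then have "(N ^^ 1) w = 0" by simp
      then show ?thesis using ker_funpow_mono[OF N, of 1 p] q(1) by auto
    qed
    moreover have "v \<in> ?Z" using vm(1) NZ unfolding V_def by blast
    ultimately have "w - v \<in> ?Z" by (rule subspace_diff[OF Z])
    then have "m = 0" using vm ZM by auto
    with vm show "w \<in> V (Suc q)" by simp
  qed
  then have UC: "qdim (U \<inter> ?C) {0} \<noteq> \<infinity>" by (intro qdim_finite_mono[OF q(3)]) auto
  obtain T where T: "bop sc T" "\<And>x. T (N x) = N (T x)" "\<And>x. T ((N ^^ Suc q) x) = 0"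
    "infinite {l. \<not> bij (shift sc T l)}"
    using infinite_spectrum_commuting[OF N U Uinf U_def Cc UC] by blast
  have "T ((N ^^ p) x) = 0" for x
  proof -
    have "(N ^^ p) x \<in> ?C" using MC by blast
    then show ?thesis using T(3) by auto
  qed
  then show ?thesis using that T p by blast
qed

lemma pole_scaled_shift:
  assumes F: "bop sc F" and pole: "\<And>l. pole (shift sc F l)" and m: "m \<noteq> 0"
  shows "pole (\<lambda>x. sc m (F x) - sc \<mu> x)"
proof -
  let ?S = "shift sc F (\<mu> / m)"
  have S: "bop sc (?S ^^ k)" for k using F by (intro bop_funpow bop_shift)
  have e: "(\<lambda>x. sc m (F x) - sc \<mu> x) = (\<lambda>x. sc m (?S x))"
    using m by (auto simp: shift_def scale_right_diff_distrib)
  have p: "((\<lambda>x. sc m (?S x)) ^^ k) x = sc (m ^ k) ((?S ^^ k) x)" for k x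
    by (induction k) (simp_all add: bop_scale[OF bop_shift[OF F]])
  have r: "range ((\<lambda>x. sc m (?S x)) ^^ k) = range (?S ^^ k)" for k
  proof
    show "range ((\<lambda>x. sc m (?S x)) ^^ k) \<subseteq> range (?S ^^ k)"
      unfolding p using subspace_scale[OF subspace_range[OF S]] by blast
    show "range (?S ^^ k) \<subseteq> range ((\<lambda>x. sc m (?S x)) ^^ k)"
    proof
      fix y assume "y \<in> range (?S ^^ k)"
      then obtain x where "y = (?S ^^ k) x" by blast
      then have "y = sc (m ^ k) ((?S ^^ k) (sc (1 / m ^ k) x))" using m by (simp add: bop_scale[OF S])
      then show "y \<in> range ((\<lambda>x. sc m (?S x)) ^^ k)" unfolding p[symmetric] by blast
    qed
  qed
  have n: "{x. ((\<lambda>x. sc m (?S x)) ^^ k) x = 0} = {x. (?S ^^ k) x = 0}" for k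
    unfolding p using m by simp
  show ?thesis using pole[of "\<mu> / m"] unfolding e pole_def r n .
qed

text \<open>On \<open>range Q\<close> the operator \<open>V\<close> is \<open>A\<close>; on the
  complement \<open>Z\<close> it is bijective. A bijective summand leaves the stationarity of ranges
  and kernels untouched.\<close>

lemma pole_decompose:
  assumes V: "bop sc V" and A: "bop sc A" "pole A" and Q: "bop sc Q" "\<And>x. Q (A x) = A (Q x)"
    and Z: "subspace Z" and VZ: "V ` Z = Z" "\<And>z. z \<in> Z \<Longrightarrow> V z = 0 \<Longrightarrow> z = 0"
    and VA: "\<And>x. V (Q x) = A (Q x)"
    and dec: "\<And>x. \<exists>y z. z \<in> Z \<and> x = Q y + z" and int: "range Q \<inter> Z \<subseteq> {0}"
  shows "pole V"
proof -
  obtain r where r: "range (A ^^ r) = range (A ^^ Suc r)" "{x. (A ^^ r) x = 0} = {x. (A ^^ Suc r) x = 0}"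
    using poleE[OF A] by metis
  have Ak: "(A ^^ k) (Q x) = Q ((A ^^ k) x)" for k x using Q(2) by (simp add: funpow_commute)
  have Vk: "(V ^^ k) (Q x) = Q ((A ^^ k) x)" for k x
  proof (induction k)
    case (Suc k)
    then show ?case using VA[of "(A ^^ k) x"] Q(2) by simp
  qed simp
  have VkZ: "(V ^^ k) ` Z = Z" for k
  proof (induction k)
    case (Suc k)
    have "(V ^^ Suc k) ` Z = V ` (V ^^ k) ` Z" by (simp only: funpow.simps image_comp[symmetric])
    then show ?case by (simp only: Suc VZ(1))
  qed simp
  have Vb: "bop sc (V ^^ k)" for k using V by (rule bop_funpow)
  have inj: "z = 0" if "z \<in> Z" "(V ^^ k) z = 0" for z k
    using that
  proof (induction k)
    case (Suc k)
    have "(V ^^ k) z \<in> Z" using VkZ Suc.prems(1) by blast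
    then have "(V ^^ k) z = 0" by (rule VZ(2)) (use Suc.prems(2) in simp)
    with Suc show ?case by blast
  qed simp
  have sub: "range (V ^^ r) \<subseteq> range (V ^^ Suc r)"
  proof
    fix w assume "w \<in> range (V ^^ r)"
    then obtain x where x: "w = (V ^^ r) x" by blast
    obtain y z where yz: "z \<in> Z" "x = Q y + z" using dec by blast
    obtain z' where z': "z = V z'" using yz(1) VZ(1) by (metis imageE)
    obtain y' where y': "(A ^^ r) y = (A ^^ Suc r) y'" using r(1) by (metis rangeE rangeI)
    have "w = Q ((A ^^ r) y) + (V ^^ r) (V z')" unfolding x yz(2) z' by (simp add: bop_add[OF Vb] Vk)
    also have "Q ((A ^^ r) y) = (V ^^ Suc r) (Q y')" unfolding y' by (rule Vk[symmetric])
    also have "(V ^^ r) (V z') = (V ^^ Suc r) z'" by (simp add: funpow_swap1)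
    also have "(V ^^ Suc r) (Q y') + (V ^^ Suc r) z' = (V ^^ Suc r) (Q y' + z')" by (rule bop_add[OF Vb, symmetric])
    finally show "w \<in> range (V ^^ Suc r)" by blast
  qed
  have "range (V ^^ r) = range (V ^^ Suc r)"
    using sub range_funpow_antimono[of r "Suc r" V] by (simp del: funpow.simps)
  moreover have "(V ^^ r) x = 0" if x: "(V ^^ Suc r) x = 0" for x
  proof -
    obtain y z where yz: "z \<in> Z" "x = Q y + z" using dec by blast
    have e: "Q ((A ^^ Suc r) y) + (V ^^ Suc r) z = 0"
      using x unfolding yz(2) by (simp only: bop_add[OF Vb] Vk)
    have vz: "(V ^^ Suc r) z \<in> Z" using VkZ yz(1) by blast
    have "Q ((A ^^ Suc r) y) = - (V ^^ Suc r) z" using e by (simp only: eq_neg_iff_add_eq_0)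
    then have "Q ((A ^^ Suc r) y) \<in> range Q \<inter> Z" using subspace_neg[OF Z vz] by (metis IntI rangeI)
    then have q0: "Q ((A ^^ Suc r) y) = 0" using int by blast
    then have "(V ^^ Suc r) z = 0" using e by (simp del: funpow.simps)
    then have z0: "z = 0" using inj[OF yz(1)] by blast
    have "(A ^^ Suc r) (Q y) = 0" using q0 Ak by (simp del: funpow.simps)
    then have "(A ^^ r) (Q y) = 0" using r(2) by blast
    then show ?thesis unfolding yz(2) z0 using Vk Ak by simp
  qed
  then have "{x. (V ^^ r) x = 0} = {x. (V ^^ Suc r) x = 0}"
    using ker_funpow_mono[OF V, of r "Suc r"] by (auto simp del: funpow.simps)
  ultimately show ?thesis unfolding pole_def by blast
qed

text \<open>On the kernel of \<open>B^p\<close>, the bijective operator \<open>(V + B)^(1 + p)\<close> is a multiple of \<open>V\<close>.\<close>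
lemma nilpotent_perturbation_bijective:
  assumes V: "bop sc V" and B: "bop sc B" and comm: "\<And>x. V (B x) = B (V x)"
    and D: "bij (\<lambda>x. V x + B x)"
  shows "V ` {x. (B ^^ p) x = 0} = {x. (B ^^ p) x = 0}"
    and "(B ^^ p) z = 0 \<Longrightarrow> V z = 0 \<Longrightarrow> z = 0"
proof -
  let ?D = "\<lambda>x. V x + B x" and ?Z = "{x. (B ^^ p) x = 0}"
  have Db: "bop sc ?D" using V B by (rule bop_plus)
  obtain G H where GH: "opalg V B G" "opalg V B H"
    "\<And>x. (?D ^^ (1 + p)) x = (V ^^ 1) (G x) + (B ^^ p) (H x)"
    using funpow_add_factor[OF V B comm, of 1 p] by blast
  have Bp: "bop sc (B ^^ k)" for k using B by (rule bop_funpow)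
  have VB: "(B ^^ p) (V x) = V ((B ^^ p) x)" for x using comm by (intro funpow_commute) simp
  have GB: "G (V x) = V (G x)" "H (B x) = B (H x)" "G (B x) = B (G x)" for x
    using opalg_commute[OF GH(1) V, of x] opalg_commute[OF GH(2) B, of x] opalg_commute[OF GH(1) B, of x] comm
    by simp_all
  have HB: "(B ^^ p) (H x) = H ((B ^^ p) x)" "(B ^^ p) (G x) = G ((B ^^ p) x)" for x
    using GB by (simp_all add: funpow_commute)
  have H0: "H 0 = 0" "G 0 = 0" using opalg_bop[OF _ V B] GH bop_0 by blast+
  have DZ: "(?D ^^ (1 + p)) z = V (G z)" if "z \<in> ?Z" for z
    using that H0 unfolding GH(3) HB by simp
  have Dinj: "x = 0" if "(?D ^^ k) x = 0" for x k
    using that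
  proof (induction k)
    case (Suc k)
    then have "?D ((?D ^^ k) x) = ?D 0" using bop_0[OF Db] by simp
    then have "(?D ^^ k) x = 0" using bij_is_inj[OF D] injD by metis
    then show ?case by (rule Suc.IH)
  qed simp
  have Dsurj: "\<exists>x. (?D ^^ k) x = y" for y k
  proof -
    have "surj (?D ^^ k)" using bij_is_surj[OF D] by (rule surj_fn)
    from surjD[OF this, of y] obtain x where "y = (?D ^^ k) x" by blast
    then show ?thesis by blast
  qed
  show "z = 0" if "(B ^^ p) z = 0" "V z = 0"
  proof -
    have "V (G z) = 0" using GB(1)[of z] that(2) H0(2) by simp
    then have "(?D ^^ (1 + p)) z = 0" using DZ[of z] that(1) by (simp del: funpow.simps)
    then show ?thesis by (rule Dinj)
  qed
  show "V ` ?Z = ?Z"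
  proof
    show "V ` ?Z \<subseteq> ?Z" using VB bop_0[OF V] by auto
    show "?Z \<subseteq> V ` ?Z"
    proof
      fix y assume y: "y \<in> ?Z"
      obtain x where x: "(?D ^^ (1 + p)) x = y" using Dsurj by blast
      have DB: "?D (B x) = B (?D x)" for x by (simp add: comm bop_add[OF B])
      \<comment> \<open>The preimage of a point of \<open>?Z\<close> under the bijection lies in
        \<open>?Z\<close> again, because the bijection commutes with \<open>B^p\<close>.\<close>
      have "(?D ^^ (1 + p)) ((B ^^ p) x) = (B ^^ p) ((?D ^^ (1 + p)) x)"
      proof -
        have "?D ((B ^^ p) x) = (B ^^ p) (?D x)" for x
          using funpow_commute[of B ?D p x] DB by simp
        then show ?thesis by (rule funpow_commute)
      qed
      then have "(?D ^^ (1 + p)) ((B ^^ p) x) = 0" using x y by simp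
      then have "(B ^^ p) x = 0" by (rule Dinj)
      then have xZ: "x \<in> ?Z" by simp
      then have "y = V (G x)" using DZ x by simp
      moreover have "G x \<in> ?Z" using xZ HB H0 by simp
      ultimately show "y \<in> V ` ?Z" by blast
    qed
  qed
qed

section \<open>The main theorem\<close>

lemma spectrum_zero: "spectrum_k sc k (\<lambda>x. 0) = {}"
proof -
  have Z: "bop sc (\<lambda>x. 0)" by (rule bop_zero)
  have "pole (shift sc (\<lambda>x. 0) l)" for l
  proof (cases "l = 0")
    case True
    have "range ((\<lambda>x::'a. 0::'a) ^^ 1) = range ((\<lambda>x::'a. 0::'a) ^^ Suc 1)"
      "{x. ((\<lambda>x::'a. 0::'a) ^^ 1) x = 0} = {x. ((\<lambda>x::'a. 0::'a) ^^ Suc 1) x = 0}" by auto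
    with True show ?thesis unfolding pole_def by (simp only: shift_0) blast
  next
    case False
    have "bij (shift sc (\<lambda>x. 0) l)"
    proof (rule bij_shiftI[OF Z])
      show "\<exists>x. 0 - sc l x = y" for y using False by (intro exI[of _ "sc (- (1 / l)) y"]) simp
    qed (use False in auto)
    then have b: "inj (shift sc (\<lambda>x. 0) l)" "surj (shift sc (\<lambda>x. 0) l)" by (auto simp: bij_def)
    have "shift sc (\<lambda>x. 0) l x = 0 \<longleftrightarrow> x = 0" for x using False by (simp add: shift_def)
    then have "range (shift sc (\<lambda>x. 0) l ^^ 0) = range (shift sc (\<lambda>x. 0) l ^^ Suc 0)"
      "{x. (shift sc (\<lambda>x. 0) l ^^ 0) x = 0} = {x. (shift sc (\<lambda>x. 0) l ^^ Suc 0) x = 0}"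
      using b(2) by auto
    then show ?thesis unfolding pole_def by blast
  qed
  then show ?thesis using pole_imp_spec_prop[OF bop_shift[OF Z]] by (simp add: spectrum_k_def)
qed

text \<open>\<open>T + m F\<close> commutes with \<open>F\<close> again, so the invariance can be
  applied repeatedly and large multiples of \<open>F\<close> become available.\<close>

lemma spectrum_iterate:
  assumes F: "bop sc F" and inv: "\<And>T. bop sc T \<Longrightarrow> T \<circ> F = F \<circ> T \<Longrightarrow> spectrum_k sc k (opadd T F) = spectrum_k sc k T"
    and T: "bop sc T" "T \<circ> F = F \<circ> T"
  shows "spectrum_k sc k (\<lambda>x. T x + sc (of_nat m) (F x)) = spectrum_k sc k T"
proof (induction m)
  case (Suc m)
  let ?S = "\<lambda>x. T x + sc (of_nat m) (F x)"
  have c: "T (F x) = F (T x)" for x using T(2) by (metis comp_apply)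
  have S: "bop sc ?S" using T(1) bop_sc[OF F] by (rule bop_plus)
  have "?S \<circ> F = F \<circ> ?S" by (auto simp: c bop_add[OF F] bop_scale[OF F])
  then have "spectrum_k sc k (opadd ?S F) = spectrum_k sc k T" using inv[OF S] Suc by simp
  moreover have "opadd ?S F = (\<lambda>x. T x + sc (of_nat (Suc m)) (F x))"
    by (simp add: opadd_def scale_left_distrib ac_simps)
  ultimately show ?case by simp
qed simp

theorem power_finite_rank_if_spectrum_invariant:
  assumes F: "bop sc F"
    and inv: "\<And>T. bop sc T \<Longrightarrow> T \<circ> F = F \<circ> T \<Longrightarrow> spectrum_k sc k (opadd T F) = spectrum_k sc k T"
  shows "\<exists>n. finite_rank sc (F ^^ n)"
proof (rule ccontr)
  assume "\<nexists>n. finite_rank sc (F ^^ n)"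
  then have nfr: "\<not> finite_rank sc (F ^^ n)" for n by blast
  have "spectrum_k sc k (opadd (\<lambda>x. 0) F) = spectrum_k sc k (\<lambda>x. 0)"
    using bop_0[OF F] by (intro inv bop_zero) auto
  then have "spectrum_k sc k F = {}" by (simp add: opadd_def spectrum_zero)
  then have W: "uniform_descent (shift sc F l)" for l
    using spec_prop_imp_uniform_descent[OF bop_shift[OF F]] by (auto simp: spectrum_k_def)
  note poleF = uniform_descent_everywhere(1)[OF F W]
  obtain l n where l: "l \<noteq> 0" "qdim {x. (shift sc F l ^^ n) x = 0} {0} = \<infinity>"
    using infinite_dim_eigenspace[OF F W nfr] by blast
  define N where "N = shift sc F l"
  have N: "bop sc N" "pole N" using bop_shift[OF F] poleF by (auto simp: N_def)
  obtain T p where T: "bop sc T" "\<And>x. T (N x) = N (T x)" "\<And>x. T ((N ^^ p) x) = 0"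
    "infinite {m. \<not> bij (shift sc T m)}" and p: "{x. N x = 0} \<inter> range (N ^^ p) \<subseteq> {0}"
    "range (N ^^ p) = range (N ^^ Suc p)"
    using commuting_infinite_spectrum[OF N l(2)[folded N_def]] by blast
  have FN: "F x = N x + sc l x" for x by (simp add: N_def shift_def)
  have TF: "T (F x) = F (T x)" for x by (simp add: FN T(2) bop_add[OF T(1)] bop_scale[OF T(1)])
  obtain \<mu> where \<mu>: "\<not> uniform_descent (shift sc T \<mu>)"
    using uniform_descent_everywhere(2)[OF T(1)] T(4) by blast
  obtain R where R: "R > 0" "\<And>c. cmod c > R \<Longrightarrow> bij (shift sc T c)" using bij_shift_large[OF T(1)] by blast
  \<comment> \<open>Large enough for \<open>m l - \<mu>\<close> to leave the disc of radius
    \<open>R\<close> outside which all points are regular for \<open>T\<close>.\<close>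
  obtain m :: nat where m: "real m > (R + cmod \<mu>) / cmod l" using reals_Archimedean2 by blast
  have ml: "real m * cmod l > R + cmod \<mu>" using m l(1) by (simp add: field_simps)
  have m0: "m \<noteq> 0"
  proof
    assume "m = 0"
    then have "R + cmod \<mu> < 0" using ml by simp
    then show False using R(1) norm_ge_zero[of \<mu>] by linarith
  qed
  define c where "c = of_nat m * l - \<mu>"
  have "cmod (of_nat m * l) - cmod \<mu> \<le> cmod c" unfolding c_def by (rule norm_triangle_ineq2)
  then have c: "cmod (- c) > R" using ml by (simp add: norm_mult)
  \<comment> \<open>\<open>V = T + m F - \<mu>\<close> is the operator to be analysed. Since
    \<open>F = N + l\<close>, adding \<open>B = - m N\<close> turns it into the invertible
    \<open>T + c\<close>, and \<open>B\<close> is nilpotent on the generalised kernel.\<close>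
  define A where "A x = sc (of_nat m) (F x) - sc \<mu> x" for x
  define B where "B x = sc (- of_nat m) (N x)" for x
  define V where "V x = T x + A x" for x
  have A: "bop sc A" unfolding A_def using F by (intro bop_sub bop_sc bop_id)
  have B: "bop sc B" unfolding B_def using N(1) by (rule bop_sc)
  have V: "bop sc V" unfolding V_def using T(1) A by (rule bop_plus)
  have FNc: "F (N x) = N (F x)" for x by (simp add: FN bop_add[OF N(1)] bop_scale[OF N(1)])
  have AN: "A (N x) = N (A x)" for x
    by (simp add: A_def FNc bop_diff[OF N(1)] bop_scale[OF N(1)])
  have VN: "V (N x) = N (V x)" for x by (simp add: V_def AN T(2) bop_add[OF N(1)])
  have VB: "V (B x) = B (V x)" for x by (simp add: B_def VN bop_scale[OF V] bop_minus[OF V])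
  have poleA: "pole A" unfolding A_def[abs_def] using F poleF m0 by (intro pole_scaled_shift) auto
  have D: "(\<lambda>x. V x + B x) = shift sc T (- c)"
    by (auto simp: V_def A_def B_def c_def shift_def FN scale_right_distrib scale_left_diff_distrib)
  have bD: "bij (\<lambda>x. V x + B x)" unfolding D using R(2)[OF c] .
  have Bp: "(B ^^ k) x = sc ((- of_nat m) ^ k) ((N ^^ k) x)" for k x
    by (induction k) (simp_all add: B_def bop_scale[OF N(1)])
  have ZB: "{x. (B ^^ p) x = 0} = {x. (N ^^ p) x = 0}" unfolding Bp using m0 by simp
  let ?Z = "{x. (N ^^ p) x = 0}"
  have Np: "bop sc (N ^^ p)" using N(1) by (rule bop_funpow)
  have st: "(N ^^ p) ` UNIV = (N ^^ Suc p) ` UNIV" using p(2) .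
  have dec: "UNIV = {(N ^^ p) x + z | x z. x \<in> UNIV \<and> z \<in> ?Z \<inter> UNIV}" and int: "range (N ^^ p) \<inter> ?Z \<subseteq> {0}"
    using closed_stable_image(2,3)[OF N(1) subspace_UNIV closed_UNIV _ st] p(1) by auto
  \<comment> \<open>On the range of \<open>N^p\<close> the operator \<open>T\<close> vanishes, which
    leaves the scaled shift \<open>A\<close> of \<open>F\<close>; on \<open>?Z\<close> the operator
    \<open>V\<close> is the invertible \<open>T + c\<close> minus the commuting nilpotent
    \<open>B\<close>.\<close>
  have "pole V"
  proof (rule pole_decompose[OF V A poleA Np _ subspace_ker[OF Np]])
    show "(N ^^ p) (A x) = A ((N ^^ p) x)" for x using AN by (intro funpow_commute) simp
    show "V ` ?Z = ?Z" using nilpotent_perturbation_bijective(1)[OF V B VB bD, of p] unfolding ZB .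
    show "z = 0" if "z \<in> ?Z" "V z = 0" for z
      using nilpotent_perturbation_bijective(2)[OF V B VB bD, of p z] that ZB by blast
    show "V ((N ^^ p) x) = A ((N ^^ p) x)" for x by (simp add: V_def T(3))
    show "\<exists>y z. z \<in> ?Z \<and> x = (N ^^ p) y + z" for x
    proof -
      have "x \<in> {(N ^^ p) x + z | x z. x \<in> UNIV \<and> z \<in> ?Z \<inter> UNIV}" using dec by blast
      then show ?thesis by blast
    qed
  qed (use int in blast)
  then have "spec_prop sc k V" using V pole_imp_spec_prop by blast
  moreover have "V = shift sc (\<lambda>x. T x + sc (of_nat m) (F x)) \<mu>" by (auto simp: V_def A_def shift_def)
  ultimately have "\<mu> \<notin> spectrum_k sc k (\<lambda>x. T x + sc (of_nat m) (F x))" by (simp add: spectrum_k_def)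
  moreover have "T \<circ> F = F \<circ> T" using TF by auto
  ultimately have "\<mu> \<notin> spectrum_k sc k T" using spectrum_iterate[OF F inv T(1)] by blast
  then have "spec_prop sc k (shift sc T \<mu>)" by (simp add: spectrum_k_def)
  with \<mu> show False using spec_prop_imp_uniform_descent[OF bop_shift[OF T(1)]] by blast
qed

end

theorem theorem2p19:
  fixes sc :: "complex \<Rightarrow> 'a::banach \<Rightarrow> 'a"
    and F :: "'a \<Rightarrow> 'a"
    and k :: spec_kind
  assumes "complex_banach_scale sc"
    and "cdim sc (UNIV :: 'a set) = \<infinity>"
    and "bop sc F"
  shows "(\<exists>n. finite_rank sc (F ^^ n)) \<longleftrightarrow>
         (\<forall>T. bop sc T \<and> T \<circ> F = F \<circ> T \<longrightarrow>
               spectrum_k sc k (opadd T F) = spectrum_k sc k T)"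
proof -
  interpret cbanach sc using assms(1) by unfold_locales
  show ?thesis
  proof
    assume "\<exists>n. finite_rank sc (F ^^ n)"
    then show "\<forall>T. bop sc T \<and> T \<circ> F = F \<circ> T \<longrightarrow> spectrum_k sc k (opadd T F) = spectrum_k sc k T"
      using spectrum_power_finite_rank_invariant[OF assms(3)] by blast
  next
    assume "\<forall>T. bop sc T \<and> T \<circ> F = F \<circ> T \<longrightarrow> spectrum_k sc k (opadd T F) = spectrum_k sc k T"
    then show "\<exists>n. finite_rank sc (F ^^ n)"
      using power_finite_rank_if_spectrum_invariant[OF assms(3)] by blast
  qed
qed

end
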